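(* Let $X(\underline{x})$, $\underline{x}\in\mathbb{R}^2$, be a homogenous and isotropic stochastic field on the plane with fourth order cumulant function $\mathcal{C}_4$ and trispectrum $S_4$. Then $$\mathcal{C}_{4}\left((r_2,\varphi_2),(r_3,\varphi_3),r_{4}\right)=4\int_0^\infty\!\int_0^\infty\!\int_0^\infty\int_0^\pi\!\int_0^\pi \mathcal{T}_{4}\left(\alpha_1,\rho_{2:4},\beta_2\,\middle|\,(r,\varphi)_{2:3},r_4\right) S_4\left(\alpha_1,\rho_{2:4},\beta_2\right)\,d\alpha_1\,d\beta_2\prod_{k=2}^4\rho_k\,d\rho_k ,$$ and, in return, $$S_4\left(\alpha_1,\rho_{2:4},\beta_2\right)=\frac{1}{(2\pi)^4}\int_0^\infty\!\int_0^\infty\!\int_0^\infty\int_0^{2\pi}\!\int_0^{2\pi}\mathcal{T}_{4}\left(\alpha_1,\rho_{2:4},\beta_2\,\middle|\,(r,\varphi)_{2:3},r_4\right)\mathcal{C}_4\left((r_2,\varphi_2),(r_3,\varphi_3),r_4\right)\,d\varphi_2\,d\varphi_3\prod_{k=2}^4 r_k\,dr_k ,$$ provided that the integrals exist.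
   Context: Field. $X(\underline{x})$, $\underline{x}\in\mathbb{R}^2$, is a real valued, mean square continuous stochastic field with $EX(\underline{x})=0$, all of whose moments exist. Homogenous means that all finite dimensional distributions are translation invariant; isotropic means that all finite dimensional distributions are invariant under rotations $g\in SO(2)$. It has the spectral representation $X(\underline{x})=\int_{\mathbb{R}^2}e^{i\underline{x}\cdot\underline{\omega}}Z(d\underline{\omega})$ with a stochastic spectral measure $Z$. $\operatorname{Cum}$ denotes the joint cumulant. Trispectrum. It is assumed that the fourth order cumulants have the spectral representation $$\operatorname{Cum}(X(\underline{x}_1),\dots,X(\underline{x}_4))=\int_{(\mathbb{R}^2)^4}e^{i\sum_{k=1}^4\underline{x}_k\cdot\underline{\omega}_k}\,S_4(\underline{\omega}_1,\dots,\underline{\omega}_4)\,\delta\Big(\sum_{k=1}^4\underline{\omega}_k\Big)\prod_{k=1}^4 d\underline{\omega}_k ,$$ where $\delta$ is the Dirac distribution on $\mathbb{R}^2$; $S_4$ is the trispectrum. By isotropy $S_4$ is regarded as a function of the invariants of the quadrilateral formed by $\underline{\omega}_1,\dots,\underline{\omega}_4$ with $\sum_k\underline{\omega}_k=0$, written $S_4(\underline{\omega}_1,\dots,\underline{\omega}_4)=S_4(\alpha_1,\rho_2,\rho_3,\rho_4,\beta_2)=S_4(\alpha_1,\rho_{2:4},\beta_2)$. Here $\rho_k=|\underline{\omega}_k|>0$, $\kappa=|\underline{\omega}_1+\underline{\omega}_2|=|\underline{\omega}_3+\underline{\omega}_4|$ is the diagonal, $\alpha_1\in(0,\pi)$ is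 the angle opposite to $\rho_1$ in the triangle with sides $\rho_1,\rho_2,\kappa$, and $\beta_2\in(0,\pi)$ is the angle opposite to $\kappa$ in the triangle with sides $\kappa,\rho_3,\rho_4$. Cumulant function. For $r_2,r_3,r_4>0$ and $\varphi_2,\varphi_3\in[0,2\pi)$, with $\underline{x}_k=(r_k\cos\varphi_k,r_k\sin\varphi_k)$ for $k=2,3$ and $\underline{n}=(1,0)$, $$\mathcal{C}_4\left((r_2,\varphi_2),(r_3,\varphi_3),r_4\right)=\operatorname{Cum}\left(X(\underline{0}),X(\underline{x}_2),X(\underline{x}_3),X(r_4\underline{n})\right).$$ Kernel. With $J_\ell$ the Bessel function of the first kind, $$\mathcal{T}_{4}\left(\alpha_1,\rho_{2:4},\beta_2\,\middle|\,(r,\varphi)_{2:3},r_4\right)=\sum_{\ell_2,\ell_3=-\infty}^{\infty}e^{i(\ell_2\varphi_2+\ell_3\varphi_3)}J_{\ell_2}(\rho_2r_2)J_{\ell_3}(\rho_3r_3)J_{\ell_2+\ell_3}(\rho_4r_4)\cos(\ell_2\alpha_1)\cos(\ell_2\alpha_3-\ell_3\beta_2),$$ where $\kappa=\sqrt{\rho_3^2+\rho_4^2-2\rho_3\rho_4\cos\beta_2}$ and $\alpha_3\in(0,\pi)$ is the angle opposite to $\rho_3$ in the triangle with sides $\kappa,\rho_3,\rho_4$, i.e. $\cos\alpha_3=(\kappa^2+\rho_4^2-\rho_3^2)/(2\kappa\rho_4)$.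
   Formalization: The Dirac distribution has mass c>0 and the constants 4 and 1/(2π)^4 become 2πc·4 and 1/(2πc)·1/(2π)^4 (the printed ones for c=1/(2π)); the formula for S_4 is asserted for almost every argument and at every continuity point of S_4. *)

theory Defs
  imports "HOL-Probability.Probability"
begin

section \<open>Homogeneous and isotropic fields on the plane\<close>

locale planar_field = prob_space M
  for M :: "'a measure" and X :: "real^2 \<Rightarrow> 'a \<Rightarrow> real" +
  assumes measurable_field: "X x \<in> borel_measurable M"
    and moments_exist: "integrable M (\<lambda>w. X x w ^ n)"
    and centred: "(LINT w|M. X x w) = 0"
    and mean_square_continuous: "((\<lambda>y. LINT w|M. (X y w - X x w)\<^sup>2) \<longlongrightarrow> 0) (at x)"

definition fin_dim_distr ::
    "'a measure \<Rightarrow> (real^2 \<Rightarrow> 'a \<Rightarrow> real) \<Rightarrow> nat \<Rightarrow> (nat \<Rightarrow> real^2) \<Rightarrow> (nat \<Rightarrow> real) measure" where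
  "fin_dim_distr M X n x =
     distr M (Pi\<^sub>M {..<n} (\<lambda>_. borel)) (\<lambda>w. \<lambda>i\<in>{..<n}. X (x i) w)"

definition homogeneous :: "'a measure \<Rightarrow> (real^2 \<Rightarrow> 'a \<Rightarrow> real) \<Rightarrow> bool" where
  "homogeneous M X \<longleftrightarrow>
     (\<forall>n x t. fin_dim_distr M X n (\<lambda>i. x i + t) = fin_dim_distr M X n x)"

definition isotropic :: "'a measure \<Rightarrow> (real^2 \<Rightarrow> 'a \<Rightarrow> real) \<Rightarrow> bool" where
  "isotropic M X \<longleftrightarrow>
     (\<forall>n x. \<forall>g :: real^2^2. rotation_matrix g \<longrightarrow>
        fin_dim_distr M X n (\<lambda>i. g *v x i) = fin_dim_distr M X n x)"

section \<open>Joint cumulants\<close>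

text \<open>The joint cumulant of the family \<open>Y i\<close>, \<open>i \<in> I\<close>, given by the moments--cumulants
  formula: a sum over all partitions of the finite index set.\<close>

definition joint_cumulant :: "'a measure \<Rightarrow> 'i set \<Rightarrow> ('i \<Rightarrow> 'a \<Rightarrow> real) \<Rightarrow> real" where
  "joint_cumulant M I Y =
     (\<Sum>P | partition_on I P.
        (- 1) ^ (card P - 1) * fact (card P - 1) * (\<Prod>B\<in>P. LINT w|M. (\<Prod>i\<in>B. Y i w)))"

definition cum4 ::
    "'a measure \<Rightarrow> (real^2 \<Rightarrow> 'a \<Rightarrow> real) \<Rightarrow> real^2 \<Rightarrow> real^2 \<Rightarrow> real^2 \<Rightarrow> real^2 \<Rightarrow> real" where
  "cum4 M X x1 x2 x3 x4 = joint_cumulant M {..<4::nat} (\<lambda>k. X ([x1, x2, x3, x4] ! k))"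

definition C4 ::
    "'a measure \<Rightarrow> (real^2 \<Rightarrow> 'a \<Rightarrow> real) \<Rightarrow> real \<times> real \<Rightarrow> real \<times> real \<Rightarrow> real \<Rightarrow> real" where
  "C4 M X = (\<lambda>(r2, \<phi>2) (r3, \<phi>3) r4.
     cum4 M X 0 (vector [r2 * cos \<phi>2, r2 * sin \<phi>2]) (vector [r3 * cos \<phi>3, r3 * sin \<phi>3])
       (r4 *\<^sub>R vector [1, 0]))"

section \<open>The trispectrum\<close>

text \<open>The angle opposite to the side \<open>a\<close> in a triangle with sides \<open>a\<close>, \<open>b\<close>, \<open>c\<close>.\<close>

definition opposite_angle :: "real \<Rightarrow> real \<Rightarrow> real \<Rightarrow> real" where
  "opposite_angle a b c = arccos ((b\<^sup>2 + c\<^sup>2 - a\<^sup>2) / (2 * b * c))"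

text \<open>The invariants \<open>(\<alpha>\<^sub>1, \<rho>\<^sub>2, \<rho>\<^sub>3, \<rho>\<^sub>4, \<beta>\<^sub>2)\<close> of the closed quadrilateral with sides
  \<open>\<omega>\<^sub>1, \<dots>, \<omega>\<^sub>4\<close>, and their range. For a closed quadrilateral the invariants lie in this
  range exactly when both triangles cut out by the diagonal are non-degenerate; in particular
  \<open>\<omega>\<^sub>1 = 0\<close> gives \<open>\<alpha>\<^sub>1 = 0\<close> or \<open>\<rho>\<^sub>2 = 0\<close>, and a vanishing diagonal gives \<open>\<beta>\<^sub>2 = 0\<close> or
  \<open>\<rho>\<^sub>3 = 0\<close>.\<close>

definition quad_invariants ::
    "real^2 \<Rightarrow> real^2 \<Rightarrow> real^2 \<Rightarrow> real^2 \<Rightarrow> real \<times> real \<times> real \<times> real \<times> real" where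
  "quad_invariants \<omega>1 \<omega>2 \<omega>3 \<omega>4 =
     (let \<kappa> = norm (\<omega>1 + \<omega>2)
      in (opposite_angle (norm \<omega>1) (norm \<omega>2) \<kappa>, norm \<omega>2, norm \<omega>3, norm \<omega>4,
          opposite_angle \<kappa> (norm \<omega>3) (norm \<omega>4)))"

definition invariant_range :: "(real \<times> real \<times> real \<times> real \<times> real) set" where
  "invariant_range = {0<..<pi} \<times> {0<..} \<times> {0<..} \<times> {0<..} \<times> {0<..<pi}"

text \<open>\<open>S4\<close> is a density in the spectral representation of the fourth order cumulants with
  respect to \<open>\<delta>(\<omega>\<^sub>1 + \<dots> + \<omega>\<^sub>4) d\<omega>\<^sub>1 \<dots> d\<omega>\<^sub>4\<close>, where \<open>\<delta>\<close> is the Dirac distribution on the plane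
  with total mass \<open>c\<close>; it is used to integrate out \<open>\<omega>\<^sub>1 = -(\<omega>\<^sub>2 + \<omega>\<^sub>3 + \<omega>\<^sub>4)\<close>. The usual unit
  mass is \<open>c = 1\<close>. Integrating a rotation invariant function over the common rotation of the
  quadrilateral contributes a factor \<open>2 * pi\<close>, so that constants of the transform pair between
  cumulants and trispectrum that do not show this factor belong to \<open>c = 1 / (2 * pi)\<close>.\<close>

definition has_trispectrum ::
    "real \<Rightarrow> 'a measure \<Rightarrow> (real^2 \<Rightarrow> 'a \<Rightarrow> real)
       \<Rightarrow> (real^2 \<Rightarrow> real^2 \<Rightarrow> real^2 \<Rightarrow> real^2 \<Rightarrow> complex) \<Rightarrow> bool" where
  "has_trispectrum c M X S4 \<longleftrightarrow>
     (\<forall>x1 x2 x3 x4.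
        let f = (\<lambda>(\<omega>2, \<omega>3, \<omega>4).
          let \<omega>1 = - (\<omega>2 + \<omega>3 + \<omega>4)
          in cis (x1 \<bullet> \<omega>1 + x2 \<bullet> \<omega>2 + x3 \<bullet> \<omega>3 + x4 \<bullet> \<omega>4) * S4 \<omega>1 \<omega>2 \<omega>3 \<omega>4)
        in integrable lborel f \<and>
           complex_of_real (cum4 M X x1 x2 x3 x4) = complex_of_real c * (LINT \<omega>|lborel. f \<omega>))"

definition function_of_invariants ::
    "(real^2 \<Rightarrow> real^2 \<Rightarrow> real^2 \<Rightarrow> real^2 \<Rightarrow> complex)
       \<Rightarrow> (real \<times> real \<times> real \<times> real \<times> real \<Rightarrow> complex) \<Rightarrow> bool" where
  "function_of_invariants S4 s \<longleftrightarrow>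
     (\<forall>\<omega>1 \<omega>2 \<omega>3 \<omega>4.
        \<omega>1 + \<omega>2 + \<omega>3 + \<omega>4 = 0 \<and> quad_invariants \<omega>1 \<omega>2 \<omega>3 \<omega>4 \<in> invariant_range
        \<longrightarrow> S4 \<omega>1 \<omega>2 \<omega>3 \<omega>4 = s (quad_invariants \<omega>1 \<omega>2 \<omega>3 \<omega>4))"

section \<open>The kernel\<close>

text \<open>The power series of the Bessel function of the first kind. Since \<open>rGamma\<close> vanishes at the
  non-positive integers, it also covers negative orders.\<close>

definition bessel_J :: "int \<Rightarrow> real \<Rightarrow> real" where
  "bessel_J l z =
     (\<Sum>m. (- 1) ^ m / fact m * rGamma (of_int (int m + l + 1)) * (z / 2) powi (2 * int m + l))"

definition T4 ::
    "real \<times> real \<times> real \<times> real \<times> real \<Rightarrow> real \<times> real \<Rightarrow> real \<times> real \<Rightarrow> real \<Rightarrow> complex" where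
  "T4 = (\<lambda>(\<alpha>1, \<rho>2, \<rho>3, \<rho>4, \<beta>2) (r2, \<phi>2) (r3, \<phi>3) r4.
     let \<kappa> = sqrt (\<rho>3\<^sup>2 + \<rho>4\<^sup>2 - 2 * \<rho>3 * \<rho>4 * cos \<beta>2);
         \<alpha>3 = opposite_angle \<rho>3 \<kappa> \<rho>4
     in \<Sum>\<^sub>\<infinity>(l2, l3)\<in>UNIV.
          cis (of_int l2 * \<phi>2 + of_int l3 * \<phi>3)
          * complex_of_real
              (bessel_J l2 (\<rho>2 * r2) * bessel_J l3 (\<rho>3 * r3) * bessel_J (l2 + l3) (\<rho>4 * r4)
               * cos (of_int l2 * \<alpha>1) * cos (of_int l2 * \<alpha>3 - of_int l3 * \<beta>2)))"

text \<open>The range of the spatial coordinates \<open>(r\<^sub>2, \<phi>\<^sub>2, r\<^sub>3, \<phi>\<^sub>3, r\<^sub>4)\<close>.\<close>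

definition space_range :: "(real \<times> real \<times> real \<times> real \<times> real) set" where
  "space_range = {0<..} \<times> {0..<2 * pi} \<times> {0<..} \<times> {0..<2 * pi} \<times> {0<..}"

definition cumulant_integrand ::
    "(real \<times> real \<times> real \<times> real \<times> real \<Rightarrow> complex) \<Rightarrow> real \<times> real \<Rightarrow> real \<times> real \<Rightarrow> real
       \<Rightarrow> real \<times> real \<times> real \<times> real \<times> real \<Rightarrow> complex" where
  "cumulant_integrand s p2 p3 r4 = (\<lambda>(\<alpha>1, \<rho>2, \<rho>3, \<rho>4, \<beta>2).
     T4 (\<alpha>1, \<rho>2, \<rho>3, \<rho>4, \<beta>2) p2 p3 r4 * s (\<alpha>1, \<rho>2, \<rho>3, \<rho>4, \<beta>2)
     * complex_of_real (\<rho>2 * \<rho>3 * \<rho>4))"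

definition trispectrum_integrand ::
    "'a measure \<Rightarrow> (real^2 \<Rightarrow> 'a \<Rightarrow> real) \<Rightarrow> real \<times> real \<times> real \<times> real \<times> real
       \<Rightarrow> real \<times> real \<times> real \<times> real \<times> real \<Rightarrow> complex" where
  "trispectrum_integrand M X q = (\<lambda>(r2, \<phi>2, r3, \<phi>3, r4).
     T4 q (r2, \<phi>2) (r3, \<phi>3) r4 * complex_of_real (C4 M X (r2, \<phi>2) (r3, \<phi>3) r4)
     * complex_of_real (r2 * r3 * r4))"

end

theory Submission
  imports Defs
begin

text \<open>
  The value of \<open>s\<close> at \<open>q = (\<alpha>\<^sub>1, \<rho>\<^sub>2, \<rho>\<^sub>3, \<rho>\<^sub>4, \<beta>\<^sub>2)\<close> is the common value of the spectral density on all
  closed quadrilaterals with invariants \<open>q\<close>. Such a quadrilateral is determined by the direction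
  \<open>\<theta>\<close> of \<open>\<omega>\<^sub>4\<close> and by two signs: the two triangles on either side of the diagonal can be reflected
  independently, because the invariants only record unoriented angles. The map \<open>quad_frame\<close>
  parametrises them, and in these coordinates Lebesgue measure for \<open>(\<omega>\<^sub>2, \<omega>\<^sub>3, \<omega>\<^sub>4)\<close> becomes the sum over the
  four sign pairs of \<open>\<rho>\<^sub>2 \<rho>\<^sub>3 \<rho>\<^sub>4\<close> times Lebesgue measure in \<open>\<theta>\<close> and \<open>q\<close> (\<open>integral_quad_frame\<close>).

  The kernel \<open>T4\<close> is the mean of the plane waves over these quadrilaterals
  (\<open>T4_integral\<close>). Indeed each plane wave in polar coordinates is the generating function of
  the Bessel functions, and integrating the product of three such series over the common rotation
  \<open>\<theta>\<close> keeps only the terms with \<open>l\<^sub>4 = l\<^sub>2 + l\<^sub>3\<close>; the sum over the signs turns the remaining exponentials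
  into \<open>4 cos (l\<^sub>2 \<alpha>\<^sub>1) cos (l\<^sub>2 \<alpha>\<^sub>3 - l\<^sub>3 \<beta>\<^sub>2)\<close>. The formula for the cumulant is then the spectral
  representation, written in these coordinates, with the \<open>\<theta>\<close>-integral carried out first
  (\<open>fourier_of_function_of_invariants\<close>).

  For the inverse formula the ordinary Fourier inversion theorem does not apply: absolute convergence of the
  integral of \<open>T4\<close> times the cumulant at one \<open>q\<close> does not make the cumulant integrable, since \<open>T4\<close>
  decays in the space variables. Instead the cumulant is multiplied by \<open>exp (- e\<^sup>2 |x|\<^sup>2 / 2)\<close>. For every \<open>e > 0\<close>,
  integrating it against the plane waves of the four quadrilaterals gives the
  convolution of the spectral density with a Gaussian of width \<open>e\<close> at these four points
  (\<open>fourier_gauss_smooth\<close>). On the other hand the cumulant is invariant under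
  rotations, by isotropy of the field, so the common rotation of the space variables can be integrated out, and this
  produces \<open>T4\<close> (\<open>fourier_of_rotation_invariant\<close>). As \<open>e\<close> tends to zero, the assumed
  integrability dominates the space integral, and the convolution tends to the spectral density at
  its points of continuity and, because the density is integrable, along a subsequence almost
  everywhere (\<open>gauss_smooth_AE_subseq\<close>). This gives the two versions of the inverse formula
  (\<open>trispectrum_inversion\<close>).
\<close>

section \<open>Bessel functions and the angular integral of three plane waves\<close>

lemma has_sum_product_complex:
  fixes f g :: "_ \<Rightarrow> complex"
  assumes f: "(f has_sum a) A" and g: "(g has_sum b) B"
  shows "((\<lambda>(x, y). f x * g y) has_sum (a * b)) (A \<times> B)"
proof (rule has_sum_SigmaI)
  show "((\<lambda>y. case (x, y) of (x, y) \<Rightarrow> f x * g y) has_sum f x * b) B" for x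
    using has_sum_cmult_right[OF g, of "f x"] by simp
  show "((\<lambda>x. f x * b) has_sum a * b) A"
    by (rule has_sum_cmult_left[OF f])
  have fg: "(\<lambda>x. norm (f x)) summable_on A" "(\<lambda>x. norm (g x)) summable_on B"
    using f g by (simp_all add: has_sum_imp_summable flip: summable_on_iff_abs_summable_on_complex)
  have "(\<lambda>z. norm (case z of (x, y) \<Rightarrow> f x * g y)) summable_on A \<times> B"
  proof (rule iffD2[OF Infinite_Sum.abs_summable_on_Sigma_iff], intro conjI ballI)
    have eq: "norm (case (x, y) of (x, y) \<Rightarrow> f x * g y) = norm (f x) * norm (g y)" for x y
      by (simp add: norm_mult)
    show "(\<lambda>y. norm (case (x, y) of (x, y) \<Rightarrow> f x * g y)) summable_on B" for x
      unfolding eq by (rule summable_on_cmult_right[OF fg(2)])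
    have "norm (\<Sum>\<^sub>\<infinity>y\<in>B. norm (case (x, y) of (x, y) \<Rightarrow> f x * g y)) = norm (f x) * (\<Sum>\<^sub>\<infinity>y\<in>B. norm (g y))" for x
    proof -
      have "0 \<le> (\<Sum>\<^sub>\<infinity>y\<in>B. norm (g y))"
        by (rule infsum_nonneg) simp
      then show ?thesis
        unfolding eq infsum_cmult_right'[of "norm (f x)"] by (simp add: abs_mult del: infsum_nonneg)
    qed
    then show "(\<lambda>x. norm (\<Sum>\<^sub>\<infinity>y\<in>B. norm (case (x, y) of (x, y) \<Rightarrow> f x * g y))) summable_on A"
      by (simp only: summable_on_cmult_left[OF fg(1)])
  qed
  then show "(\<lambda>(x, y). f x * g y) summable_on A \<times> B"
    by (rule abs_summable_summable)
qed

lemma has_sum_exp: "((\<lambda>n. z ^ n / fact n) has_sum exp z) (UNIV :: nat set)" for z :: complex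
  using norm_summable_imp_has_sum[OF summable_norm_exp[of z] exp_converges[of z]]
  by (simp add: scaleR_conv_of_real field_simps)

text \<open>The product of two terms of exponential series, rewritten in the summation indices \<open>n = a - b\<close> and
  \<open>m = b\<close> of the Laurent expansion: the inner sum over \<open>m\<close> is the Bessel series of order \<open>n\<close>, with
  \<open>rGamma (m + n + 1) = 1 / a!\<close>.\<close>

lemma bessel_generating_term:
  fixes z :: real
  assumes "w \<noteq> 0"
  shows "(complex_of_real z * w) ^ a / fact a * ((- complex_of_real z * inverse w) ^ b / fact b)
    = complex_of_real ((- 1) ^ b / fact b * rGamma (of_int (int b + (int a - int b) + 1))
         * z powi (2 * int b + (int a - int b))) * w powi (int a - int b)"
proof -
  have g: "rGamma (of_int (int b + (int a - int b) + 1)) = inverse (fact a :: real)"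
  proof -
    have "int b + (int a - int b) + 1 = int a + 1" by simp
    then show ?thesis by (simp only: rGamma_of_int) simp
  qed
  have p: "z powi (2 * int b + (int a - int b)) = z ^ a * z ^ b"
  proof -
    have "2 * int b + (int a - int b) = int (a + b)" by simp
    then show ?thesis by (simp only: power_int_of_nat power_add)
  qed
  have w: "w powi (int a - int b) = w ^ a * inverse w ^ b"
    using assms by (simp add: power_int_diff power_inverse divide_inverse)
  have m: "(- complex_of_real z * inverse w) ^ b = (- 1) ^ b * complex_of_real z ^ b * inverse w ^ b"
    by (simp only: power_mult_distrib power_minus[of "complex_of_real z"])
  show ?thesis
    unfolding g p w m by (simp add: power_mult_distrib divide_inverse)
qed

text \<open>The expansion of Jacobi and Anger. With \<open>w = cis u\<close>,
  \<open>cis (z sin u) = exp (z w / 2) exp (- z / (2 w))\<close>; multiplying the two exponential series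
  and collecting the powers of \<open>w\<close> gives the claim. Regrouping is legitimate because unconditional
  convergence of the double series is part of \<open>has_sum\<close>.\<close>

lemma bessel_generating_function:
  fixes z u :: real
  assumes z: "z \<noteq> 0"
  shows "((\<lambda>n. complex_of_real (bessel_J n z) * cis (of_int n * u)) has_sum cis (z * sin u)) UNIV"
proof -
  define w where "w = cis u"
  have w0: "w \<noteq> 0" by (simp add: w_def)
  define y where "y = z / 2"
  have y0: "y \<noteq> 0" using z by (simp add: y_def)
  define h where "h = (\<lambda>(n :: int, m :: nat). complex_of_real ((- 1) ^ m / fact m
      * rGamma (of_int (int m + n + 1)) * y powi (2 * int m + n)) * w powi n)"
  have "complex_of_real y * w + - complex_of_real y * inverse w = \<i> * complex_of_real (z * sin u)"
    by (simp add: w_def y_def complex_eq_iff cis_inverse)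
  then have "exp (complex_of_real y * w) * exp (- complex_of_real y * inverse w) = cis (z * sin u)"
    by (simp add: exp_add[symmetric] cis_conv_exp)
  moreover have "(\<lambda>(a, b). h (int a - int b, b)) = (\<lambda>(a, b). (complex_of_real y * w) ^ a / fact a
      * ((- complex_of_real y * inverse w) ^ b / fact b))"
    by (simp only: bessel_generating_term[OF w0] h_def prod.case)
  ultimately have "((\<lambda>(a, b). h (int a - int b, b)) has_sum cis (z * sin u)) (UNIV \<times> UNIV)"
    using has_sum_product_complex[OF has_sum_exp[of "complex_of_real y * w"] has_sum_exp[of "- complex_of_real y * inverse w"]]
    by (simp only:)
  then have "((\<lambda>x. h ((\<lambda>(a, b). (int a - int b, b)) x)) has_sum cis (z * sin u)) UNIV"
    by (simp add: split_beta')
  \<comment> \<open>Only pairs with \<open>m + n \<ge> 0\<close> occur; on the others \<open>rGamma\<close> vanishes, so the sum extends to all pairs.\<close>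
  moreover have "bij_betw (\<lambda>(a, b). (int a - int b, b)) UNIV {(n, m). int m + n \<ge> 0}"
    by (rule bij_betw_byWitness[where f'="\<lambda>(n, m). (nat (n + int m), m)"]) auto
  ultimately have "(h has_sum cis (z * sin u)) {(n, m). int m + n \<ge> 0}"
    by (subst (asm) has_sum_reindex_bij_betw)
  moreover have "h (n, m) = 0" if "int m + n < 0" for n m
  proof -
    have "\<not> 0 < int m + n + 1" using that by simp
    then show ?thesis by (simp only: h_def rGamma_of_int prod.case) simp
  qed
  ultimately have h: "(h has_sum cis (z * sin u)) UNIV"
    by (subst (asm) has_sum_cong_neutral[where T=UNIV and g=h]) (auto simp: not_le)
  have inner: "((\<lambda>m. h (n, m)) has_sum complex_of_real (bessel_J n z) * w powi n) UNIV" for n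
  proof -
    have "h summable_on (UNIV \<times> UNIV)"
      using h by (simp add: has_sum_imp_summable)
    then have "(\<lambda>m. h (n, m)) summable_on UNIV"
      using summable_on_SigmaD1[of "\<lambda>x y. h (x, y)" UNIV "\<lambda>_. UNIV" n] by (simp add: split_beta')
    then obtain S where S: "((\<lambda>m. h (n, m)) has_sum S) UNIV"
      by (auto simp: summable_on_def)
    then have hs: "((\<lambda>m. h (n, m) * inverse (w powi n)) has_sum S * inverse (w powi n)) UNIV"
      by (rule has_sum_cmult_left)
    have inv: "w powi n * inverse (w powi n) = 1"
      using w0 by simp
    have eq: "h (n, m) * inverse (w powi n) = complex_of_real ((- 1) ^ m / fact m
        * rGamma (of_int (int m + n + 1)) * y powi (2 * int m + n))" for m
      by (simp only: h_def prod.case mult.assoc inv mult_1_right)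
    have 1: "(\<lambda>m. complex_of_real ((- 1) ^ m / fact m * rGamma (of_int (int m + n + 1)) * y powi (2 * int m + n)))
        sums (S * inverse (w powi n))"
      by (rule has_sum_imp_sums) (rule hs[unfolded eq])
    then have "(\<lambda>m. Re (complex_of_real ((- 1) ^ m / fact m * rGamma (of_int (int m + n + 1)) * y powi (2 * int m + n))))
        sums Re (S * inverse (w powi n))"
      by (rule sums_Re)
    then have "(\<lambda>m. (- 1) ^ m / fact m * rGamma (of_int (int m + n + 1)) * y powi (2 * int m + n))
        sums Re (S * inverse (w powi n))"
      by (simp only: Re_complex_of_real)
    then have J: "(\<lambda>m. (- 1) ^ m / fact m * rGamma (of_int (int m + n + 1)) * y powi (2 * int m + n)) sums bessel_J n z"
      unfolding bessel_J_def y_def by (simp add: sums_iff)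
    have "S * inverse (w powi n) = complex_of_real (bessel_J n z)"
      by (rule sums_unique2[OF 1 sums_of_real[OF J]])
    then have "S = complex_of_real (bessel_J n z) * w powi n"
      using w0 by (simp add: field_simps)
    with S show ?thesis by simp
  qed
  have "((\<lambda>n. complex_of_real (bessel_J n z) * w powi n) has_sum cis (z * sin u)) UNIV"
    by (rule has_sum_SigmaD[OF _ inner]) (use h in simp)
  then show ?thesis
    by (simp add: w_def cis_power_int)
qed

text \<open>Term-by-term integration, from the Weierstrass criterion.\<close>

lemma has_sum_integral:
  fixes f :: "'i \<Rightarrow> real \<Rightarrow> complex"
  assumes c: "\<And>i. continuous_on {a..b} (f i)"
    and M: "\<And>i t. t \<in> {a..b} \<Longrightarrow> norm (f i t) \<le> M i" "M summable_on A"
    and F: "\<And>t. t \<in> {a..b} \<Longrightarrow> ((\<lambda>i. f i t) has_sum F t) A"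
  shows "((\<lambda>i. integral {a..b} (f i)) has_sum integral {a..b} F) A"
proof -
  have "uniform_limit {a..b} (\<lambda>X t. \<Sum>i\<in>X. f i t) F (finite_subsets_at_top A)"
    by (rule Weierstrass_m_test_general'[where M=M]) (use M F in auto)
  then obtain I J where I: "\<And>X. ((\<lambda>t. \<Sum>i\<in>X. f i t) has_integral I X) {a..b}"
    and J: "(F has_integral J) {a..b}" and lim: "(I \<longlongrightarrow> J) (finite_subsets_at_top A)"
    by (rule uniform_limit_integral) (auto intro!: continuous_intros c)
  have "I X = (\<Sum>i\<in>X. integral {a..b} (f i))" if "finite X" for X
    using I[of X] by (simp add: integral_sum[OF that] c integrable_continuous_real has_integral_iff)
  then have "\<forall>\<^sub>F X in finite_subsets_at_top A. (\<Sum>i\<in>X. integral {a..b} (f i)) = I X"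
    by (intro eventually_finite_subsets_at_top_weakI) simp
  then have "(sum (\<lambda>i. integral {a..b} (f i)) \<longlongrightarrow> J) (finite_subsets_at_top A)"
    using lim by (simp add: tendsto_cong)
  then show ?thesis
    using J by (simp add: has_sum_def has_integral_iff)
qed

lemma integral_cis_period:
  fixes n :: int and s b :: real
  assumes s: "s = 1 \<or> s = - 1"
  shows "integral {0..2 * pi} (\<lambda>t. cis (of_int n * (s * t + b))) = (if n = 0 then complex_of_real (2 * pi) else 0)"
proof (cases "n = 0")
  case False
  let ?k = "of_int n * s"
  have k: "?k \<noteq> 0" using False s by auto
  let ?G = "\<lambda>t. cis (of_int n * (s * t + b)) / (\<i> * complex_of_real ?k)"
  have "((\<lambda>t. cis (of_int n * (s * t + b))) has_integral ?G (2 * pi) - ?G 0) {0..2 * pi}"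
  proof (rule fundamental_theorem_of_calculus)
    fix t :: real
    have eq: "?G = (\<lambda>t. exp (\<i> * complex_of_real (of_int n * (s * t + b))) / (\<i> * complex_of_real ?k))"
      by (simp add: cis_conv_exp)
    show "(?G has_vector_derivative cis (of_int n * (s * t + b))) (at t within {0..2 * pi})"
      unfolding eq using k
      by (auto intro!: derivative_eq_intros has_vector_derivative_real_field simp: cis_conv_exp field_simps)
  qed simp
  moreover have "?G (2 * pi) = ?G 0"
  proof -
    have "cis (of_int n * (s * (2 * pi) + b)) = cis (of_int n * (s * 0 + b)) * cis (2 * pi * (of_int n * s))"
      by (simp add: cis_mult algebra_simps)
    moreover have "cis (2 * pi * (of_int n * s)) = 1"
      using s by (intro cis_multiple_2pi) auto
    ultimately show ?thesis by simp
  qed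
  ultimately show ?thesis
    using False by (simp add: integral_unique)
qed (simp add: scaleR_conv_of_real)

text \<open>The core of the kernel computation. Writing each cosine as a sine, the integrand is a product of
  three generating functions; the third one is expanded in \<open>- u\<close>, so that the integral over a period
  selects \<open>l\<^sub>4 = l\<^sub>2 + l\<^sub>3\<close>. The minus signs of the two other waves are chosen such that all
  quarter turns from the conversion of cosines to sines cancel. The argument \<open>s t + b\<close> with \<open>s = 1\<close> or
  \<open>s = - 1\<close> covers both a rotation of the space variables and a rotation of the frequencies.\<close>

lemma bessel_triple_integral:
  fixes z2 z3 z4 b2 b3 s b :: real
  assumes z: "z2 \<noteq> 0" "z3 \<noteq> 0" "z4 \<noteq> 0" and s: "s = 1 \<or> s = - 1"
  shows "((\<lambda>(l2, l3). complex_of_real (bessel_J l2 z2 * bessel_J l3 z3 * bessel_J (l2 + l3) z4)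
        * cis (of_int l2 * b2 + of_int l3 * b3))
      has_sum integral {0..2 * pi} (\<lambda>t. cis (z4 * cos (s * t + b) - z2 * cos (s * t + b + b2)
          - z3 * cos (s * t + b + b3))) / complex_of_real (2 * pi)) UNIV"
proof -
  define u where "u t = s * t + b" for t
  define J where "J = (\<lambda>(l2, l3, l4). complex_of_real (bessel_J l2 z2 * bessel_J l3 z3 * bessel_J l4 z4))"
  define f where "f = (\<lambda>(l2, l3, l4) t. J (l2, l3, l4) * cis (of_int l2 * (u t + b2 - pi / 2)
      + of_int l3 * (u t + b3 - pi / 2) + of_int l4 * (pi / 2 - u t)))"
  define E where "E t = cis (z4 * cos (u t) - z2 * cos (u t + b2) - z3 * cos (u t + b3))" for t
  have E: "((\<lambda>l. f l t) has_sum E t) UNIV" for t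
  proof -
    have "sin (v - pi / 2) = - cos v" "sin (pi / 2 - v) = cos v" for v :: real
      by (simp_all add: sin_diff)
    then have e: "E t = cis (z2 * sin (u t + b2 - pi / 2)) * (cis (z3 * sin (u t + b3 - pi / 2)) * cis (z4 * sin (pi / 2 - u t)))"
      by (simp add: E_def cis_mult algebra_simps)
    have "f = (\<lambda>l t. (complex_of_real (bessel_J (fst l) z2) * cis (of_int (fst l) * (u t + b2 - pi / 2)))
       * ((complex_of_real (bessel_J (fst (snd l)) z3) * cis (of_int (fst (snd l)) * (u t + b3 - pi / 2)))
         * (complex_of_real (bessel_J (snd (snd l)) z4) * cis (of_int (snd (snd l)) * (pi / 2 - u t)))))"
      by (auto simp: fun_eq_iff f_def J_def split_beta cis_mult[symmetric])
    then show ?thesis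
      unfolding e
      using has_sum_product_complex[OF bessel_generating_function[OF z(1)]
          has_sum_product_complex[OF bessel_generating_function[OF z(2)] bessel_generating_function[OF z(3)]]]
      by (simp add: split_beta')
  qed
  have c: "continuous_on S (f l)" for S l
    by (cases l) (auto simp: f_def u_def intro!: continuous_intros)
  have M: "norm (f l t) \<le> norm (J l)" for l t
    by (cases l) (auto simp: f_def norm_mult)
  have sJ: "(\<lambda>l. norm (J l)) summable_on UNIV"
  proof -
    have "(\<lambda>l. norm (f l 0)) summable_on UNIV"
      using E[of 0] by (simp only: has_sum_imp_summable flip: summable_on_iff_abs_summable_on_complex)
    moreover have "norm (f l 0) = norm (J l)" for l
      by (cases l) (auto simp: f_def norm_mult)
    ultimately show ?thesis by simp
  qed
  have "((\<lambda>l. integral {0..2 * pi} (f l)) has_sum integral {0..2 * pi} E) UNIV"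
    using c M sJ E by (rule has_sum_integral)
  moreover have "integral {0..2 * pi} (f (l2, l3, l4)) = (if l4 = l2 + l3
      then complex_of_real (2 * pi) * (J (l2, l3, l2 + l3) * cis (of_int l2 * b2 + of_int l3 * b3)) else 0)" for l2 l3 l4
  proof -
    let ?n = "l2 + l3 - l4" and ?c = "of_int l2 * b2 + of_int l3 * b3 - pi / 2 * of_int (l2 + l3 - l4)"
    have "of_int l2 * (u t + b2 - pi / 2) + of_int l3 * (u t + b3 - pi / 2) + of_int l4 * (pi / 2 - u t)
        = ?c + of_int ?n * (s * t + b)" for t
      by (simp add: algebra_simps u_def)
    then have "f (l2, l3, l4) = (\<lambda>t. J (l2, l3, l4) * cis ?c * cis (of_int ?n * (s * t + b)))"
      by (simp add: f_def fun_eq_iff cis_mult mult.assoc)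
    then show ?thesis
      using integral_cis_period[OF s, of ?n b] by (auto simp: integral_mult_right)
  qed
  then have "(\<lambda>l. integral {0..2 * pi} (f l)) = (\<lambda>(l2, l3, l4). if l4 = l2 + l3
      then complex_of_real (2 * pi) * (J (l2, l3, l2 + l3) * cis (of_int l2 * b2 + of_int l3 * b3)) else 0)"
    by (intro ext) (simp only: split_paired_all prod.case)
  ultimately have hs: "((\<lambda>(l2, l3, l4). if l4 = l2 + l3
      then complex_of_real (2 * pi) * (J (l2, l3, l2 + l3) * cis (of_int l2 * b2 + of_int l3 * b3)) else 0)
      has_sum integral {0..2 * pi} E) UNIV" (is "(?g has_sum _) _")
    by (simp only:)
  \<comment> \<open>All terms off the graph \<open>l\<^sub>4 = l\<^sub>2 + l\<^sub>3\<close> vanish, which leaves a sum over pairs.\<close>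
  have "(?g has_sum integral {0..2 * pi} E) ((\<lambda>(l2, l3). (l2, l3, l2 + l3)) ` UNIV)"
    using hs by (subst has_sum_cong_neutral[where T=UNIV and g="?g"]) (auto simp: image_iff)
  then have "((?g \<circ> (\<lambda>(l2, l3). (l2, l3, l2 + l3))) has_sum integral {0..2 * pi} E) UNIV"
    by (subst (asm) has_sum_reindex) (auto simp: inj_on_def)
  then have "((\<lambda>(l2, l3). complex_of_real (2 * pi) * (J (l2, l3, l2 + l3) * cis (of_int l2 * b2 + of_int l3 * b3)))
      has_sum integral {0..2 * pi} E) UNIV"
    by (simp add: o_def split_beta')
  then have "((\<lambda>l. (case l of (l2, l3) \<Rightarrow> complex_of_real (2 * pi) * (J (l2, l3, l2 + l3) * cis (of_int l2 * b2 + of_int l3 * b3)))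
      * inverse (complex_of_real (2 * pi))) has_sum integral {0..2 * pi} E * inverse (complex_of_real (2 * pi))) UNIV"
    by (rule has_sum_cmult_left)
  then show ?thesis
  proof -
    assume hs: "((\<lambda>l. (case l of (l2, l3) \<Rightarrow> complex_of_real (2 * pi) * (J (l2, l3, l2 + l3) * cis (of_int l2 * b2 + of_int l3 * b3)))
      * inverse (complex_of_real (2 * pi))) has_sum integral {0..2 * pi} E * inverse (complex_of_real (2 * pi))) UNIV"
    have "complex_of_real (2 * pi) * x * inverse (complex_of_real (2 * pi)) = x" for x
      by simp
    then have "(\<lambda>l. (case l of (l2, l3) \<Rightarrow> complex_of_real (2 * pi) * (J (l2, l3, l2 + l3) * cis (of_int l2 * b2 + of_int l3 * b3)))
      * inverse (complex_of_real (2 * pi))) = (\<lambda>(l2, l3). J (l2, l3, l2 + l3) * cis (of_int l2 * b2 + of_int l3 * b3))"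
      by (simp only: fun_eq_iff split_paired_All prod.case) simp
    with hs show ?thesis
      unfolding divide_inverse by (simp only: J_def prod.case E_def[abs_def] u_def)
  qed
qed

section \<open>Gaussian summation of Fourier integrals\<close>

lemma cis_measurable [measurable]: "cis \<in> borel_measurable borel"
  by (intro borel_measurable_continuous_onI continuous_intros)

text \<open>Integrals of products over the coordinates reduce Gaussian integrals in any Euclidean space to the
  real line.\<close>

lemma lborel_integral_prod_Basis:
  fixes f :: "'a::euclidean_space \<Rightarrow> real \<Rightarrow> complex"
  assumes f: "\<And>b. b \<in> Basis \<Longrightarrow> integrable lborel (f b)"
  shows integrable_lborel_prod_Basis: "integrable lborel (\<lambda>x::'a. \<Prod>b\<in>Basis. f b (x \<bullet> b))"
    and integral_lborel_prod_Basis: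
      "(LINT x|lborel. (\<Prod>b\<in>Basis. f b (x \<bullet> b))) = (\<Prod>b\<in>Basis. (LINT t|lborel. f b t))"
proof -
  interpret product_sigma_finite "\<lambda>_::'a. lborel :: real measure" ..
  have [measurable]: "\<And>b. b \<in> Basis \<Longrightarrow> f b \<in> borel_measurable borel"
    using f borel_measurable_integrable by fastforce
  have co: "(\<Sum>b'\<in>Basis. g b' *\<^sub>R b') \<bullet> b = g b" if "b \<in> Basis" for g and b :: 'a
    using that by (simp add: inner_sum_left inner_Basis if_distrib sum.delta cong: if_cong)
  have eq: "(\<Prod>b\<in>Basis. f b ((\<Sum>b'\<in>Basis. g b' *\<^sub>R b') \<bullet> b)) = (\<Prod>b\<in>Basis. f b (g b))" for g
    by (intro prod.cong refl) (simp add: co)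
  show "integrable lborel (\<lambda>x::'a. \<Prod>b\<in>Basis. f b (x \<bullet> b))"
    unfolding lborel_eq[where 'a='a]
    by (subst integrable_distr_eq) (use product_integrable_prod[OF finite_Basis f] in \<open>auto simp: eq\<close>)
  show "(LINT x|lborel. (\<Prod>b\<in>Basis. f b (x \<bullet> b))) = (\<Prod>b\<in>Basis. (LINT t|lborel. f b t))"
    unfolding lborel_eq[where 'a='a]
    by (subst integral_distr) (use product_integral_prod[OF finite_Basis f] in \<open>auto simp: eq lborel_eq[symmetric]\<close>)
qed

definition gauss_density :: "real \<Rightarrow> 'a::euclidean_space \<Rightarrow> real" where
  "gauss_density e y = (\<Prod>b\<in>Basis. normal_density 0 e (y \<bullet> b))"

lemma gauss_density_pos: "e > 0 \<Longrightarrow> gauss_density e y > 0"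
  by (auto simp: gauss_density_def intro!: prod_pos normal_density_pos)

lemma gauss_density_measurable [measurable]: "gauss_density e \<in> borel_measurable borel"
  unfolding gauss_density_def by measurable

lemma sum_inner_Basis_sq: "(\<Sum>b\<in>Basis. (y \<bullet> b)\<^sup>2) = (norm y)\<^sup>2"
  by (simp add: norm_eq_sqrt_inner euclidean_inner[of y y] power2_eq_square flip: power2_eq_square)
     (simp add: power2_eq_square sum_nonneg)

lemma gauss_density_eq:
  "gauss_density e (y::'a::euclidean_space)
     = (1 / sqrt (2 * pi * e\<^sup>2)) ^ DIM('a) * exp (- (norm y)\<^sup>2 / (2 * e\<^sup>2))"
proof -
  have "gauss_density e y = (1 / sqrt (2 * pi * e\<^sup>2)) ^ DIM('a) * (\<Prod>b\<in>Basis. exp (- (y \<bullet> b)\<^sup>2 / (2 * e\<^sup>2)))"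
    by (simp add: gauss_density_def normal_density_def prod.distrib prod_dividef power_divide)
  also have "(\<Prod>b\<in>Basis. exp (- (y \<bullet> b)\<^sup>2 / (2 * e\<^sup>2))) = exp (\<Sum>b\<in>Basis. - (y \<bullet> b)\<^sup>2 / (2 * e\<^sup>2))"
    by (simp add: exp_sum)
  also have "(\<Sum>b\<in>Basis. - (y \<bullet> b)\<^sup>2 / (2 * e\<^sup>2)) = - (norm y)\<^sup>2 / (2 * e\<^sup>2)"
    by (simp add: sum_inner_Basis_sq[symmetric] sum_divide_distrib sum_negf)
  finally show ?thesis .
qed

lemma gauss_density_integral:
  assumes "e > 0"
  shows "integrable lborel (gauss_density e :: 'a::euclidean_space \<Rightarrow> real)"
    and "(LINT y|lborel. gauss_density e (y::'a)) = 1"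
proof -
  have i: "integrable lborel (\<lambda>x. complex_of_real (normal_density 0 e x))"
    using assms by (intro integrable_of_real integrable_normal_density)
  have I: "(LINT x|lborel. complex_of_real (normal_density 0 e x)) = 1"
    using assms by (simp add: integral_complex_of_real integral_normal_density)
  have 1: "integrable lborel (\<lambda>y::'a. complex_of_real (gauss_density e y))"
    unfolding gauss_density_def of_real_prod by (rule integrable_lborel_prod_Basis) (rule i)
  then show "integrable lborel (gauss_density e :: 'a \<Rightarrow> real)"
    by (simp only: complex_of_real_integrable_eq)
  have "(LINT y|lborel. complex_of_real (gauss_density e (y::'a))) = 1"
    unfolding gauss_density_def of_real_prod
    by (subst integral_lborel_prod_Basis) (use i I in auto)
  then show "(LINT y|lborel. gauss_density e (y::'a)) = 1"
    by (simp add: integral_complex_of_real)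
qed

text \<open>The characteristic function of the standard normal distribution after scaling by \<open>e\<close>.\<close>

lemma gaussian_char_real:
  fixes e y :: real
  assumes "e > 0"
  shows "integrable lborel (\<lambda>x. cis (x * y) * complex_of_real (exp (- (e\<^sup>2 * x\<^sup>2) / 2)))"
    and "(LINT x|lborel. cis (x * y) * complex_of_real (exp (- (e\<^sup>2 * x\<^sup>2) / 2)))
           = complex_of_real (2 * pi * normal_density 0 e y)"
proof -
  let ?h = "\<lambda>x. cis (x * (y / e)) * complex_of_real (std_normal_density x)"
  have ih: "integrable lborel ?h"
    by (rule Bochner_Integration.integrable_bound[where f="\<lambda>x. std_normal_density x"])
       (auto simp: norm_mult integrable_normal_density)
  have "(LINT x|lborel. ?h x) = char std_normal_distribution (y / e)"
    unfolding char_def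
    by (subst integral_density)
       (auto simp: normal_density_nonneg scaleR_conv_of_real mult.commute cis_conv_exp)
  also have "\<dots> = complex_of_real (exp (- ((y / e)\<^sup>2) / 2))"
    by (simp add: char_std_normal_distribution)
  finally have Ih: "(LINT x|lborel. ?h x) = complex_of_real (exp (- ((y / e)\<^sup>2) / 2))" .
  have eq: "cis (x * y) * complex_of_real (exp (- (e\<^sup>2 * x\<^sup>2) / 2))
      = complex_of_real (sqrt (2 * pi)) * ?h (0 + e * x)" for x
    using assms by (simp add: normal_density_def power_mult_distrib mult.commute)
  show "integrable lborel (\<lambda>x. cis (x * y) * complex_of_real (exp (- (e\<^sup>2 * x\<^sup>2) / 2)))"
    unfolding eq using assms by (intro integrable_mult_right lborel_integrable_real_affine ih) auto
  have "(LINT x|lborel. ?h x) = \<bar>e\<bar> *\<^sub>R (LINT x|lborel. ?h (0 + e * x))"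
    by (rule lborel_integral_real_affine) (use assms in auto)
  then have "(LINT x|lborel. ?h (0 + e * x)) = complex_of_real (exp (- ((y / e)\<^sup>2) / 2) / e)"
    using Ih assms by (simp add: scaleR_conv_of_real field_simps)
  moreover have "sqrt (2 * pi) * (exp (- ((y / e)\<^sup>2) / 2) / e) = 2 * pi * normal_density 0 e y"
    using assms by (simp add: normal_density_def field_simps real_sqrt_mult power_divide)
  ultimately show "(LINT x|lborel. cis (x * y) * complex_of_real (exp (- (e\<^sup>2 * x\<^sup>2) / 2)))
           = complex_of_real (2 * pi * normal_density 0 e y)"
    unfolding eq integral_mult_right_zero by (metis of_real_mult)
qed

lemma gaussian_char:
  fixes y :: "'a::euclidean_space"
  assumes "e > 0"
  shows "integrable lborel (\<lambda>x. cis (x \<bullet> y) * complex_of_real (exp (- (e\<^sup>2 * (norm x)\<^sup>2) / 2)))"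
    and "(LINT x|lborel. cis (x \<bullet> y) * complex_of_real (exp (- (e\<^sup>2 * (norm x)\<^sup>2) / 2)))
           = complex_of_real ((2 * pi) ^ DIM('a) * gauss_density e y)"
proof -
  have cis_sum: "cis (\<Sum>b\<in>A. u b) = (\<Prod>b\<in>A. cis (u b))" if "finite A" for A :: "'a set" and u
    using that by induction (auto simp: cis_mult[symmetric])
  have eq: "cis (x \<bullet> y) * complex_of_real (exp (- (e\<^sup>2 * (norm x)\<^sup>2) / 2))
      = (\<Prod>b\<in>Basis. cis ((x \<bullet> b) * (y \<bullet> b)) * complex_of_real (exp (- (e\<^sup>2 * (x \<bullet> b)\<^sup>2) / 2)))"
    for x :: 'a
  proof -
    have "exp (- (e\<^sup>2 * (norm x)\<^sup>2) / 2) = (\<Prod>b\<in>Basis. exp (- (e\<^sup>2 * (x \<bullet> b)\<^sup>2) / 2))"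
      by (simp add: sum_inner_Basis_sq[symmetric] exp_sum[symmetric] sum_divide_distrib sum_negf sum_distrib_left)
    then show ?thesis
      by (simp only: prod.distrib euclidean_inner[of x y] cis_sum[OF finite_Basis] of_real_prod)
  qed
  show "integrable lborel (\<lambda>x. cis (x \<bullet> y) * complex_of_real (exp (- (e\<^sup>2 * (norm x)\<^sup>2) / 2)))"
    unfolding eq by (rule integrable_lborel_prod_Basis) (rule gaussian_char_real(1)[OF assms])
  show "(LINT x|lborel. cis (x \<bullet> y) * complex_of_real (exp (- (e\<^sup>2 * (norm x)\<^sup>2) / 2)))
           = complex_of_real ((2 * pi) ^ DIM('a) * gauss_density e y)"
    unfolding eq
    by (subst integral_lborel_prod_Basis[OF gaussian_char_real(1)[OF assms]])
       (simp only: gaussian_char_real(2)[OF assms] prod.distrib gauss_density_def of_real_prod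
          of_real_mult of_real_power prod_constant power_mult_distrib)
qed


text \<open>Convolution with a centred Gaussian of standard deviation \<open>e\<close>.\<close>

definition gauss_smooth :: "real \<Rightarrow> ('a::euclidean_space \<Rightarrow> complex) \<Rightarrow> 'a \<Rightarrow> complex" where
  "gauss_smooth e F w = (LINT v|lborel. F v * complex_of_real (gauss_density e (v - w)))"

lemma gauss_density_le:
  fixes y :: "'a::euclidean_space"
  assumes "e > 0"
  shows "gauss_density e y \<le> (1 / sqrt (2 * pi * e\<^sup>2)) ^ DIM('a)"
  using assms unfolding gauss_density_eq by (simp add: mult_le_cancel_left1 divide_nonneg_nonneg)

lemma gauss_smooth_integrable:
  fixes F :: "'a::euclidean_space \<Rightarrow> complex"
  assumes "e > 0" "integrable lborel F"
  shows "integrable lborel (\<lambda>v. F v * complex_of_real (gauss_density e (v - w)))"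
proof (rule Bochner_Integration.integrable_bound)
  show "integrable lborel (\<lambda>v. norm (F v) * (1 / sqrt (2 * pi * e\<^sup>2)) ^ DIM('a))"
    using assms by auto
  have [measurable]: "F \<in> borel_measurable borel" using assms(2) by (simp add: borel_measurable_integrable flip: measurable_lborel1)
  show "(\<lambda>v. F v * complex_of_real (gauss_density e (v - w))) \<in> borel_measurable lborel"
    by measurable
  show "AE v in lborel. norm (F v * complex_of_real (gauss_density e (v - w)))
      \<le> norm (norm (F v) * (1 / sqrt (2 * pi * e\<^sup>2)) ^ DIM('a))"
    using gauss_density_le[OF assms(1), where 'a='a] gauss_density_pos[OF assms(1), where 'a='a] assms(1)
    by (auto simp: norm_mult abs_mult less_imp_le intro!: mult_left_mono)
qed

text \<open>Damping a Fourier transform by a Gaussian and transforming back amounts to smoothing the original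
  function: exchange the integrals and use that the Gaussian is, up to scaling, its own transform.\<close>

lemma fourier_gauss_smooth:
  fixes F :: "'a::euclidean_space \<Rightarrow> complex" and w :: 'a
  assumes e: "e > 0" and F: "integrable lborel F"
  defines "h \<equiv> \<lambda>x. cis (- (x \<bullet> w)) * complex_of_real (exp (- (e\<^sup>2 * (norm x)\<^sup>2) / 2))
                   * (LINT v|lborel. cis (x \<bullet> v) * F v)"
  shows "integrable lborel h"
    and "(LINT x|lborel. h x) = complex_of_real ((2 * pi) ^ DIM('a)) * gauss_smooth e F w"
proof -
  have [measurable]: "F \<in> borel_measurable borel"
    using F by (simp add: borel_measurable_integrable flip: measurable_lborel1)
  let ?G = "\<lambda>x::'a. complex_of_real (exp (- (e\<^sup>2 * (norm x)\<^sup>2) / 2))"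
  let ?g = "\<lambda>(x, v). cis (- (x \<bullet> w)) * ?G x * (cis (x \<bullet> v) * F v)"
  have iG: "integrable lborel ?G"
    using gaussian_char(1)[OF e, of "0::'a"] by simp
  have "integrable (lborel \<Otimes>\<^sub>M lborel) (\<lambda>(x, v). ?G x * F v)"
  proof (intro lborel_pair.Fubini_integrable)
    have "(LINT v|lborel. norm (case (x, v) of (x, v) \<Rightarrow> ?G x * F v)) = norm (?G x) * (LINT v|lborel. norm (F v))" for x
      by (simp add: norm_mult)
    then show "integrable lborel (\<lambda>x. LINT v|lborel. norm (case (x, v) of (x, v) \<Rightarrow> ?G x * F v))"
      using integrable_norm[OF iG] by simp
  qed (use F in auto)
  then have ig: "integrable (lborel \<Otimes>\<^sub>M lborel) ?g"
    by (rule Bochner_Integration.integrable_bound) (auto simp: norm_mult split_beta)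
  have h: "h = (\<lambda>x. LINT v|lborel. ?g (x, v))"
    by (simp add: h_def)
  show "integrable lborel h"
    unfolding h by (rule lborel_pair.integrable_fst'[OF ig])
  have "(LINT x|lborel. h x) = (LINT v|lborel. (LINT x|lborel. ?g (x, v)))"
    unfolding h using lborel_pair.Fubini_integral[of "\<lambda>x v. ?g (x, v)"] ig by simp
  also have "\<dots> = (LINT v|lborel. complex_of_real ((2 * pi) ^ DIM('a)) * (F v * complex_of_real (gauss_density e (v - w))))"
  proof (rule Bochner_Integration.integral_cong[OF refl])
    fix v
    have "cis (x \<bullet> (v - w)) = cis (- (x \<bullet> w)) * cis (x \<bullet> v)" for x
      by (simp add: inner_diff_right cis_mult)
    then have "?g (x, v) = F v * (cis (x \<bullet> (v - w)) * ?G x)" for x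
      by simp
    then have "(LINT x|lborel. ?g (x, v)) = F v * (LINT x|lborel. cis (x \<bullet> (v - w)) * ?G x)"
      by (simp only: integral_mult_right_zero)
    then show "(LINT x|lborel. ?g (x, v))
        = complex_of_real ((2 * pi) ^ DIM('a)) * (F v * complex_of_real (gauss_density e (v - w)))"
      by (simp only: gaussian_char(2)[OF e] of_real_mult mult.left_commute)
  qed
  also have "\<dots> = complex_of_real ((2 * pi) ^ DIM('a)) * gauss_smooth e F w"
    by (simp add: gauss_smooth_def)
  finally show "(LINT x|lborel. h x) = complex_of_real ((2 * pi) ^ DIM('a)) * gauss_smooth e F w" .
qed

text \<open>Rescaling moves the width of the Gaussian into the argument of \<open>F\<close>, where continuity of \<open>F\<close> can be used.\<close>

lemma gauss_smooth_rescale: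
  fixes F :: "'a::euclidean_space \<Rightarrow> complex"
  assumes e: "e > 0" and [measurable]: "F \<in> borel_measurable borel"
  shows "gauss_smooth e F w = (LINT u|lborel. F (w + e *\<^sub>R u) * complex_of_real (gauss_density 1 u))"
proof -
  have sc: "e ^ DIM('a) * gauss_density e (e *\<^sub>R u) = gauss_density 1 u" for u :: 'a
    using e by (simp add: gauss_density_eq power_mult_distrib real_sqrt_mult power_divide field_simps)
  have "gauss_smooth e F w = (LINT v|density (distr lborel borel (\<lambda>x. w + e *\<^sub>R x)) (\<lambda>_. ennreal (\<bar>e\<bar> ^ DIM('a))).
      F v * complex_of_real (gauss_density e (v - w)))"
    unfolding gauss_smooth_def using lborel_affine[of e w] e by (simp add: ennreal_power)
  also have "\<dots> = (LINT u|lborel. \<bar>e\<bar> ^ DIM('a) *\<^sub>R (F (w + e *\<^sub>R u) * complex_of_real (gauss_density e (e *\<^sub>R u))))"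
    by (subst integral_density, simp_all, subst integral_distr, simp_all)
  also have "\<dots> = (LINT u|lborel. F (w + e *\<^sub>R u) * complex_of_real (gauss_density 1 u))"
    using e by (intro Bochner_Integration.integral_cong refl) (simp add: scaleR_conv_of_real sc[symmetric])
  finally show ?thesis .
qed

lemma gauss_smooth_tendsto_bounded:
  fixes F :: "'a::euclidean_space \<Rightarrow> complex"
  assumes F [measurable]: "F \<in> borel_measurable borel" and B: "\<And>v. norm (F v) \<le> B" and c: "isCont F w"
    and e: "e \<longlonglongrightarrow> 0" and pos: "\<And>n. e n > 0"
  shows "(\<lambda>n. gauss_smooth (e n) F w) \<longlonglongrightarrow> F w"
proof -
  have "(\<lambda>n. LINT u|lborel. F (w + e n *\<^sub>R u) * complex_of_real (gauss_density 1 (u::'a)))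
      \<longlonglongrightarrow> (LINT u|lborel. F w * complex_of_real (gauss_density 1 (u::'a)))"
  proof (rule integral_dominated_convergence[where w="\<lambda>u. B * gauss_density 1 u"])
    show "integrable lborel (\<lambda>u::'a. B * gauss_density 1 u)"
      using gauss_density_integral(1)[of 1, where 'a='a] by simp
    show "AE u in lborel. (\<lambda>n. F (w + e n *\<^sub>R u) * complex_of_real (gauss_density 1 (u::'a)))
        \<longlonglongrightarrow> F w * complex_of_real (gauss_density 1 u)"
    proof (intro AE_I2 tendsto_mult_right)
      fix u :: 'a
      have "(\<lambda>n. w + e n *\<^sub>R u) \<longlonglongrightarrow> w + 0 *\<^sub>R u"
        by (intro tendsto_intros e)
      then show "(\<lambda>n. F (w + e n *\<^sub>R u)) \<longlonglongrightarrow> F w"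
        using isCont_tendsto_compose[OF c] by simp
    qed
    show "AE u in lborel. norm (F (w + e n *\<^sub>R u) * complex_of_real (gauss_density 1 (u::'a)))
        \<le> B * gauss_density 1 u" for n
      using B gauss_density_pos[of 1, where 'a='a] by (auto simp: norm_mult less_imp_le intro!: mult_right_mono)
  qed measurable
  then show ?thesis
    using gauss_density_integral(2)[of 1, where 'a='a] pos by (simp add: gauss_smooth_rescale integral_complex_of_real)
qed


lemma gauss_smooth_minus:
  fixes F G :: "'a::euclidean_space \<Rightarrow> complex"
  assumes "e > 0" "integrable lborel F" "integrable lborel G"
  shows "gauss_smooth e (\<lambda>v. F v - G v) w = gauss_smooth e F w - gauss_smooth e G w"
  using assms gauss_smooth_integrable[of e F w] gauss_smooth_integrable[of e G w]
  by (simp add: gauss_smooth_def left_diff_distrib)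

text \<open>Off the origin the Gaussian tends to zero uniformly, since exponential decay beats the power of \<open>1 / e\<close> in the
  normalisation.\<close>

lemma gauss_density_far_tendsto_0:
  assumes d: "d > 0" and e: "e \<longlonglongrightarrow> 0" and pos: "\<And>n. e n > 0"
  shows "(\<lambda>n. (1 / sqrt (2 * pi * (e n)\<^sup>2)) ^ k * exp (- d\<^sup>2 / (2 * (e n)\<^sup>2))) \<longlonglongrightarrow> 0"
proof -
  define s where "s = (\<lambda>n. d\<^sup>2 / (2 * (e n)\<^sup>2))"
  have "filterlim (\<lambda>n. (e n)\<^sup>2) (at_right 0) sequentially"
    using tendsto_power[OF e, of 2] pos
    by (auto simp: filterlim_at intro!: always_eventually) (metis less_irrefl)
  then have "filterlim (\<lambda>n. inverse ((e n)\<^sup>2)) at_top sequentially"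
    by (rule filterlim_compose[OF filterlim_inverse_at_top_right])
  then have "filterlim (\<lambda>n. (d\<^sup>2 / 2) * inverse ((e n)\<^sup>2)) at_top sequentially"
    by (intro filterlim_tendsto_pos_mult_at_top[OF tendsto_const]) (use d in auto)
  then have s: "filterlim s at_top sequentially"
    by (simp add: s_def field_simps)
  have lim: "(\<lambda>n. (1 / (pi * d\<^sup>2)) ^ k * (s n ^ k / exp (s n))) \<longlonglongrightarrow> 0"
    using tendsto_mult[OF tendsto_const filterlim_compose[OF tendsto_power_div_exp_0[of k] s],
        of "(1 / (pi * d\<^sup>2)) ^ k"] by simp
  have ev: "\<forall>\<^sub>F n in sequentially. 2 * pi * (e n)\<^sup>2 < 1"
  proof -
    have "(\<lambda>n. 2 * pi * (e n)\<^sup>2) \<longlonglongrightarrow> 2 * pi * 0\<^sup>2"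
      by (intro tendsto_intros e)
    then show ?thesis by (rule order_tendstoD) simp
  qed
  show ?thesis
  proof (rule tendsto_sandwich[OF _ _ tendsto_const lim])
    show "\<forall>\<^sub>F n in sequentially. 0 \<le> (1 / sqrt (2 * pi * (e n)\<^sup>2)) ^ k * exp (- d\<^sup>2 / (2 * (e n)\<^sup>2))"
      by (auto intro!: always_eventually)
    show "\<forall>\<^sub>F n in sequentially. (1 / sqrt (2 * pi * (e n)\<^sup>2)) ^ k * exp (- d\<^sup>2 / (2 * (e n)\<^sup>2))
        \<le> (1 / (pi * d\<^sup>2)) ^ k * (s n ^ k / exp (s n))"
      using ev
    proof eventually_elim
      fix n assume n: "2 * pi * (e n)\<^sup>2 < 1"
      have en: "e n > 0" by (rule pos)
      let ?t = "2 * pi * (e n)\<^sup>2"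
      have t: "?t > 0" using en by simp
      have "?t \<le> sqrt ?t"
      proof (rule real_le_rsqrt)
        show "?t\<^sup>2 \<le> ?t"
          using n t mult_left_mono[of ?t 1 ?t] by (simp only: power2_eq_square) simp
      qed
      then have "1 / sqrt ?t \<le> 1 / ?t"
        using t by (intro divide_left_mono) auto
      also have "1 / ?t = 1 / (pi * d\<^sup>2) * s n"
        using d en by (simp add: s_def field_simps)
      finally have "(1 / sqrt ?t) ^ k \<le> (1 / (pi * d\<^sup>2) * s n) ^ k"
        by (intro power_mono) auto
      then have "(1 / sqrt ?t) ^ k * exp (- s n) \<le> (1 / (pi * d\<^sup>2) * s n) ^ k * exp (- s n)"
        by (intro mult_right_mono) auto
      then show "(1 / sqrt (2 * pi * (e n)\<^sup>2)) ^ k * exp (- d\<^sup>2 / (2 * (e n)\<^sup>2))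
          \<le> (1 / (pi * d\<^sup>2)) ^ k * (s n ^ k / exp (s n))"
        by (simp only: s_def power_mult_distrib exp_minus divide_inverse mult.assoc minus_mult_left[symmetric])
    qed
  qed
qed

text \<open>Near \<open>w\<close> the function is bounded and the bounded case applies; the part of \<open>F\<close> away from \<open>w\<close> is integrable
  and meets only the uniformly small tail of the Gaussian.\<close>

lemma gauss_smooth_tendsto_isCont:
  fixes F :: "'a::euclidean_space \<Rightarrow> complex"
  assumes F: "integrable lborel F" and c: "isCont F w"
    and e: "e \<longlonglongrightarrow> 0" and pos: "\<And>n. e n > 0"
  shows "(\<lambda>n. gauss_smooth (e n) F w) \<longlonglongrightarrow> F w"
proof -
  have [measurable]: "F \<in> borel_measurable borel"
    using F by (simp add: borel_measurable_integrable flip: measurable_lborel1)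
  obtain d where d: "d > 0" "\<And>v. dist v w < d \<Longrightarrow> dist (F v) (F w) < 1"
    using c unfolding continuous_at_eps_delta by (metis zero_less_one)
  define G where "G = (\<lambda>v. indicator (ball w d) v *\<^sub>R F v)"
  have [measurable]: "G \<in> borel_measurable borel"
    unfolding G_def by (intro borel_measurable_scaleR borel_measurable_indicator) auto
  have iG: "integrable lborel G"
    using F by (rule Bochner_Integration.integrable_bound) (auto simp: G_def indicator_def)
  have "norm (G v) \<le> norm (F w) + 1" for v
  proof (cases "v \<in> ball w d")
    case True
    then have "norm (F v - F w) < 1"
      using d(2)[of v] by (simp add: dist_norm norm_minus_commute dist_commute)
    then show ?thesis
      using norm_triangle_sub[of "F v" "F w"] True by (simp add: G_def)
  qed (simp add: G_def)
  moreover have "isCont G w"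
  proof -
    have "\<forall>\<^sub>F v in nhds w. v \<in> ball w d"
      using d(1) by (intro eventually_nhds_in_open) auto
    then have "\<forall>\<^sub>F v in nhds w. G v = F v"
      by eventually_elim (simp add: G_def)
    then show ?thesis using c isCont_cong by blast
  qed
  ultimately have GT: "(\<lambda>n. gauss_smooth (e n) G w) \<longlonglongrightarrow> G w"
    by (intro gauss_smooth_tendsto_bounded[OF _ _ _ e pos]) auto
  have bd: "norm (gauss_smooth (e n) F w - gauss_smooth (e n) G w)
      \<le> ((1 / sqrt (2 * pi * (e n)\<^sup>2)) ^ DIM('a) * exp (- d\<^sup>2 / (2 * (e n)\<^sup>2))) * (LINT v|lborel. norm (F v))" for n
  proof -
    let ?C = "(1 / sqrt (2 * pi * (e n)\<^sup>2)) ^ DIM('a) * exp (- d\<^sup>2 / (2 * (e n)\<^sup>2))"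
    have "gauss_smooth (e n) F w - gauss_smooth (e n) G w = gauss_smooth (e n) (\<lambda>v. F v - G v) w"
      using pos F iG by (simp add: gauss_smooth_minus)
    also have "norm \<dots> \<le> (LINT v|lborel. ?C * norm (F v))"
      unfolding gauss_smooth_def
    proof (rule order_trans[OF integral_norm_bound integral_mono[OF integrable_norm]])
      show "integrable lborel (\<lambda>v. (F v - G v) * complex_of_real (gauss_density (e n) (v - w)))"
        using F iG pos by (intro gauss_smooth_integrable) auto
      show "integrable lborel (\<lambda>v. ?C * norm (F v))"
        using F by auto
      fix v
      show "norm ((F v - G v) * complex_of_real (gauss_density (e n) (v - w))) \<le> ?C * norm (F v)"
      proof (cases "v \<in> ball w d")
        case False
        then have "d\<^sup>2 \<le> (norm (v - w))\<^sup>2"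
          using d(1) by (intro power_mono) (auto simp: dist_norm norm_minus_commute)
        then have "gauss_density (e n) (v - w) \<le> ?C"
          unfolding gauss_density_eq by (intro mult_left_mono) (auto simp: divide_right_mono)
        then show ?thesis
          using False gauss_density_pos[OF pos, of n "v - w"]
          by (simp add: G_def norm_mult mult.commute mult_left_mono)
      qed (simp add: G_def)
    qed
    finally show ?thesis by simp
  qed
  have "(\<lambda>n. ((1 / sqrt (2 * pi * (e n)\<^sup>2)) ^ DIM('a) * exp (- d\<^sup>2 / (2 * (e n)\<^sup>2))) * (LINT v|lborel. norm (F v))) \<longlonglongrightarrow> 0"
    by (rule tendsto_mult_left_zero) (rule gauss_density_far_tendsto_0[OF d(1) e pos])
  then have "(\<lambda>n. gauss_smooth (e n) F w - gauss_smooth (e n) G w) \<longlonglongrightarrow> 0"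
    by (rule Lim_null_comparison[rotated]) (use bd in \<open>auto intro!: always_eventually\<close>)
  from tendsto_add[OF this GT] show ?thesis
    using d(1) by (simp add: G_def)
qed


lemma gauss_density_integral_shift:
  assumes "e > 0"
  shows "integrable lborel (\<lambda>w. gauss_density e (v - w :: 'a::euclidean_space))"
    and "(LINT w|lborel. gauss_density e (v - w :: 'a)) = 1"
proof -
  have sym: "gauss_density e (v - w) = gauss_density e ((- v) + w)" for w :: 'a
    by (simp add: gauss_density_eq norm_minus_commute)
  have "integrable (distr lborel borel ((+) (- v))) (gauss_density e :: 'a \<Rightarrow> real)"
    unfolding lborel_distr_plus by (rule gauss_density_integral(1)[OF assms])
  then show "integrable lborel (\<lambda>w. gauss_density e (v - w :: 'a::euclidean_space))"
    unfolding sym by (subst (asm) integrable_distr_eq) auto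
  have "(LINT w|distr lborel borel ((+) (- v)). gauss_density e (w :: 'a)) = 1"
    unfolding lborel_distr_plus by (rule gauss_density_integral(2)[OF assms])
  then show "(LINT w|lborel. gauss_density e (v - w :: 'a)) = 1"
    unfolding sym by (subst (asm) integral_distr) auto
qed

text \<open>Smoothing is a contraction of \<open>L\<^sup>1\<close>, by exchanging the order of integration.\<close>

lemma gauss_smooth_L1:
  fixes F :: "'a::euclidean_space \<Rightarrow> complex"
  assumes e: "e > 0" and F: "integrable lborel F"
  shows "integrable lborel (gauss_smooth e F)"
    and "(LINT w|lborel. norm (gauss_smooth e F w)) \<le> (LINT v|lborel. norm (F v))"
proof -
  have [measurable]: "F \<in> borel_measurable borel"
    using F by (simp add: borel_measurable_integrable flip: measurable_lborel1)
  let ?g = "\<lambda>(v, w). F v * complex_of_real (gauss_density e (v - w))"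
  have n: "norm (gauss_density e (v - w)) = gauss_density e (v - w)" for v w :: 'a
    using gauss_density_pos[OF e, of "v - w"] by simp
  have ng: "(LINT w|lborel. norm (?g (v, w))) = norm (F v)" for v
    using gauss_density_integral_shift(2)[OF e, of v] by (simp add: norm_mult n[simplified])
  have ig: "integrable (lborel \<Otimes>\<^sub>M lborel) ?g"
  proof (intro lborel_pair.Fubini_integrable)
    show "integrable lborel (\<lambda>v. LINT w|lborel. norm (?g (v, w)))"
      unfolding ng using F by auto
    show "AE v in lborel. integrable lborel (\<lambda>w. ?g (v, w))"
      using gauss_density_integral_shift(1)[OF e] by (auto intro!: AE_I2 integrable_mult_right integrable_of_real)
  qed measurable
  have sm: "gauss_smooth e F = (\<lambda>w. LINT v|lborel. ?g (v, w))"
    by (auto simp: gauss_smooth_def)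
  show "integrable lborel (gauss_smooth e F)"
    unfolding sm using lborel_pair.integrable_snd[of "\<lambda>v w. ?g (v, w)"] ig by simp
  have ig': "integrable (lborel \<Otimes>\<^sub>M lborel) (\<lambda>(v, w). norm (?g (v, w)))"
    using integrable_norm[OF ig] by (simp add: split_beta')
  have "(LINT w|lborel. norm (gauss_smooth e F w)) \<le> (LINT w|lborel. (LINT v|lborel. norm (?g (v, w))))"
    unfolding sm
  proof (rule integral_mono)
    show "integrable lborel (\<lambda>w. norm (LINT v|lborel. ?g (v, w)))"
      using integrable_norm[OF lborel_pair.integrable_snd[of "\<lambda>v w. ?g (v, w)"]] ig by simp
    show "integrable lborel (\<lambda>w. LINT v|lborel. norm (?g (v, w)))"
      using lborel_pair.integrable_snd[of "\<lambda>v w. norm (?g (v, w))"] ig' by simp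
  qed (rule integral_norm_bound)
  also have "\<dots> = (LINT v|lborel. (LINT w|lborel. norm (?g (v, w))))"
    using lborel_pair.Fubini_integral[of "\<lambda>v w. norm (?g (v, w))"] ig' by simp
  also have "\<dots> = (LINT v|lborel. norm (F v))"
    unfolding ng ..
  finally show "(LINT w|lborel. norm (gauss_smooth e F w)) \<le> (LINT v|lborel. norm (F v))" .
qed

text \<open>A continuous cut-off, both in the space variable \<open>x\<close> and in the value \<open>z\<close>; it leaves \<open>z\<close> unchanged
  if \<open>|x| \<le> m\<close> and \<open>|z| \<le> m\<close>.\<close>

definition truncate :: "real \<Rightarrow> 'a::euclidean_space \<Rightarrow> complex \<Rightarrow> complex" where
  "truncate m x z = (max 0 (min 1 (m + 1 - norm x)) / max 1 (norm z / m)) *\<^sub>R z"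

lemma truncate_bounds:
  assumes "m > 0"
  shows "norm (truncate m x z) \<le> norm z" "norm (truncate m x z) \<le> m"
    "norm x > m + 1 \<Longrightarrow> truncate m x z = 0"
    "m \<ge> norm x \<Longrightarrow> m \<ge> norm z \<Longrightarrow> truncate m x z = z"
proof -
  let ?c = "max 0 (min 1 (m + 1 - norm x))" and ?d = "max 1 (norm z / m)"
  have eq: "norm (truncate m x z) = ?c * (norm z / ?d)"
    by (simp add: truncate_def)
  have c: "0 \<le> ?c" "?c \<le> 1" by auto
  have d: "norm z / ?d \<le> norm z" "norm z / ?d \<le> m" "norm z / ?d \<ge> 0"
  proof -
    have "norm z / ?d \<le> norm z / 1"
      by (intro divide_left_mono) auto
    then show "norm z / ?d \<le> norm z" by simp
  qed (use assms in \<open>auto simp: field_simps max_def\<close>)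
  show "norm (truncate m x z) \<le> norm z" "norm (truncate m x z) \<le> m"
    unfolding eq using mult_left_le_one_le[OF d(3) c] d by linarith+
  show "norm x > m + 1 \<Longrightarrow> truncate m x z = 0"
    by (simp add: truncate_def)
  show "m \<ge> norm x \<Longrightarrow> m \<ge> norm z \<Longrightarrow> truncate m x z = z"
    using assms by (simp add: truncate_def max_def min_def)
qed

lemma truncate_continuous [continuous_intros]:
  assumes "continuous_on S f" "continuous_on S g" "m > 0"
  shows "continuous_on S (\<lambda>x. truncate m (f x) (g x))"
  unfolding truncate_def using assms by (intro continuous_intros) auto

text \<open>A measurable function is an almost everywhere limit of continuous functions; after truncation of the
  function and of its approximations the convergence is dominated, hence takes place in \<open>L\<^sup>1\<close>.\<close>

lemma L1_dense_bounded_continuous: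
  fixes F :: "'a::euclidean_space \<Rightarrow> complex"
  assumes F: "integrable lborel F" and d: "d > 0"
  obtains g B where "continuous_on UNIV g" "\<And>v. norm (g v) \<le> B" "integrable lborel g"
    "(LINT v|lborel. norm (F v - g v)) < d"
proof -
  have [measurable]: "F \<in> borel_measurable borel"
    using F by (simp add: borel_measurable_integrable flip: measurable_lborel1)
  have tm [measurable]: "(\<lambda>v. truncate m v (h v)) \<in> borel_measurable borel"
    if [measurable]: "h \<in> borel_measurable borel" for m and h :: "'a \<Rightarrow> complex"
    unfolding truncate_def by measurable
  have "(\<lambda>n. LINT v|lborel. norm (F v - truncate (real (Suc n)) v (F v))) \<longlonglongrightarrow> (LINT v::'a|lborel. 0)"
  proof (rule integral_dominated_convergence[where w="\<lambda>v. norm (F v) + norm (F v)"])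
    show "AE v in lborel. (\<lambda>n. norm (F v - truncate (real (Suc n)) v (F v))) \<longlonglongrightarrow> 0"
    proof (rule AE_I2)
      fix v
      obtain N :: nat where N: "real N \<ge> max (norm v) (norm (F v))"
        using real_arch_simple by blast
      have "norm (F v - truncate (real (Suc n)) v (F v)) = 0" if "n \<ge> N" for n
        using truncate_bounds(4)[of "real (Suc n)" v "F v"] N that by simp
      then show "(\<lambda>n. norm (F v - truncate (real (Suc n)) v (F v))) \<longlonglongrightarrow> 0"
        by (intro tendsto_eventually) (auto simp: eventually_sequentially)
    qed
    show "AE v in lborel. norm (norm (F v - truncate (real (Suc n)) v (F v))) \<le> norm (F v) + norm (F v)" for n
      using truncate_bounds(1)[of "real (Suc n)"]
      by (auto intro!: AE_I2 order_trans[OF norm_triangle_ineq4])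
  qed (use F in auto)
  then have "\<forall>\<^sub>F n in sequentially. (LINT v|lborel. norm (F v - truncate (real (Suc n)) v (F v))) < d / 2"
    using d by (intro order_tendstoD(2)[where y=0]) auto
  then obtain n where n: "(LINT v|lborel. norm (F v - truncate (real (Suc n)) v (F v))) < d / 2"
    using eventually_happens by fastforce
  define m where "m = real (Suc n)"
  have m: "m > 0" by (simp add: m_def)
  have "F measurable_on UNIV"
    by (rule lebesgue_measurable_imp_measurable_on) (auto intro: measurable_completion)
  then obtain N g where N: "negligible N" and g: "\<And>k. continuous_on UNIV (g k)"
    and lim: "\<And>x. x \<notin> N \<Longrightarrow> (\<lambda>k. g k x) \<longlonglongrightarrow> F x"
    unfolding measurable_on_def by auto
  have AEN: "AE x in lborel. x \<notin> N"
    using N by (auto simp: negligible_iff_null_sets AE_completion_iff dest!: AE_not_in)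
  have [measurable]: "g k \<in> borel_measurable borel" for k
    using g by (rule borel_measurable_continuous_onI)
  have ball: "integrable lborel (\<lambda>v::'a. indicat_real (cball 0 (m + 1)) v)"
    by (intro integrable_real_indicator emeasure_lborel_cball_finite) auto
  have itr: "integrable lborel (\<lambda>v. truncate m v (h v))"
    if [measurable]: "h \<in> borel_measurable borel" for h :: "'a \<Rightarrow> complex"
  proof (rule Bochner_Integration.integrable_bound[OF integrable_mult_right[OF ball, of m]])
    show "AE v in lborel. norm (truncate m v (h v)) \<le> norm (m * indicat_real (cball 0 (m + 1)) v)"
      using truncate_bounds(2,3)[OF m] m by (auto simp: indicator_def not_le intro!: AE_I2)
  qed measurable
  have "(\<lambda>k. LINT v|lborel. norm (truncate m v (F v) - truncate m v (g k v))) \<longlonglongrightarrow> (LINT v::'a|lborel. 0)"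
  proof (rule integral_dominated_convergence[where w="\<lambda>v. 2 * m * indicat_real (cball 0 (m + 1)) v"])
    show "integrable lborel (\<lambda>v::'a. 2 * m * indicat_real (cball 0 (m + 1)) v)"
      using ball by (rule integrable_mult_right)
    show "AE v in lborel. (\<lambda>k. norm (truncate m v (F v) - truncate m v (g k v))) \<longlonglongrightarrow> 0"
      using AEN
    proof eventually_elim
      fix v assume "v \<notin> N"
      have "isCont (truncate m v) (F v)"
        using truncate_continuous[OF continuous_on_const continuous_on_id m, of UNIV v]
        by (simp add: continuous_on_eq_continuous_at)
      then have "(\<lambda>k. truncate m v (g k v)) \<longlonglongrightarrow> truncate m v (F v)"
        by (rule isCont_tendsto_compose) (rule lim[OF \<open>v \<notin> N\<close>])
      then have "(\<lambda>k. truncate m v (F v) - truncate m v (g k v)) \<longlonglongrightarrow> truncate m v (F v) - truncate m v (F v)"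
        by (intro tendsto_intros)
      then show "(\<lambda>k. norm (truncate m v (F v) - truncate m v (g k v))) \<longlonglongrightarrow> 0"
        by (simp add: tendsto_norm_zero)
    qed
    show "AE v in lborel. norm (norm (truncate m v (F v) - truncate m v (g k v))) \<le> 2 * m * indicat_real (cball 0 (m + 1)) v" for k
    proof (rule AE_I2)
      fix v
      show "norm (norm (truncate m v (F v) - truncate m v (g k v))) \<le> 2 * m * indicat_real (cball 0 (m + 1)) v"
        using truncate_bounds(2,3)[OF m, of v "F v"] truncate_bounds(2,3)[OF m, of v "g k v"]
          norm_triangle_ineq4[of "truncate m v (F v)" "truncate m v (g k v)"]
        by (auto simp: indicator_def)
    qed
  qed measurable
  then have "\<forall>\<^sub>F k in sequentially. (LINT v|lborel. norm (truncate m v (F v) - truncate m v (g k v))) < d / 2"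
    using d by (intro order_tendstoD(2)[where y=0]) auto
  then obtain k where k: "(LINT v|lborel. norm (truncate m v (F v) - truncate m v (g k v))) < d / 2"
    using eventually_happens by fastforce
  show thesis
  proof (rule that)
    show "continuous_on UNIV (\<lambda>v. truncate m v (g k v))"
      by (intro continuous_intros g m)
    show "norm (truncate m v (g k v)) \<le> m" for v
      by (rule truncate_bounds(2)[OF m])
    show "integrable lborel (\<lambda>v. truncate m v (g k v))"
      by (rule itr) measurable
    have "(LINT v|lborel. norm (F v - truncate m v (g k v)))
        \<le> (LINT v|lborel. norm (F v - truncate m v (F v)) + norm (truncate m v (F v) - truncate m v (g k v)))"
      by (intro integral_mono Bochner_Integration.integrable_add integrable_norm Bochner_Integration.integrable_diff F itr)
         (auto intro: order_trans[OF _ norm_triangle_ineq])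
    also have "\<dots> = (LINT v|lborel. norm (F v - truncate m v (F v)))
        + (LINT v|lborel. norm (truncate m v (F v) - truncate m v (g k v)))"
      by (intro Bochner_Integration.integral_add integrable_norm Bochner_Integration.integrable_diff F itr) auto
    also have "\<dots> < d" using n k by (simp add: m_def)
    finally show "(LINT v|lborel. norm (F v - truncate m v (g k v))) < d" .
  qed
qed

text \<open>Convergence in \<open>L\<^sup>1\<close> gives almost everywhere convergence of a subsequence, which is enough here and
  avoids differentiation theorems. The convergence is proved in the space weighted
  by the bounded integrable weight \<open>W\<close>: for a bounded continuous approximation of \<open>F\<close> it then follows from pointwise
  convergence by domination, and the weight does no harm to the contraction property.\<close>

lemma gauss_smooth_AE_subseq:
  fixes F :: "'a::euclidean_space \<Rightarrow> complex"
  assumes F: "integrable lborel F" and e: "e \<longlonglongrightarrow> 0" and pos: "\<And>n. e n > 0"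
  obtains r where "strict_mono r" "AE w in lborel. (\<lambda>n. gauss_smooth (e (r n)) F w) \<longlonglongrightarrow> F w"
proof -
  \<comment> \<open>Any integrable weight with values in the interval from \<open>0\<close> (excluded) to \<open>1\<close> would do.\<close>
  define W where "W = (gauss_density 1 :: 'a \<Rightarrow> real)"
  have W: "W w > 0" "W w \<le> 1" for w
  proof -
    show "W w > 0" by (simp add: W_def gauss_density_pos)
    have "(1 / sqrt (2 * pi)) ^ DIM('a) \<le> 1"
      using pi_ge_two by (intro power_le_one) auto
    then show "W w \<le> 1"
      using gauss_density_le[of 1 w] by (simp add: W_def)
  qed
  have [measurable]: "W \<in> borel_measurable borel" by (simp add: W_def)
  have iW: "integrable lborel W" by (simp add: W_def gauss_density_integral)
  have wi: "integrable lborel (\<lambda>w. norm (h w) * W w)" 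
    and wI: "(LINT w|lborel. norm (h w) * W w) \<le> (LINT w|lborel. norm (h w))"
    if h: "integrable lborel h" for h :: "'a \<Rightarrow> complex"
  proof -
    have le: "norm (h w) * W w \<le> norm (h w)" for w
      using W[of w] by (simp add: mult_left_le)
    have [measurable]: "h \<in> borel_measurable borel"
      using h by (simp add: borel_measurable_integrable flip: measurable_lborel1)
    show 1: "integrable lborel (\<lambda>w. norm (h w) * W w)"
      by (rule Bochner_Integration.integrable_bound[OF integrable_norm[OF h]]) (use le W in \<open>auto simp: abs_mult less_imp_le\<close>)
    show "(LINT w|lborel. norm (h w) * W w) \<le> (LINT w|lborel. norm (h w))"
      by (rule integral_mono[OF 1 integrable_norm[OF h] le])
  qed
  define u where "u = (\<lambda>n w. (gauss_smooth (e n) F w - F w) * complex_of_real (W w))"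
  have nu: "norm (u n w) = norm (gauss_smooth (e n) F w - F w) * W w" for n w
    using W(1)[of w] by (simp add: u_def norm_mult)
  have iu: "integrable lborel (u n)" for n
  proof (rule Bochner_Integration.integrable_bound)
    have i: "integrable lborel (\<lambda>w. gauss_smooth (e n) F w - F w)"
      using F gauss_smooth_L1(1)[OF pos F] by auto
    show "integrable lborel (\<lambda>w. norm (gauss_smooth (e n) F w - F w) * W w)"
      by (rule wi[OF i])
    show "u n \<in> borel_measurable lborel"
      using i unfolding u_def by (auto intro!: borel_measurable_times)
  qed (auto simp: nu)
  have "(\<lambda>n. LINT w|lborel. norm (u n w)) \<longlonglongrightarrow> 0"
  proof (rule order_tendstoI)
    fix a :: real assume "a < 0"
    then show "\<forall>\<^sub>F n in sequentially. a < (LINT w|lborel. norm (u n w))"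
      by (intro always_eventually allI less_le_trans[OF _ integral_nonneg_AE]) auto
  next
    fix a :: real assume "0 < a"
    then have "a / 3 > 0" by simp
    from L1_dense_bounded_continuous[OF F this] obtain g B where
      g: "continuous_on UNIV g" "\<And>v. norm (g v) \<le> B" "integrable lborel g"
         "(LINT v|lborel. norm (F v - g v)) < a / 3" by blast
    have [measurable]: "g \<in> borel_measurable borel"
      using g(1) by (rule borel_measurable_continuous_onI)
    have Fg: "integrable lborel (\<lambda>v. F v - g v)"
      using F g(3) by auto
    have "(\<lambda>n. LINT w|lborel. norm (gauss_smooth (e n) g w - g w) * W w) \<longlonglongrightarrow> (LINT w::'a|lborel. 0)"
    proof (rule integral_dominated_convergence[where w="\<lambda>w. (B + B) * W w"])
      show "integrable lborel (\<lambda>w. (B + B) * W w)"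
        using iW by (rule integrable_mult_right)
      show "AE w in lborel. (\<lambda>n. norm (gauss_smooth (e n) g w - g w) * W w) \<longlonglongrightarrow> 0"
      proof (rule AE_I2)
        fix w
        have "(\<lambda>n. gauss_smooth (e n) g w) \<longlonglongrightarrow> g w"
          using g(1,2) e pos by (intro gauss_smooth_tendsto_bounded) (auto simp: continuous_on_eq_continuous_at)
        then have "(\<lambda>n. gauss_smooth (e n) g w - g w) \<longlonglongrightarrow> g w - g w"
          by (intro tendsto_intros)
        then show "(\<lambda>n. norm (gauss_smooth (e n) g w - g w) * W w) \<longlonglongrightarrow> 0"
          by (intro tendsto_mult_left_zero tendsto_norm_zero) simp
      qed
      fix n
      have sb: "norm (gauss_smooth (e n) g w) \<le> B" for w
      proof -
        have "norm (gauss_smooth (e n) g w) \<le> (LINT v|lborel. B * gauss_density (e n) (v - w))"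
          unfolding gauss_smooth_def
        proof (rule order_trans[OF integral_norm_bound integral_mono[OF integrable_norm]])
          have sy: "gauss_density (e n) (v - w) = gauss_density (e n) (w - v)" for v
            by (simp add: gauss_density_eq norm_minus_commute)
          show "integrable lborel (\<lambda>v. B * gauss_density (e n) (v - w))"
            unfolding sy by (intro integrable_mult_right gauss_density_integral_shift pos)
          show "integrable lborel (\<lambda>v. g v * complex_of_real (gauss_density (e n) (v - w)))"
            by (rule gauss_smooth_integrable[OF pos g(3)])
          show "norm (g v * complex_of_real (gauss_density (e n) (v - w))) \<le> B * gauss_density (e n) (v - w)" for v
            using g(2)[of v] gauss_density_pos[OF pos, of n "v - w"] by (simp add: norm_mult mult_right_mono)
        qed
        also have "\<dots> = B"
          using gauss_density_integral_shift(2)[OF pos, of n w]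
          by (simp add: gauss_density_eq norm_minus_commute)
        finally show ?thesis .
      qed
      show "AE w in lborel. norm (norm (gauss_smooth (e n) g w - g w) * W w) \<le> (B + B) * W w"
      proof (rule AE_I2)
        fix w
        have "norm (gauss_smooth (e n) g w - g w) \<le> B + B"
          using norm_triangle_ineq4[of "gauss_smooth (e n) g w" "g w"] sb[of w] g(2)[of w] by linarith
        then show "norm (norm (gauss_smooth (e n) g w - g w) * W w) \<le> (B + B) * W w"
          using W(1)[of w] by (simp add: abs_mult mult_right_mono)
      qed
      have "gauss_smooth (e n) g \<in> borel_measurable lborel"
        using gauss_smooth_L1(1)[OF pos g(3)] by (rule borel_measurable_integrable)
      then show "(\<lambda>w. norm (gauss_smooth (e n) g w - g w) * W w) \<in> borel_measurable lborel"
        by measurable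
    qed simp
    then have "\<forall>\<^sub>F n in sequentially. (LINT w|lborel. norm (gauss_smooth (e n) g w - g w) * W w) < a / 3"
      using \<open>a / 3 > 0\<close> by (intro order_tendstoD(2)[where y=0]) auto
    then show "\<forall>\<^sub>F n in sequentially. (LINT w|lborel. norm (u n w)) < a"
    proof eventually_elim
      fix n assume n: "(LINT w|lborel. norm (gauss_smooth (e n) g w - g w) * W w) < a / 3"
      let ?A = "\<lambda>w. norm (gauss_smooth (e n) (\<lambda>v. F v - g v) w) * W w"
      let ?B = "\<lambda>w. norm (gauss_smooth (e n) g w - g w) * W w"
      let ?C = "\<lambda>w. norm (F w - g w) * W w"
      have i: "integrable lborel ?A" "integrable lborel ?B" "integrable lborel ?C"
        by (intro wi gauss_smooth_L1(1) pos Fg Bochner_Integration.integrable_diff g(3))+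
      have "(LINT w|lborel. norm (u n w)) \<le> (LINT w|lborel. ?A w + ?B w + ?C w)"
      proof (rule integral_mono)
        fix w
        have "gauss_smooth (e n) F w - F w = gauss_smooth (e n) (\<lambda>v. F v - g v) w + (gauss_smooth (e n) g w - g w) - (F w - g w)"
          using gauss_smooth_minus[OF pos F g(3), of n w] by simp
        then have "norm (gauss_smooth (e n) F w - F w)
            \<le> norm (gauss_smooth (e n) (\<lambda>v. F v - g v) w) + norm (gauss_smooth (e n) g w - g w) + norm (F w - g w)"
          by (metis (no_types) add_right_mono norm_triangle_ineq norm_triangle_ineq4 order_trans)
        then show "norm (u n w) \<le> ?A w + ?B w + ?C w"
          using W(1)[of w] unfolding nu by (metis (no_types) distrib_right less_imp_le mult_right_mono)
      qed (use i iu in auto)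
      also have "\<dots> = (LINT w|lborel. ?A w) + (LINT w|lborel. ?B w) + (LINT w|lborel. ?C w)"
        using i by simp
      also have "(LINT w|lborel. ?A w) \<le> (LINT w|lborel. norm (gauss_smooth (e n) (\<lambda>v. F v - g v) w))"
        by (intro wI gauss_smooth_L1(1) pos Fg)
      also have "\<dots> \<le> (LINT v|lborel. norm (F v - g v))"
        by (intro gauss_smooth_L1(2) pos Fg)
      also have "(LINT w|lborel. ?C w) \<le> (LINT v|lborel. norm (F v - g v))"
        by (intro wI Fg)
      finally show "(LINT w|lborel. norm (u n w)) < a"
        using n g(4) by linarith
    qed
  qed
  from tendsto_L1_AE_subseq[OF iu this] obtain r where
    r: "strict_mono r" "AE w in lborel. (\<lambda>n. u (r n) w) \<longlonglongrightarrow> 0" by blast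
  show thesis
  proof (rule that[OF r(1)])
    show "AE w in lborel. (\<lambda>n. gauss_smooth (e (r n)) F w) \<longlonglongrightarrow> F w"
      using r(2)
    proof eventually_elim
      fix w assume "(\<lambda>n. u (r n) w) \<longlonglongrightarrow> 0"
      then have "(\<lambda>n. u (r n) w / complex_of_real (W w) + F w) \<longlonglongrightarrow> 0 / complex_of_real (W w) + F w"
        by (intro tendsto_intros) (use W(1)[of w] in auto)
      then show "(\<lambda>n. gauss_smooth (e (r n)) F w) \<longlonglongrightarrow> F w"
        using W(1)[of w] by (simp add: u_def)
    qed
  qed
qed

section \<open>Polar coordinates for three vectors in the plane\<close>

lemma fst_snd_borel_measurable [measurable]:
  "fst \<in> borel_measurable (borel :: ('a::second_countable_topology \<times> 'b::second_countable_topology) measure)"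
  "snd \<in> borel_measurable (borel :: ('a::second_countable_topology \<times> 'b::second_countable_topology) measure)"
  by (intro borel_measurable_continuous_onI continuous_intros)+

definition polar :: "real \<Rightarrow> real \<Rightarrow> real^2" where
  "polar r t = vector [r * cos t, r * sin t]"

lemma polar_nth [simp]: "polar r t $ 1 = r * cos t" "polar r t $ 2 = r * sin t"
  by (simp_all add: polar_def)

lemma vector2_eq: "vector [a, b] = a *\<^sub>R axis 1 1 + b *\<^sub>R (axis 2 1 :: real^2)"
  by (simp add: vec_eq_iff forall_2 axis_def)

lemma vector2_measurable [measurable]:
  "(\<lambda>p. vector [fst p, snd p] :: real^2) \<in> borel_measurable (borel :: (real \<times> real) measure)"
  unfolding vector2_eq by measurable

lemma polar_measurable [measurable (raw)]:
  assumes [measurable]: "f \<in> borel_measurable M" "g \<in> borel_measurable M"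
  shows "(\<lambda>x. polar (f x) (g x)) \<in> borel_measurable M"
  unfolding polar_def vector2_eq by measurable

lemma polar_periodic: "polar r (t + 2 * pi * of_int k) = polar r t"
  by (simp add: polar_def cos_add sin_add)

lemma vec_nth_measurable [measurable]: "(\<lambda>v :: real^2. v $ i) \<in> borel_measurable borel"
  by (intro borel_measurable_continuous_onI continuous_intros)

lemma distr_vector2: "distr lborel borel (\<lambda>p. vector [fst p, snd p]) = (lborel :: (real^2) measure)"
proof (rule lborel_eqI[symmetric])
  fix l u :: "real^2"
  assume lu: "\<And>b. b \<in> Basis \<Longrightarrow> l \<bullet> b \<le> u \<bullet> b"
  have le: "l $ i \<le> u $ i" for i
    using lu[of "axis i 1"] by (simp add: axis_in_Basis_iff inner_axis)
  have pre: "(\<lambda>p. vector [fst p, snd p]) -` box l u = {l$1<..<u$1} \<times> {l$2<..<u$2}"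
    by (auto simp: mem_box_cart forall_2)
  have "emeasure (distr lborel borel (\<lambda>p. vector [fst p, snd p])) (box l u)
      = emeasure (lborel \<Otimes>\<^sub>M lborel) ({l$1<..<u$1} \<times> {l$2<..<u$2})"
    by (subst emeasure_distr) (simp_all add: pre lborel_prod)
  also have "\<dots> = ennreal (u$1 - l$1) * ennreal (u$2 - l$2)"
    by (subst lborel.emeasure_pair_measure_Times) (simp_all add: le)
  also have "\<dots> = ennreal ((u$1 - l$1) * (u$2 - l$2))"
    using le by (simp add: ennreal_mult)
  also have "(u$1 - l$1) * (u$2 - l$2) = (\<Prod>b\<in>Basis. (u - l) \<bullet> b)"
    by (simp add: Basis_vec_def UNIV_2 inner_axis prod.UNION_disjoint axis_eq_axis)
  finally show "emeasure (distr lborel borel (\<lambda>p. vector [fst p, snd p])) (box l u)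
      = (\<Prod>b\<in>Basis. (u - l) \<bullet> b)" .
qed simp

definition polar_weight :: "real \<Rightarrow> ennreal" where
  "polar_weight r = ennreal r * indicator {0<..} r"

text \<open>The indicator of one full turn as a weight for angles.\<close>

abbreviation turn :: "real \<Rightarrow> ennreal" where
  "turn \<equiv> indicator {0..<2 * pi}"

lemma polar_weight_measurable [measurable]: "polar_weight \<in> borel_measurable borel"
  unfolding polar_weight_def by measurable

text \<open>The change of variables theorem for the polar map, which is injective on \<open>r > 0\<close>, \<open>0 \<le> t < 2 \<pi>\<close> with Jacobian
  determinant \<open>r\<close> and misses only the origin.\<close>

lemma polar_box_emeasure:
  fixes l u :: "real^2"
  shows "(\<integral>\<^sup>+p. polar_weight (fst p) * turn (snd p) * indicator (box l u) (polar (fst p) (snd p)) \<partial>lborel)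
      = emeasure lborel (box l u)"
proof -
  define T where "T = {v :: real^2. v$1 > 0 \<and> 0 \<le> v$2 \<and> v$2 < 2 * pi \<and> polar (v$1) (v$2) \<in> box l u}"
  define f where "f = (\<lambda>v :: real^2. polar (v$1) (v$2))"
  define f' where "f' = (\<lambda>(v :: real^2) (h :: real^2). vector [h$1 * cos (v$2) - v$1 * sin (v$2) * h$2,
     h$1 * sin (v$2) + v$1 * cos (v$2) * h$2] :: real^2)"
  have T [measurable]: "T \<in> sets borel"
    unfolding T_def by measurable
  have der: "(f has_derivative f' v) (at v within S)" for v S
    unfolding f_def polar_def f'_def vector2_eq
    by (auto intro!: derivative_eq_intros bounded_linear_imp_has_derivative[OF bounded_linear_vec_nth]
        simp: fun_eq_iff algebra_simps)
  have "matrix (f' v) $ 1 $ 1 = cos (v$2)" "matrix (f' v) $ 2 $ 1 = sin (v$2)"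
    "matrix (f' v) $ 1 $ 2 = - v$1 * sin (v$2)" "matrix (f' v) $ 2 $ 2 = v$1 * cos (v$2)" for v
    by (simp_all add: matrix_def f'_def axis_def)
  then have "det (matrix (f' v)) = v$1 * ((sin (v$2))\<^sup>2 + (cos (v$2))\<^sup>2)" for v
    by (simp only: det_2 power2_eq_square) (simp add: algebra_simps del: sin_cos_squared_add3)
  then have det: "det (matrix (f' v)) = v$1" for v
    by (simp only: sin_cos_squared_add mult_1_right)
  have inj: "inj_on f T"
  proof (rule inj_onI)
    fix v w assume v: "v \<in> T" and w: "w \<in> T" and eq: "f v = f w"
    have c: "v$1 * cos (v$2) = w$1 * cos (w$2)" and s: "v$1 * sin (v$2) = w$1 * sin (w$2)"
      using eq unfolding f_def by (metis polar_nth(1), metis polar_nth(2))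
    have "(v$1)\<^sup>2 = (v$1 * cos (v$2))\<^sup>2 + (v$1 * sin (v$2))\<^sup>2" "(w$1)\<^sup>2 = (w$1 * cos (w$2))\<^sup>2 + (w$1 * sin (w$2))\<^sup>2"
      by (simp_all add: power_mult_distrib distrib_left[symmetric])
    then have "(v$1)\<^sup>2 = (w$1)\<^sup>2" using c s by simp
    then have r: "v$1 = w$1" using v w by (simp add: T_def power2_eq_iff_nonneg)
    then have "cos (v$2) = cos (w$2)" "sin (v$2) = sin (w$2)"
      using c s v w by (auto simp: T_def)
    then obtain n :: int where n: "v$2 = w$2 + 2 * pi * of_int n"
      using sin_cos_eq_iff[of "v$2" "w$2"] by auto
    have "\<bar>v$2 - w$2\<bar> < 2 * pi"
      using v w by (auto simp: T_def abs_if)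
    then have "\<bar>of_int n :: real\<bar> < 1"
      by (simp add: n abs_mult)
    then have "v$2 = w$2" using n by simp
    then show "v = w" using r by (simp add: vec_eq_iff forall_2)
  qed
  have img: "f ` T = box l u - {0}"
  proof (intro equalityI subsetI)
    fix x assume "x \<in> f ` T"
    then obtain v where v: "v \<in> T" "x = f v" by blast
    then have "x \<in> box l u" by (simp add: T_def f_def)
    moreover have "x \<noteq> 0"
    proof
      assume "x = 0"
      then have "v$1 * cos (v$2) = 0" "v$1 * sin (v$2) = 0"
        using v(2) unfolding f_def by (metis polar_nth(1) zero_index, metis polar_nth(2) zero_index)
      then have "cos (v$2) = 0" "sin (v$2) = 0" using v(1) by (auto simp: T_def)
      then show False using sin_cos_squared_add[of "v$2"] by simp
    qed
    ultimately show "x \<in> box l u - {0}" by simp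
  next
    fix x assume x: "x \<in> box l u - {0}"
    define r where "r = norm x"
    have r: "r > 0" using x by (simp add: r_def)
    have "r\<^sup>2 = (x$1)\<^sup>2 + (x$2)\<^sup>2"
      by (simp add: r_def norm_vec_def L2_set_def sum_2)
    then have "((x$1)\<^sup>2 + (x$2)\<^sup>2) / r\<^sup>2 = 1"
      using r by (metis divide_self less_irrefl zero_less_power)
    then have "(x$1 / r)\<^sup>2 + (x$2 / r)\<^sup>2 = 1"
      by (simp only: power_divide add_divide_distrib)
    then obtain t where t: "0 \<le> t" "t < 2 * pi" "x$1 / r = cos t" "x$2 / r = sin t"
      by (rule sincos_total_2pi)
    then have "x = f (vector [r, t])"
      using r by (auto simp: f_def vec_eq_iff forall_2 field_simps)
    moreover have "vector [r, t] \<in> T"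
      using t r x calculation by (simp add: T_def f_def)
    ultimately show "x \<in> f ` T" by blast
  qed
  have "box l u - {0} \<in> lmeasurable"
    by (intro fmeasurable.Diff lmeasurable_box) (auto simp: bounded_set_imp_lmeasurable)
  moreover have "measure lebesgue (box l u - {0}) = measure lborel (box l u)"
    by (subst measure_Diff_null_set) auto
  ultimately have "((\<lambda>v. \<bar>det (matrix (f' v))\<bar>) has_integral measure lborel (box l u)) T"
    by (intro iffD1[OF has_measure_differentiable_image[where f=f]] der inj) (auto simp: img)
  then have "(\<integral>\<^sup>+v. indicator T v * \<bar>det (matrix (f' v))\<bar> \<partial>lborel) = measure lborel (box l u)"
    by (intro nn_integral_has_integral_lebesgue) auto
  also have "(\<integral>\<^sup>+v. indicator T v * \<bar>det (matrix (f' v))\<bar> \<partial>lborel)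
      = (\<integral>\<^sup>+v. polar_weight (v$1) * turn (v$2) * indicator (box l u) (polar (v$1) (v$2)) \<partial>(lborel :: (real^2) measure))"
    by (intro nn_integral_cong) (auto simp: det T_def polar_weight_def indicator_def)
  also have "\<dots> = (\<integral>\<^sup>+p. polar_weight (fst p) * turn (snd p) * indicator (box l u) (polar (fst p) (snd p)) \<partial>lborel)"
    unfolding distr_vector2[symmetric] by (subst nn_integral_distr) auto
  finally have "(\<integral>\<^sup>+p. polar_weight (fst p) * turn (snd p) * indicator (box l u) (polar (fst p) (snd p)) \<partial>lborel)
      = ennreal (measure lborel (box l u))" .
  also have "\<dots> = emeasure lborel (box l u)"
    by (intro emeasure_eq_ennreal_measure[symmetric])
       (metis emeasure_lborel_box_finite infinity_ennreal_def less_irrefl)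
  finally show ?thesis .
qed

lemma lborel_polar:
  "(lborel :: (real^2) measure)
     = distr (density lborel (\<lambda>p. polar_weight (fst p) * turn (snd p))) borel (\<lambda>p. polar (fst p) (snd p))"
proof (rule lborel_eqI)
  fix l u :: "real^2"
  assume lu: "\<And>b. b \<in> Basis \<Longrightarrow> l \<bullet> b \<le> u \<bullet> b"
  have "emeasure (distr (density lborel (\<lambda>p. polar_weight (fst p) * turn (snd p))) borel (\<lambda>p. polar (fst p) (snd p))) (box l u)
    = (\<integral>\<^sup>+p. polar_weight (fst p) * turn (snd p) * indicator (box l u) (polar (fst p) (snd p)) \<partial>lborel)"
    by (subst emeasure_distr, simp, simp, subst emeasure_density)
       (auto intro!: nn_integral_cong measurable_sets_borel[of _ borel] simp: indicator_def)
  also have "\<dots> = (\<Prod>b\<in>Basis. (u - l) \<bullet> b)"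
    unfolding polar_box_emeasure using lu by (simp add: emeasure_lborel_box)
  finally show "emeasure (distr (density lborel (\<lambda>p. polar_weight (fst p) * turn (snd p))) borel (\<lambda>p. polar (fst p) (snd p))) (box l u)
      = (\<Prod>b\<in>Basis. (u - l) \<bullet> b)" .
qed simp

lemma nn_integral_lborel_fold:
  fixes f :: "'a::euclidean_space \<times> 'b::euclidean_space \<Rightarrow> ennreal"
  assumes "f \<in> borel_measurable borel"
  shows "(\<integral>\<^sup>+z. f z \<partial>lborel) = (\<integral>\<^sup>+x. \<integral>\<^sup>+y. f (x, y) \<partial>lborel \<partial>lborel)"
  using assms by (subst lborel_prod[symmetric], subst lborel.nn_integral_fst[symmetric]) (simp_all add: lborel_prod)

lemma nn_integral_lborel_swap:
  fixes f :: "'a::euclidean_space \<Rightarrow> 'b::euclidean_space \<Rightarrow> ennreal"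
  assumes "(\<lambda>(x, y). f x y) \<in> borel_measurable borel"
  shows "(\<integral>\<^sup>+x. \<integral>\<^sup>+y. f x y \<partial>lborel \<partial>lborel) = (\<integral>\<^sup>+y. \<integral>\<^sup>+x. f x y \<partial>lborel \<partial>lborel)"
  using assms by (intro lborel_pair.Fubini'[symmetric]) (simp add: lborel_prod)

lemma nn_integral_polar:
  assumes [measurable]: "f \<in> borel_measurable borel"
  shows "(\<integral>\<^sup>+x. f x \<partial>(lborel :: (real^2) measure))
    = (\<integral>\<^sup>+r. polar_weight r * (\<integral>\<^sup>+t. turn t * f (polar r t) \<partial>lborel) \<partial>lborel)"
proof -
  have "(\<integral>\<^sup>+x. f x \<partial>(lborel :: (real^2) measure))
     = (\<integral>\<^sup>+p. polar_weight (fst p) * turn (snd p) * f (polar (fst p) (snd p)) \<partial>lborel)"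
    by (subst lborel_polar) (simp add: nn_integral_distr nn_integral_density)
  also have "\<dots> = (\<integral>\<^sup>+r. \<integral>\<^sup>+t. polar_weight r * (turn t * f (polar r t)) \<partial>lborel \<partial>lborel)"
    by (subst nn_integral_lborel_fold) (simp_all add: mult.assoc)
  also have "\<dots> = (\<integral>\<^sup>+r. polar_weight r * (\<integral>\<^sup>+t. turn t * f (polar r t) \<partial>lborel) \<partial>lborel)"
    by (intro nn_integral_cong nn_integral_cmult) simp
  finally show ?thesis .
qed

lemma nn_integral_turn_shift:
  fixes h :: "real \<Rightarrow> ennreal"
  assumes [measurable]: "h \<in> borel_measurable borel" and per: "\<And>t k. h (t + 2 * pi * of_int k) = h t"
  shows "(\<integral>\<^sup>+t. turn t * h (a + t) \<partial>lborel) = (\<integral>\<^sup>+t. turn t * h t \<partial>lborel)"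
proof -
  have main: "(\<integral>\<^sup>+t. turn t * h (a + t) \<partial>lborel) = (\<integral>\<^sup>+t. turn t * h t \<partial>lborel)" if a: "0 \<le> a" "a < 2 * pi" for a
  proof -
    have "(\<integral>\<^sup>+t. turn t * h (a + t) \<partial>lborel) = (\<integral>\<^sup>+t. indicator {a..<a + 2 * pi} t * h t \<partial>lborel)"
      by (subst (2) nn_integral_real_affine[where c=1 and t=a])
         (auto intro!: nn_integral_cong simp: indicator_def)
    also have "\<dots> = (\<integral>\<^sup>+t. indicator {a..<2 * pi} t * h t + indicator {2 * pi..<a + 2 * pi} t * h t \<partial>lborel)"
      using a by (intro nn_integral_cong) (auto simp: indicator_def)
    also have "\<dots> = (\<integral>\<^sup>+t. indicator {a..<2 * pi} t * h t \<partial>lborel) + (\<integral>\<^sup>+t. indicator {2 * pi..<a + 2 * pi} t * h t \<partial>lborel)"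
      by (intro nn_integral_add) auto
    also have "(\<integral>\<^sup>+t. indicator {2 * pi..<a + 2 * pi} t * h t \<partial>lborel) = (\<integral>\<^sup>+t. indicator {0..<a} t * h t \<partial>lborel)"
      using per[of _ 1]
      by (subst nn_integral_real_affine[where c=1 and t="2 * pi"])
         (auto intro!: nn_integral_cong simp: indicator_def add.commute)
    also have "(\<integral>\<^sup>+t. indicator {a..<2 * pi} t * h t \<partial>lborel) + (\<integral>\<^sup>+t. indicator {0..<a} t * h t \<partial>lborel)
        = (\<integral>\<^sup>+t. indicator {a..<2 * pi} t * h t + indicator {0..<a} t * h t \<partial>lborel)"
      by (intro nn_integral_add[symmetric]) auto
    also have "\<dots> = (\<integral>\<^sup>+t. turn t * h t \<partial>lborel)"
      using a by (intro nn_integral_cong) (auto simp: indicator_def)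
    finally show ?thesis .
  qed
  define k where "k = \<lfloor>a / (2 * pi)\<rfloor>"
  have k: "of_int k \<le> a / (2 * pi)" "a / (2 * pi) < of_int k + 1"
    unfolding k_def by linarith+
  then have "0 \<le> a - 2 * pi * of_int k" "a - 2 * pi * of_int k < 2 * pi"
    by (simp_all add: field_simps)
  from main[OF this] show ?thesis
    using per[of "a - 2 * pi * of_int k + t" k for t] by (simp add: algebra_simps)
qed

text \<open>A full turn seen from the direction \<open>c\<close>: the angles on either side of \<open>c\<close>. This is where the signs of
  the quadrilaterals come from.\<close>

lemma nn_integral_turn_reflect:
  fixes h :: "real \<Rightarrow> ennreal"
  assumes [measurable]: "h \<in> borel_measurable borel" and per: "\<And>t k. h (t + 2 * pi * of_int k) = h t"
  shows "(\<integral>\<^sup>+t. turn t * h t \<partial>lborel)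
    = (\<Sum>e\<in>{1, - 1}. \<integral>\<^sup>+a. indicator {0<..<pi} a * h (c + e * a) \<partial>lborel)"
proof -
  have "(\<integral>\<^sup>+t. turn t * h t \<partial>lborel) = (\<integral>\<^sup>+t. turn t * h (c + t) \<partial>lborel)"
    by (rule nn_integral_turn_shift[symmetric]) (use per in auto)
  also have "\<dots> = (\<integral>\<^sup>+t. indicator {0<..<pi} t * h (c + t) + indicator {pi<..<2 * pi} t * h (c + t) \<partial>lborel)"
  proof (rule nn_integral_cong_AE)
    show "AE t in lborel. turn t * h (c + t) = indicator {0<..<pi} t * h (c + t) + indicator {pi<..<2 * pi} t * h (c + t)"
      using AE_lborel_singleton[of 0] AE_lborel_singleton[of pi]
      by eventually_elim (auto simp: indicator_def)
  qed
  also have "\<dots> = (\<integral>\<^sup>+t. indicator {0<..<pi} t * h (c + t) \<partial>lborel) + (\<integral>\<^sup>+t. indicator {pi<..<2 * pi} t * h (c + t) \<partial>lborel)"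
    by (intro nn_integral_add) auto
  also have "(\<integral>\<^sup>+t. indicator {pi<..<2 * pi} t * h (c + t) \<partial>lborel) = (\<integral>\<^sup>+a. indicator {0<..<pi} a * h (c - a) \<partial>lborel)"
    using per[of "c - t" 1 for t]
    by (subst nn_integral_real_affine[where c="-1" and t="2 * pi"])
       (auto intro!: nn_integral_cong simp: indicator_def algebra_simps)
  finally show ?thesis by simp
qed


text \<open>The radius and angle of the vector \<open>\<omega>\<^sub>4\<close> are integrated outermost and those of \<open>\<omega>\<^sub>2\<close> innermost, so that the angle of
  each vector can be measured relative to the vectors before it.\<close>

lemma nn_integral_three_polar:
  fixes H :: "(real^2) \<times> (real^2) \<times> (real^2) \<Rightarrow> ennreal"
  assumes [measurable]: "H \<in> borel_measurable borel"
  shows "(\<integral>\<^sup>+w. H w \<partial>lborel)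
    = (\<integral>\<^sup>+r4. polar_weight r4 * (\<integral>\<^sup>+t4. turn t4 *
       (\<integral>\<^sup>+r3. polar_weight r3 * (\<integral>\<^sup>+t3. turn t3 *
        (\<integral>\<^sup>+r2. polar_weight r2 * (\<integral>\<^sup>+t2. turn t2 *
           H (polar r2 t2, polar r3 t3, polar r4 t4) \<partial>lborel) \<partial>lborel) \<partial>lborel) \<partial>lborel) \<partial>lborel) \<partial>lborel)"
proof -
  have s1: "(\<integral>\<^sup>+w. H w \<partial>lborel) = (\<integral>\<^sup>+x2. \<integral>\<^sup>+x34. H (x2, x34) \<partial>lborel \<partial>lborel)"
    by (rule nn_integral_lborel_fold) measurable
  have s2: "\<dots> = (\<integral>\<^sup>+x34. \<integral>\<^sup>+x2. H (x2, x34) \<partial>lborel \<partial>lborel)"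
    by (rule nn_integral_lborel_swap) measurable
  have s3: "\<dots> = (\<integral>\<^sup>+x3. \<integral>\<^sup>+x4. \<integral>\<^sup>+x2. H (x2, x3, x4) \<partial>lborel \<partial>lborel \<partial>lborel)"
    by (rule nn_integral_lborel_fold) measurable
  have s4: "\<dots> = (\<integral>\<^sup>+x4. \<integral>\<^sup>+x3. \<integral>\<^sup>+x2. H (x2, x3, x4) \<partial>lborel \<partial>lborel \<partial>lborel)"
    by (rule nn_integral_lborel_swap) measurable
  have s5: "\<dots> = (\<integral>\<^sup>+r4. polar_weight r4 * (\<integral>\<^sup>+t4. turn t4 *
      (\<integral>\<^sup>+x3. \<integral>\<^sup>+x2. H (x2, x3, polar r4 t4) \<partial>lborel \<partial>lborel) \<partial>lborel) \<partial>lborel)"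
    by (rule nn_integral_polar) measurable
  have s6: "\<And>r4 t4. (\<integral>\<^sup>+x3. \<integral>\<^sup>+x2. H (x2, x3, polar r4 t4) \<partial>lborel \<partial>lborel)
     = (\<integral>\<^sup>+r3. polar_weight r3 * (\<integral>\<^sup>+t3. turn t3 * (\<integral>\<^sup>+x2. H (x2, polar r3 t3, polar r4 t4) \<partial>lborel) \<partial>lborel) \<partial>lborel)"
    by (rule nn_integral_polar) measurable
  have s7: "\<And>r3 t3 r4 t4. (\<integral>\<^sup>+x2. H (x2, polar r3 t3, polar r4 t4) \<partial>lborel)
     = (\<integral>\<^sup>+r2. polar_weight r2 * (\<integral>\<^sup>+t2. turn t2 * H (polar r2 t2, polar r3 t3, polar r4 t4) \<partial>lborel) \<partial>lborel)"
    by (rule nn_integral_polar) measurable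
  show ?thesis
    by (simp only: s1 s2 s3 s4 s5 s6 s7)
qed


text \<open>The order of integration in \<open>nn_integral_three_polar\<close>, as opposed to the order of the coordinates in
  \<open>space_range\<close>; the next lemma does the same for \<open>invariant_range\<close>.\<close>

lemma nn_integral_reorder_space:
  fixes f :: "real \<times> real \<times> real \<times> real \<times> real \<times> real \<Rightarrow> ennreal"
  assumes [measurable]: "f \<in> borel_measurable borel"
  shows "(\<integral>\<^sup>+y. f y \<partial>lborel) = (\<integral>\<^sup>+r4. \<integral>\<^sup>+t. \<integral>\<^sup>+r3. \<integral>\<^sup>+t3. \<integral>\<^sup>+r2. \<integral>\<^sup>+t2. f (t, r2, t2, r3, t3, r4)
      \<partial>lborel \<partial>lborel \<partial>lborel \<partial>lborel \<partial>lborel \<partial>lborel)"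
proof -
  have s1: "(\<integral>\<^sup>+y. f y \<partial>lborel) = (\<integral>\<^sup>+t. \<integral>\<^sup>+y. f (t, y) \<partial>lborel \<partial>lborel)"
    by (rule nn_integral_lborel_fold) measurable
  have s2: "\<And>t. (\<integral>\<^sup>+y. f (t, y) \<partial>lborel) = (\<integral>\<^sup>+r2. \<integral>\<^sup>+y. f (t, r2, y) \<partial>lborel \<partial>lborel)"
    by (rule nn_integral_lborel_fold) measurable
  have s3: "\<And>t r2. (\<integral>\<^sup>+y. f (t, r2, y) \<partial>lborel) = (\<integral>\<^sup>+t2. \<integral>\<^sup>+y. f (t, r2, t2, y) \<partial>lborel \<partial>lborel)"
    by (rule nn_integral_lborel_fold) measurable
  have s4: "\<And>t r2. (\<integral>\<^sup>+t2. \<integral>\<^sup>+y. f (t, r2, t2, y) \<partial>lborel \<partial>lborel) = (\<integral>\<^sup>+y. \<integral>\<^sup>+t2. f (t, r2, t2, y) \<partial>lborel \<partial>lborel)"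
    by (rule nn_integral_lborel_swap) measurable
  have s5: "\<And>t. (\<integral>\<^sup>+r2. \<integral>\<^sup>+y. \<integral>\<^sup>+t2. f (t, r2, t2, y) \<partial>lborel \<partial>lborel \<partial>lborel)
      = (\<integral>\<^sup>+y. \<integral>\<^sup>+r2. \<integral>\<^sup>+t2. f (t, r2, t2, y) \<partial>lborel \<partial>lborel \<partial>lborel)"
    by (rule nn_integral_lborel_swap) measurable
  have s6: "\<And>t. (\<integral>\<^sup>+y. \<integral>\<^sup>+r2. \<integral>\<^sup>+t2. f (t, r2, t2, y) \<partial>lborel \<partial>lborel \<partial>lborel)
      = (\<integral>\<^sup>+r3. \<integral>\<^sup>+y. \<integral>\<^sup>+r2. \<integral>\<^sup>+t2. f (t, r2, t2, r3, y) \<partial>lborel \<partial>lborel \<partial>lborel \<partial>lborel)"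
    by (rule nn_integral_lborel_fold) measurable
  have s7: "\<And>t r3. (\<integral>\<^sup>+y. \<integral>\<^sup>+r2. \<integral>\<^sup>+t2. f (t, r2, t2, r3, y) \<partial>lborel \<partial>lborel \<partial>lborel)
      = (\<integral>\<^sup>+t3. \<integral>\<^sup>+r4. \<integral>\<^sup>+r2. \<integral>\<^sup>+t2. f (t, r2, t2, r3, t3, r4) \<partial>lborel \<partial>lborel \<partial>lborel \<partial>lborel)"
    by (rule nn_integral_lborel_fold) measurable
  have s8: "\<And>t r3. (\<integral>\<^sup>+t3. \<integral>\<^sup>+r4. \<integral>\<^sup>+r2. \<integral>\<^sup>+t2. f (t, r2, t2, r3, t3, r4) \<partial>lborel \<partial>lborel \<partial>lborel \<partial>lborel)
      = (\<integral>\<^sup>+r4. \<integral>\<^sup>+t3. \<integral>\<^sup>+r2. \<integral>\<^sup>+t2. f (t, r2, t2, r3, t3, r4) \<partial>lborel \<partial>lborel \<partial>lborel \<partial>lborel)"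
    by (rule nn_integral_lborel_swap) measurable
  have s9: "\<And>t. (\<integral>\<^sup>+r3. \<integral>\<^sup>+r4. \<integral>\<^sup>+t3. \<integral>\<^sup>+r2. \<integral>\<^sup>+t2. f (t, r2, t2, r3, t3, r4) \<partial>lborel \<partial>lborel \<partial>lborel \<partial>lborel \<partial>lborel)
      = (\<integral>\<^sup>+r4. \<integral>\<^sup>+r3. \<integral>\<^sup>+t3. \<integral>\<^sup>+r2. \<integral>\<^sup>+t2. f (t, r2, t2, r3, t3, r4) \<partial>lborel \<partial>lborel \<partial>lborel \<partial>lborel \<partial>lborel)"
    by (rule nn_integral_lborel_swap) measurable
  have s10: "(\<integral>\<^sup>+t. \<integral>\<^sup>+r4. \<integral>\<^sup>+r3. \<integral>\<^sup>+t3. \<integral>\<^sup>+r2. \<integral>\<^sup>+t2. f (t, r2, t2, r3, t3, r4) \<partial>lborel \<partial>lborel \<partial>lborel \<partial>lborel \<partial>lborel \<partial>lborel)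
      = (\<integral>\<^sup>+r4. \<integral>\<^sup>+t. \<integral>\<^sup>+r3. \<integral>\<^sup>+t3. \<integral>\<^sup>+r2. \<integral>\<^sup>+t2. f (t, r2, t2, r3, t3, r4) \<partial>lborel \<partial>lborel \<partial>lborel \<partial>lborel \<partial>lborel \<partial>lborel)"
    by (rule nn_integral_lborel_swap) measurable
  show ?thesis
    by (simp only: s1 s2 s3 s4 s5 s6 s7 s8 s9 s10)
qed

lemma nn_integral_reorder_invariants:
  fixes f :: "real \<times> real \<times> real \<times> real \<times> real \<times> real \<Rightarrow> ennreal"
  assumes [measurable]: "f \<in> borel_measurable borel"
  shows "(\<integral>\<^sup>+y. f y \<partial>lborel) = (\<integral>\<^sup>+r4. \<integral>\<^sup>+t. \<integral>\<^sup>+r3. \<integral>\<^sup>+b. \<integral>\<^sup>+r2. \<integral>\<^sup>+a. f (t, a, r2, r3, r4, b)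
      \<partial>lborel \<partial>lborel \<partial>lborel \<partial>lborel \<partial>lborel \<partial>lborel)"
proof -
  have [measurable]: "(\<lambda>(t, r2, a, r3, b, r4). f (t, a, r2, r3, r4, b)) \<in> borel_measurable borel"
    by measurable
  have s1: "(\<integral>\<^sup>+y. f y \<partial>lborel) = (\<integral>\<^sup>+t. \<integral>\<^sup>+y. f (t, y) \<partial>lborel \<partial>lborel)"
    by (rule nn_integral_lborel_fold) measurable
  have s2: "\<And>t. (\<integral>\<^sup>+y. f (t, y) \<partial>lborel) = (\<integral>\<^sup>+a. \<integral>\<^sup>+y. f (t, a, y) \<partial>lborel \<partial>lborel)"
    by (rule nn_integral_lborel_fold) measurable
  have s3: "\<And>t a. (\<integral>\<^sup>+y. f (t, a, y) \<partial>lborel) = (\<integral>\<^sup>+r2. \<integral>\<^sup>+y. f (t, a, r2, y) \<partial>lborel \<partial>lborel)"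
    by (rule nn_integral_lborel_fold) measurable
  have s4: "\<And>t. (\<integral>\<^sup>+a. \<integral>\<^sup>+r2. \<integral>\<^sup>+y. f (t, a, r2, y) \<partial>lborel \<partial>lborel \<partial>lborel)
      = (\<integral>\<^sup>+r2. \<integral>\<^sup>+a. \<integral>\<^sup>+y. f (t, a, r2, y) \<partial>lborel \<partial>lborel \<partial>lborel)"
    by (rule nn_integral_lborel_swap) measurable
  have s5: "\<And>t a r2. (\<integral>\<^sup>+y. f (t, a, r2, y) \<partial>lborel) = (\<integral>\<^sup>+r3. \<integral>\<^sup>+y. f (t, a, r2, r3, y) \<partial>lborel \<partial>lborel)"
    by (rule nn_integral_lborel_fold) measurable
  have s6: "\<And>t a r2 r3. (\<integral>\<^sup>+y. f (t, a, r2, r3, y) \<partial>lborel) = (\<integral>\<^sup>+r4. \<integral>\<^sup>+b. f (t, a, r2, r3, r4, b) \<partial>lborel \<partial>lborel)"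
    by (rule nn_integral_lborel_fold) measurable
  have s7: "\<And>t a r2 r3. (\<integral>\<^sup>+r4. \<integral>\<^sup>+b. f (t, a, r2, r3, r4, b) \<partial>lborel \<partial>lborel) = (\<integral>\<^sup>+b. \<integral>\<^sup>+r4. f (t, a, r2, r3, r4, b) \<partial>lborel \<partial>lborel)"
    by (rule nn_integral_lborel_swap) measurable
  have s8: "(\<integral>\<^sup>+t. \<integral>\<^sup>+r2. \<integral>\<^sup>+a. \<integral>\<^sup>+r3. \<integral>\<^sup>+b. \<integral>\<^sup>+r4. f (t, a, r2, r3, r4, b) \<partial>lborel \<partial>lborel \<partial>lborel \<partial>lborel \<partial>lborel \<partial>lborel)
      = (\<integral>\<^sup>+y. (\<lambda>(t, r2, a, r3, b, r4). f (t, a, r2, r3, r4, b)) y \<partial>lborel)"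
    by (simp add: nn_integral_lborel_fold split_beta')
  have s9: "(\<integral>\<^sup>+y. (\<lambda>(t, r2, a, r3, b, r4). f (t, a, r2, r3, r4, b)) y \<partial>lborel) = (\<integral>\<^sup>+r4. \<integral>\<^sup>+t. \<integral>\<^sup>+r3. \<integral>\<^sup>+b. \<integral>\<^sup>+r2. \<integral>\<^sup>+a. f (t, a, r2, r3, r4, b)
      \<partial>lborel \<partial>lborel \<partial>lborel \<partial>lborel \<partial>lborel \<partial>lborel)"
    by (subst nn_integral_reorder_space) simp_all
  show ?thesis
    by (simp only: s1 s2 s3, simp only: s4, simp only: s5 s6 s7 trans[OF s8 s9])
qed

text \<open>Three vectors given by their lengths, by the common rotation \<open>t\<close>, which is the direction of the
  third vector, and by the angles of the first two relative to the third.\<close>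

definition relative_frame :: "real \<times> real \<times> real \<times> real \<times> real \<times> real \<Rightarrow> (real^2) \<times> (real^2) \<times> (real^2)" where
  "relative_frame = (\<lambda>(t, r2, t2, r3, t3, r4). (polar r2 (t + t2), polar r3 (t + t3), polar r4 t))"

definition space_weight :: "real \<times> real \<times> real \<times> real \<times> real \<times> real \<Rightarrow> real" where
  "space_weight = (\<lambda>(t, x). indicator {0..<2 * pi} t * (indicator space_range x *
     (case x of (r2, t2, r3, t3, r4) \<Rightarrow> r2 * r3 * r4)))"

lemma nn_integral_relative_frame:
  fixes H :: "(real^2) \<times> (real^2) \<times> (real^2) \<Rightarrow> ennreal"
  assumes [measurable]: "H \<in> borel_measurable borel"
  shows "(\<integral>\<^sup>+w. H w \<partial>lborel) = (\<integral>\<^sup>+y. ennreal (space_weight y) * H (relative_frame y) \<partial>lborel)"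
proof -
  define G where "G = (\<lambda>(t, r2, t2, r3, t3, r4). polar_weight r4 * (turn t * (polar_weight r3 * (turn t3 *
     (polar_weight r2 * (turn t2 * H (polar r2 (t + t2), polar r3 (t + t3), polar r4 t)))))))"
  have [measurable]: "G \<in> borel_measurable borel"
    unfolding G_def by measurable
  have s1: "(\<integral>\<^sup>+w. H w \<partial>lborel) = (\<integral>\<^sup>+r4. polar_weight r4 * (\<integral>\<^sup>+t4. turn t4 *
       (\<integral>\<^sup>+r3. polar_weight r3 * (\<integral>\<^sup>+t3. turn t3 *
        (\<integral>\<^sup>+r2. polar_weight r2 * (\<integral>\<^sup>+t2. turn t2 *
           H (polar r2 t2, polar r3 t3, polar r4 t4) \<partial>lborel) \<partial>lborel) \<partial>lborel) \<partial>lborel) \<partial>lborel) \<partial>lborel)"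
    by (rule nn_integral_three_polar) measurable
  have s2: "\<And>r2 r3 t3 r4 t4. (\<integral>\<^sup>+t2. turn t2 * H (polar r2 t2, polar r3 t3, polar r4 t4) \<partial>lborel)
      = (\<integral>\<^sup>+t2. turn t2 * H (polar r2 (t4 + t2), polar r3 t3, polar r4 t4) \<partial>lborel)"
    by (rule nn_integral_turn_shift[symmetric]) (simp_all add: polar_periodic)
  have s3: "\<And>r3 r4 t4. (\<integral>\<^sup>+t3. turn t3 *
        (\<integral>\<^sup>+r2. polar_weight r2 * (\<integral>\<^sup>+t2. turn t2 * H (polar r2 (t4 + t2), polar r3 t3, polar r4 t4) \<partial>lborel) \<partial>lborel) \<partial>lborel)
      = (\<integral>\<^sup>+t3. turn t3 *
        (\<integral>\<^sup>+r2. polar_weight r2 * (\<integral>\<^sup>+t2. turn t2 * H (polar r2 (t4 + t2), polar r3 (t4 + t3), polar r4 t4) \<partial>lborel) \<partial>lborel) \<partial>lborel)"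
    by (rule nn_integral_turn_shift[symmetric]) (simp_all add: polar_periodic)
  have s4: "(\<integral>\<^sup>+r4. polar_weight r4 * (\<integral>\<^sup>+t4. turn t4 *
       (\<integral>\<^sup>+r3. polar_weight r3 * (\<integral>\<^sup>+t3. turn t3 *
        (\<integral>\<^sup>+r2. polar_weight r2 * (\<integral>\<^sup>+t2. turn t2 *
           H (polar r2 (t4 + t2), polar r3 (t4 + t3), polar r4 t4) \<partial>lborel) \<partial>lborel) \<partial>lborel) \<partial>lborel) \<partial>lborel) \<partial>lborel)
      = (\<integral>\<^sup>+y. G y \<partial>lborel)"
    by (subst nn_integral_reorder_space) (simp_all add: G_def nn_integral_cmult)
  have s5: "(\<integral>\<^sup>+y. G y \<partial>lborel) = (\<integral>\<^sup>+y. ennreal (space_weight y) * H (relative_frame y) \<partial>lborel)"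
    by (intro nn_integral_cong)
       (auto simp: G_def space_weight_def relative_frame_def space_range_def polar_weight_def indicator_def
          ennreal_mult'' mult_ac)
  show ?thesis
    by (simp only: s1 s2 s3 trans[OF s4 s5])
qed


text \<open>The sides \<open>\<omega>\<^sub>2, \<omega>\<^sub>3, \<omega>\<^sub>4\<close> of a quadrilateral with prescribed invariants, where \<open>t\<close> is the direction of \<open>\<omega>\<^sub>4\<close>
  and \<open>A\<close> computes the angle between \<open>\<omega>\<^sub>4\<close> and the diagonal \<open>\<omega>\<^sub>3 + \<omega>\<^sub>4\<close>. The sign \<open>e\<close> says on which side
  of \<open>\<omega>\<^sub>4\<close> the triangle with \<open>\<omega>\<^sub>3\<close> lies, and \<open>e'\<close> on which side of the diagonal \<open>\<omega>\<^sub>2\<close> lies.\<close>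

definition quad_frame :: "(real \<times> real \<times> real \<Rightarrow> real) \<Rightarrow> real \<Rightarrow> real
    \<Rightarrow> real \<times> real \<times> real \<times> real \<times> real \<times> real \<Rightarrow> (real^2) \<times> (real^2) \<times> (real^2)" where
  "quad_frame A e e' = (\<lambda>(t, a, r2, r3, r4, b).
     (polar r2 (t + pi - e * A (r3, r4, b) + e' * a), polar r3 (t + pi + e * b), polar r4 t))"

definition invariant_weight :: "real \<times> real \<times> real \<times> real \<times> real \<times> real \<Rightarrow> real" where
  "invariant_weight = (\<lambda>(t, q). indicator {0..<2 * pi} t * (indicator invariant_range q *
     (case q of (a, r2, r3, r4, b) \<Rightarrow> r2 * r3 * r4)))"

text \<open>The angle of \<open>\<omega>\<^sub>3\<close> is measured on both sides of the direction opposite to \<open>\<omega>\<^sub>4\<close>, and then that of \<open>\<omega>\<^sub>2\<close> on both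
  sides of the direction opposite to the diagonal. As the second reference direction is constant in the
  innermost integral, the formula holds for an arbitrary measurable \<open>A\<close>.\<close>

lemma nn_integral_quad_frame:
  fixes H :: "(real^2) \<times> (real^2) \<times> (real^2) \<Rightarrow> ennreal"
  assumes [measurable]: "H \<in> borel_measurable borel" and [measurable]: "A \<in> borel_measurable borel"
  shows "(\<integral>\<^sup>+w. H w \<partial>lborel)
    = (\<Sum>e\<in>{1, - 1}. \<Sum>e'\<in>{1, - 1}. \<integral>\<^sup>+y. ennreal (invariant_weight y) * H (quad_frame A e e' y) \<partial>lborel)"
proof -
  let ?I = "indicator {0<..<pi} :: real \<Rightarrow> ennreal"
  define G where "G = (\<lambda>e e' (t, a, r2, r3, r4, b). polar_weight r4 * (turn t * (polar_weight r3 * (?I b *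
     (polar_weight r2 * (?I a * H (polar r2 (t + pi - e * A (r3, r4, b) + e' * a), polar r3 (t + pi + e * b), polar r4 t)))))))"
  have [measurable]: "G e e' \<in> borel_measurable borel" for e e'
    unfolding G_def by measurable
  have s1: "(\<integral>\<^sup>+w. H w \<partial>lborel) = (\<integral>\<^sup>+r4. polar_weight r4 * (\<integral>\<^sup>+t4. turn t4 *
       (\<integral>\<^sup>+r3. polar_weight r3 * (\<integral>\<^sup>+t3. turn t3 *
        (\<integral>\<^sup>+r2. polar_weight r2 * (\<integral>\<^sup>+t2. turn t2 *
           H (polar r2 t2, polar r3 t3, polar r4 t4) \<partial>lborel) \<partial>lborel) \<partial>lborel) \<partial>lborel) \<partial>lborel) \<partial>lborel)"
    by (rule nn_integral_three_polar) measurable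
  have s2: "(\<integral>\<^sup>+t3. turn t3 *
        (\<integral>\<^sup>+r2. polar_weight r2 * (\<integral>\<^sup>+t2. turn t2 * H (polar r2 t2, polar r3 t3, polar r4 t4) \<partial>lborel) \<partial>lborel) \<partial>lborel)
      = (\<Sum>e\<in>{1, - 1}. \<integral>\<^sup>+b. ?I b *
        (\<integral>\<^sup>+r2. polar_weight r2 * (\<integral>\<^sup>+t2. turn t2 * H (polar r2 t2, polar r3 (t4 + pi + e * b), polar r4 t4) \<partial>lborel) \<partial>lborel) \<partial>lborel)"
    for r3 r4 t4
    by (rule nn_integral_turn_reflect) (simp_all add: polar_periodic)
  have s3: "(\<integral>\<^sup>+t2. turn t2 * H (polar r2 t2, polar r3 (t4 + pi + e * b), polar r4 t4) \<partial>lborel)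
      = (\<Sum>e'\<in>{1, - 1}. \<integral>\<^sup>+a. ?I a *
          H (polar r2 (t4 + pi - e * A (r3, r4, b) + e' * a), polar r3 (t4 + pi + e * b), polar r4 t4) \<partial>lborel)"
    for r2 r3 r4 t4 e b
    by (rule nn_integral_turn_reflect) (simp_all add: polar_periodic)
  have s4: "(\<integral>\<^sup>+y. G e e' y \<partial>lborel) = (\<integral>\<^sup>+y. ennreal (invariant_weight y) * H (quad_frame A e e' y) \<partial>lborel)" for e e'
    by (intro nn_integral_cong)
       (auto simp: G_def invariant_weight_def quad_frame_def invariant_range_def polar_weight_def indicator_def
          ennreal_mult'' mult_ac)
  have s5: "(\<integral>\<^sup>+y. G e e' y \<partial>lborel) = (\<integral>\<^sup>+r4. polar_weight r4 * (\<integral>\<^sup>+t. turn t *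
      (\<integral>\<^sup>+r3. polar_weight r3 * (\<integral>\<^sup>+b. ?I b * (\<integral>\<^sup>+r2. polar_weight r2 * (\<integral>\<^sup>+a. ?I a *
        H (polar r2 (t + pi - e * A (r3, r4, b) + e' * a), polar r3 (t + pi + e * b), polar r4 t)
       \<partial>lborel) \<partial>lborel) \<partial>lborel) \<partial>lborel) \<partial>lborel) \<partial>lborel)" for e e'
    by (subst nn_integral_reorder_invariants) (simp_all add: G_def nn_integral_cmult)
  have "(\<integral>\<^sup>+w. H w \<partial>lborel) = (\<Sum>e\<in>{1, - 1}. \<Sum>e'\<in>{1, - 1}. \<integral>\<^sup>+y. G e e' y \<partial>lborel)"
    unfolding s1 s2 s3 s5
    by (simp add: nn_integral_add distrib_left add_ac)
  then show ?thesis by (simp only: s4)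
qed

section \<open>Lebesgue integrals in frame coordinates\<close>

lemma integrable_sum_of_measures:
  fixes f :: "'a \<Rightarrow> 'b::{banach,second_countable_topology}"
  assumes I: "finite I" and sets: "\<And>i. i \<in> I \<Longrightarrow> sets (N i) = sets M"
    and nn: "\<And>h. h \<in> borel_measurable M \<Longrightarrow> (\<integral>\<^sup>+x. h x \<partial>M) = (\<Sum>i\<in>I. \<integral>\<^sup>+x. h x \<partial>N i)"
    and f: "integrable M f" and i: "i \<in> I"
  shows "integrable (N i) f"
proof (rule integrableI_bounded)
  have [measurable]: "f \<in> borel_measurable M" using f by auto
  show "f \<in> borel_measurable (N i)"
    by (simp cong: measurable_cong_sets add: sets[OF i])
  have "(\<integral>\<^sup>+x. norm (f x) \<partial>N i) \<le> (\<Sum>i\<in>I. \<integral>\<^sup>+x. norm (f x) \<partial>N i)"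
    using I i by (intro member_le_sum) auto
  also have "\<dots> = (\<integral>\<^sup>+x. norm (f x) \<partial>M)"
    by (rule nn[symmetric]) measurable
  also have "\<dots> < \<infinity>"
    using f by (simp add: integrable_iff_bounded)
  finally show "(\<integral>\<^sup>+x. norm (f x) \<partial>N i) < \<infinity>" .
qed

text \<open>Passage from nonnegative to complex integrands when a measure is a finite sum of measures, as it is
  for the four images under \<open>quad_frame\<close>.\<close>

lemma integral_sum_of_measures:
  fixes f :: "'a \<Rightarrow> complex"
  assumes I: "finite I" and sets: "\<And>i. i \<in> I \<Longrightarrow> sets (N i) = sets M"
    and nn: "\<And>h. h \<in> borel_measurable M \<Longrightarrow> (\<integral>\<^sup>+x. h x \<partial>M) = (\<Sum>i\<in>I. \<integral>\<^sup>+x. h x \<partial>N i)"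
    and f: "integrable M f"
  shows "(LINT x|M. f x) = (\<Sum>i\<in>I. LINT x|N i. f x)"
proof -
  note int = integrable_sum_of_measures[OF I sets nn]
  \<comment> \<open>Nonnegative real integrands, then differences of these, then real and imaginary parts.\<close>
  have pos: "(LINT x|M. g x) = (\<Sum>i\<in>I. LINT x|N i. g x)"
    if g: "integrable M g" and p: "\<And>x. g x \<ge> 0" for g :: "'a \<Rightarrow> real"
  proof -
    have "ennreal (LINT x|M. g x) = (\<integral>\<^sup>+x. ennreal (g x) \<partial>M)"
      by (intro nn_integral_eq_integral[symmetric] g) (use p in auto)
    also have "\<dots> = (\<Sum>i\<in>I. \<integral>\<^sup>+x. ennreal (g x) \<partial>N i)"
      by (intro nn) (use g in auto)
    also have "\<dots> = (\<Sum>i\<in>I. ennreal (LINT x|N i. g x))"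
      by (intro sum.cong refl nn_integral_eq_integral int g) (use p in auto)
    also have "\<dots> = ennreal (\<Sum>i\<in>I. LINT x|N i. g x)"
      by (intro sum_ennreal integral_nonneg_AE) (use p in auto)
    finally show ?thesis
      using p by (subst (asm) ennreal_inj) (auto intro!: integral_nonneg_AE sum_nonneg)
  qed
  have re: "(LINT x|M. g x) = (\<Sum>i\<in>I. LINT x|N i. g x)" if g: "integrable M g" for g :: "'a \<Rightarrow> real"
  proof -
    have m: "integrable M (\<lambda>x. max (g x) 0)" "integrable M (\<lambda>x. max (- g x) 0)"
      using g by auto
    have "g = (\<lambda>x. max (g x) 0 - max (- g x) 0)" by auto
    then have "(LINT x|M. g x) = (LINT x|M. max (g x) 0) - (LINT x|M. max (- g x) 0)"
      using Bochner_Integration.integral_diff[OF m] by metis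
    also have "\<dots> = (\<Sum>i\<in>I. (LINT x|N i. max (g x) 0) - (LINT x|N i. max (- g x) 0))"
      by (simp add: pos[OF m(1)] pos[OF m(2)] sum_subtractf)
    also have "\<dots> = (\<Sum>i\<in>I. (LINT x|N i. max (g x) 0 - max (- g x) 0))"
      by (intro sum.cong refl Bochner_Integration.integral_diff[symmetric] int m)
    also have "(\<lambda>x. max (g x) 0 - max (- g x) 0) = g" by auto
    finally show ?thesis .
  qed
  show "(LINT x|M. f x) = (\<Sum>i\<in>I. LINT x|N i. f x)"
  proof (rule complex_eqI)
    have ifI: "integrable (N i) f" if "i \<in> I" for i
      by (rule int) (use f that in auto)
    show "Re (LINT x|M. f x) = Re (\<Sum>i\<in>I. LINT x|N i. f x)"
      using re[of "\<lambda>x. Re (f x)"] f ifI by (simp add: integrable_Re)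
    show "Im (LINT x|M. f x) = Im (\<Sum>i\<in>I. LINT x|N i. f x)"
      using re[of "\<lambda>x. Im (f x)"] f ifI by (simp add: integrable_Im)
  qed
qed

lemma space_range_measurable [measurable]: "space_range \<in> sets borel"
  unfolding space_range_def by (intro borel_Times) auto

lemma invariant_range_measurable [measurable]: "invariant_range \<in> sets borel"
  unfolding invariant_range_def by (intro borel_Times) auto

lemma space_weight_measurable [measurable]: "space_weight \<in> borel_measurable borel"
  unfolding space_weight_def by measurable

lemma invariant_weight_measurable [measurable]: "invariant_weight \<in> borel_measurable borel"
  unfolding invariant_weight_def by measurable

lemma relative_frame_measurable [measurable]: "relative_frame \<in> borel_measurable borel"
  unfolding relative_frame_def by measurable

lemma quad_frame_measurable [measurable (raw)]:
  assumes [measurable]: "A \<in> borel_measurable borel"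
  shows "quad_frame A e e' \<in> borel_measurable borel"
  unfolding quad_frame_def by measurable

lemma space_weight_nonneg: "space_weight y \<ge> 0"
  by (auto simp: space_weight_def space_range_def indicator_def split: prod.splits)

lemma invariant_weight_nonneg: "invariant_weight y \<ge> 0"
  by (auto simp: invariant_weight_def invariant_range_def indicator_def split: prod.splits)

lemma integral_relative_frame:
  fixes H :: "(real^2) \<times> (real^2) \<times> (real^2) \<Rightarrow> complex"
  assumes H: "integrable lborel H"
  shows "integrable lborel (\<lambda>y. space_weight y *\<^sub>R H (relative_frame y))"
    and "(LINT w|lborel. H w) = (LINT y|lborel. space_weight y *\<^sub>R H (relative_frame y))"
proof -
  have [measurable]: "H \<in> borel_measurable borel"
    using H by (simp add: borel_measurable_integrable flip: measurable_lborel1)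
  let ?N = "distr (density lborel (\<lambda>y. ennreal (space_weight y))) borel relative_frame"
  have nn: "(\<integral>\<^sup>+w. h w \<partial>lborel) = (\<Sum>i\<in>{()}. \<integral>\<^sup>+w. h w \<partial>?N)"
    if "h \<in> borel_measurable lborel" for h
    using that nn_integral_relative_frame[of h] by (simp add: nn_integral_distr nn_integral_density)
  note * = integrable_sum_of_measures[where I="{()}" and N="\<lambda>_. ?N", OF _ _ nn H]
    integral_sum_of_measures[where I="{()}" and N="\<lambda>_. ?N", OF _ _ nn H]
  show "integrable lborel (\<lambda>y. space_weight y *\<^sub>R H (relative_frame y))"
    using *(1) by (simp add: integrable_distr_eq integrable_density space_weight_nonneg)
  show "(LINT w|lborel. H w) = (LINT y|lborel. space_weight y *\<^sub>R H (relative_frame y))"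
    using *(2) by (simp add: integral_distr integral_density space_weight_nonneg)
qed

definition signs :: "(real \<times> real) set" where
  "signs = {1, - 1} \<times> {1, - 1}"

lemma sum_signs: "(\<Sum>\<sigma>\<in>signs. f (fst \<sigma>) (snd \<sigma>)) = (\<Sum>e\<in>{1, - 1}. \<Sum>e'\<in>{1, - 1}. f e e')"
  unfolding signs_def by (simp add: sum.cartesian_product[of "\<lambda>e e'. f e e'", symmetric] split_beta' add_ac)

lemma integral_quad_frame:
  fixes H :: "(real^2) \<times> (real^2) \<times> (real^2) \<Rightarrow> complex"
  assumes H: "integrable lborel H" and A [measurable]: "A \<in> borel_measurable borel"
  shows "\<And>\<sigma>. \<sigma> \<in> signs \<Longrightarrow> integrable lborel (\<lambda>y. invariant_weight y *\<^sub>R H (quad_frame A (fst \<sigma>) (snd \<sigma>) y))"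
    and "(LINT w|lborel. H w) = (\<Sum>\<sigma>\<in>signs. LINT y|lborel. invariant_weight y *\<^sub>R H (quad_frame A (fst \<sigma>) (snd \<sigma>) y))"
proof -
  have [measurable]: "H \<in> borel_measurable borel"
    using H by (simp add: borel_measurable_integrable flip: measurable_lborel1)
  let ?N = "\<lambda>\<sigma>. distr (density lborel (\<lambda>y. ennreal (invariant_weight y))) borel (quad_frame A (fst \<sigma>) (snd \<sigma>))"
  have nn: "(\<integral>\<^sup>+w. h w \<partial>lborel) = (\<Sum>\<sigma>\<in>signs. \<integral>\<^sup>+w. h w \<partial>?N \<sigma>)"
    if "h \<in> borel_measurable lborel" for h
    using that nn_integral_quad_frame[of h A]
    by (simp add: nn_integral_distr nn_integral_density signs_def sum.cartesian_product[symmetric])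
  have fin: "finite signs" by (simp add: signs_def)
  note * = integrable_sum_of_measures[where I=signs and N="?N", OF fin _ nn H]
    integral_sum_of_measures[where I=signs and N="?N", OF fin _ nn H]
  show "integrable lborel (\<lambda>y. invariant_weight y *\<^sub>R H (quad_frame A (fst \<sigma>) (snd \<sigma>) y))" if "\<sigma> \<in> signs" for \<sigma>
    using *(1)[OF _ _ that] by (simp add: integrable_distr_eq integrable_density invariant_weight_nonneg)
  show "(LINT w|lborel. H w) = (\<Sum>\<sigma>\<in>signs. LINT y|lborel. invariant_weight y *\<^sub>R H (quad_frame A (fst \<sigma>) (snd \<sigma>) y))"
    using *(2) by (simp add: integral_distr integral_density invariant_weight_nonneg)
qed

text \<open>A null set of triples of frequencies has a null set of frame coordinates.\<close>

lemma AE_quad_frame: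
  assumes P: "AE w in lborel. P w" and A [measurable]: "A \<in> borel_measurable borel"
    and \<sigma>: "\<sigma> \<in> signs"
  shows "AE y in lborel. invariant_weight y > 0 \<longrightarrow> P (quad_frame A (fst \<sigma>) (snd \<sigma>) y)"
proof -
  obtain N where N: "{w. \<not> P w} \<subseteq> N" "emeasure lborel N = 0" "N \<in> sets borel"
    using P by (auto elim: AE_E)
  then have [measurable]: "N \<in> sets borel" by simp
  let ?f = "\<lambda>\<sigma> y. ennreal (invariant_weight y) * indicator N (quad_frame A (fst \<sigma>) (snd \<sigma>) y)"
  have "(\<Sum>\<sigma>\<in>signs. \<integral>\<^sup>+y. ?f \<sigma> y \<partial>lborel) = (\<integral>\<^sup>+w. indicator N w \<partial>lborel)"
    using nn_integral_quad_frame[of "indicator N" A]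
    by (simp add: signs_def sum.cartesian_product[symmetric])
  also have "\<dots> = 0" using N by simp
  finally have "(\<integral>\<^sup>+y. ?f \<sigma> y \<partial>lborel) = 0"
    using \<sigma> by (subst (asm) sum_eq_0_iff) (auto simp: signs_def)
  then have "AE y in lborel. ?f \<sigma> y = 0"
    by (subst (asm) nn_integral_0_iff_AE) auto
  then show ?thesis
    by eventually_elim (use N(1) in \<open>auto simp: indicator_def split: if_splits\<close>)
qed

section \<open>The geometry of the quadrilateral\<close>

text \<open>Outside \<open>[-1, 1]\<close> the definite description in the definition of \<open>arccos\<close> has no witness, so that \<open>arccos\<close> is
  constant there.\<close>

lemma arccos_borel_measurable [measurable]: "arccos \<in> borel_measurable borel"
proof -
  have out: "arccos y = arccos 2" if "y \<notin> {- 1..1}" for y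
  proof -
    have "(\<lambda>x. 0 \<le> x \<and> x \<le> pi \<and> cos x = y) = (\<lambda>x. 0 \<le> x \<and> x \<le> pi \<and> cos x = 2)"
    proof
      fix x
      have "cos x \<noteq> y" using that cos_ge_minus_one[of x] cos_le_one[of x] by auto
      moreover have "cos x \<noteq> 2" using cos_le_one[of x] by linarith
      ultimately show "(0 \<le> x \<and> x \<le> pi \<and> cos x = y) = (0 \<le> x \<and> x \<le> pi \<and> cos x = 2)" by simp
    qed
    then show ?thesis by (simp add: arccos_def)
  qed
  have "(\<lambda>y. if y \<in> {- 1..1} then arccos y else arccos 2) \<in> borel_measurable borel"
    by (intro borel_measurable_continuous_on_if continuous_on_arccos') auto
  moreover have "(\<lambda>y. if y \<in> {- 1..1} then arccos y else arccos 2) = arccos"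
  proof
    fix y
    show "(if y \<in> {- 1..1} then arccos y else arccos 2) = arccos y"
      by (cases "y \<in> {- 1..1}") (simp_all only: if_True if_False out[of y] not_False_eq_True)
  qed
  ultimately show ?thesis by simp
qed

definition diagonal :: "real \<Rightarrow> real \<Rightarrow> real \<Rightarrow> real" where
  "diagonal r3 r4 b = sqrt (r3\<^sup>2 + r4\<^sup>2 - 2 * r3 * r4 * cos b)"

definition alpha3 :: "real \<times> real \<times> real \<Rightarrow> real" where
  "alpha3 = (\<lambda>(r3, r4, b). opposite_angle r3 (diagonal r3 r4 b) r4)"

lemma alpha3_measurable [measurable]: "alpha3 \<in> borel_measurable borel"
  unfolding alpha3_def opposite_angle_def diagonal_def by measurable

lemma diagonal_sq: "(diagonal r3 r4 b)\<^sup>2 = (r4 - r3 * cos b)\<^sup>2 + (r3 * sin b)\<^sup>2"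
  and diagonal_sq': "(diagonal r3 r4 b)\<^sup>2 = r3\<^sup>2 + r4\<^sup>2 - 2 * r3 * r4 * cos b"
  and diagonal_nonneg: "diagonal r3 r4 b \<ge> 0"
proof -
  have eq: "r3\<^sup>2 + r4\<^sup>2 - 2 * r3 * r4 * cos b = (r4 - r3 * cos b)\<^sup>2 + (r3 * sin b)\<^sup>2"
    using sin_cos_squared_add[of b] by algebra
  have nn: "r3\<^sup>2 + r4\<^sup>2 - 2 * r3 * r4 * cos b \<ge> 0"
    unfolding eq by (rule sum_power2_ge_zero)
  show 1: "(diagonal r3 r4 b)\<^sup>2 = r3\<^sup>2 + r4\<^sup>2 - 2 * r3 * r4 * cos b"
    unfolding diagonal_def using nn by (rule real_sqrt_pow2)
  show "(diagonal r3 r4 b)\<^sup>2 = (r4 - r3 * cos b)\<^sup>2 + (r3 * sin b)\<^sup>2"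
    unfolding 1 eq ..
  show "diagonal r3 r4 b \<ge> 0"
    unfolding diagonal_def using nn by (rule real_sqrt_ge_zero)
qed

lemma diagonal_pos:
  assumes "r3 > 0" "b \<in> {0<..<pi}"
  shows "diagonal r3 r4 b > 0"
proof -
  have "(r3 * sin b)\<^sup>2 > 0"
    using assms sin_gt_zero[of b] by simp
  then have "(diagonal r3 r4 b)\<^sup>2 > 0"
    unfolding diagonal_sq by (rule add_nonneg_pos[OF zero_le_power2])
  then show ?thesis
    using diagonal_nonneg[of r3 r4 b] by (cases "diagonal r3 r4 b = 0") auto
qed

text \<open>The projections of the side \<open>\<rho>\<^sub>3\<close> onto the side \<open>\<rho>\<^sub>4\<close> and onto its normal, expressed through the diagonal.\<close>

lemma alpha3_cos_sin:
  assumes r: "r3 > 0" "r4 > 0" and b: "b \<in> {0<..<pi}"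
  shows "diagonal r3 r4 b * cos (alpha3 (r3, r4, b)) = r4 - r3 * cos b"
    and "diagonal r3 r4 b * sin (alpha3 (r3, r4, b)) = r3 * sin b"
proof -
  let ?k = "diagonal r3 r4 b" and ?al = "alpha3 (r3, r4, b)"
  have k: "?k > 0" using diagonal_pos[OF r(1) b] .
  have "?k\<^sup>2 + r4\<^sup>2 - r3\<^sup>2 = 2 * ?k * r4 * ((r4 - r3 * cos b) / ?k)"
  proof -
    have "2 * ?k * r4 * ((r4 - r3 * cos b) / ?k) = 2 * r4 * (r4 - r3 * cos b)"
      using k by simp
    then show ?thesis
      unfolding diagonal_sq' by (simp add: power2_eq_square algebra_simps)
  qed
  then have al: "?al = arccos ((r4 - r3 * cos b) / ?k)"
    using k r by (simp add: alpha3_def opposite_angle_def)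
  have "(r4 - r3 * cos b)\<^sup>2 \<le> ?k\<^sup>2"
    by (simp add: diagonal_sq)
  then have "\<bar>r4 - r3 * cos b\<bar> \<le> ?k"
    using k by (simp add: abs_le_square_iff[symmetric])
  then have le: "\<bar>(r4 - r3 * cos b) / ?k\<bar> \<le> 1"
    using k by simp
  then have c: "cos ?al = (r4 - r3 * cos b) / ?k"
    by (simp add: al cos_arccos_abs)
  then show 1: "?k * cos ?al = r4 - r3 * cos b"
    using k by simp
  have "sin ?al \<ge> 0"
  proof (rule sin_ge_zero)
    have "- 1 \<le> (r4 - r3 * cos b) / ?k" "(r4 - r3 * cos b) / ?k \<le> 1"
      using le by linarith+
    then show "0 \<le> ?al" "?al \<le> pi"
      unfolding al by (rule arccos_lbound, rule arccos_ubound)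
  qed
  moreover have "(?k * sin ?al)\<^sup>2 = (r3 * sin b)\<^sup>2"
  proof -
    have "(?k * sin ?al)\<^sup>2 = ?k\<^sup>2 - (?k * cos ?al)\<^sup>2"
      using sin_cos_squared_add[of ?al] by algebra
    then show ?thesis by (simp only: 1 diagonal_sq add_diff_cancel_left')
  qed
  moreover have "r3 * sin b \<ge> 0" using r b sin_gt_zero[of b] by simp
  ultimately show "?k * sin ?al = r3 * sin b"
    using k by (simp add: power2_eq_iff_nonneg)
qed

lemma norm_polar: "norm (polar r t) = \<bar>r\<bar>"
proof -
  have "(norm (polar r t))\<^sup>2 = (r * cos t) * (r * cos t) + (r * sin t) * (r * sin t)"
    by (simp only: power2_norm_eq_inner inner_vec_def sum_2 polar_nth inner_real_def)
  also have "\<dots> = r\<^sup>2"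
    using sin_cos_squared_add[of t] by algebra
  finally have "(norm (polar r t))\<^sup>2 = \<bar>r\<bar>\<^sup>2" by simp
  then show ?thesis by (simp only: power2_eq_iff_nonneg norm_ge_zero abs_ge_zero)
qed

lemma inner_polar: "polar r t \<bullet> polar r' t' = r * r' * cos (t - t')"
  by (simp add: inner_vec_def sum_2 cos_diff algebra_simps)

lemma polar_add_pi: "polar r (t + pi) = - polar r t"
  by (simp add: polar_def vec_eq_iff forall_2)

lemma quad_frame_add_pi: "quad_frame A e e' (t + pi, q) = - quad_frame A e e' (t, q)"
proof -
  obtain a r2 r3 r4 b where q: "q = (a, r2, r3, r4, b)" by (cases q) auto
  have 1: "t + pi + pi - x + y = (t + pi - x + y) + pi" "t + pi + pi + x = (t + pi + x) + pi" for x y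
    by simp_all
  show ?thesis
    unfolding q quad_frame_def prod.case 1 polar_add_pi by simp
qed

text \<open>The diagonal has direction \<open>t - e \<alpha>\<^sub>3\<close>, which is why \<open>quad_frame\<close> subtracts \<open>e A\<close>.\<close>

lemma polar_diagonal:
  assumes "r3 > 0" "r4 > 0" "b \<in> {0<..<pi}" and e: "e \<in> {1, - 1}"
  shows "polar r3 (t + pi + e * b) + polar r4 t = polar (diagonal r3 r4 b) (t - e * alpha3 (r3, r4, b))"
proof -
  let ?k = "diagonal r3 r4 b" and ?al = "alpha3 (r3, r4, b)"
  have ce: "cos (e * x) = cos x" "sin (e * x) = e * sin x" for x
    using e by auto
  have "?k * cos (t - e * ?al) = cos t * (?k * cos ?al) + e * sin t * (?k * sin ?al)"
    "?k * sin (t - e * ?al) = sin t * (?k * cos ?al) - e * cos t * (?k * sin ?al)"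
    by (simp_all only: cos_diff sin_diff ce) (simp_all only: distrib_left right_diff_distrib mult_ac)
  then have "?k * cos (t - e * ?al) = cos t * (r4 - r3 * cos b) + e * sin t * (r3 * sin b)"
    "?k * sin (t - e * ?al) = sin t * (r4 - r3 * cos b) - e * cos t * (r3 * sin b)"
    by (simp_all only: alpha3_cos_sin[OF assms(1-3)])
  note k12 = this
  have c12: "cos (t + pi + e * b) = - (cos t * cos b - e * (sin t * sin b))"
    "sin (t + pi + e * b) = - (sin t * cos b + e * (cos t * sin b))"
    by (simp_all add: cos_add sin_add ce)
  have "(polar r3 (t + pi + e * b) + polar r4 t) $ 1 = polar ?k (t - e * ?al) $ 1"
    by (simp only: vector_add_component polar_nth k12 c12) algebra
  moreover have "(polar r3 (t + pi + e * b) + polar r4 t) $ 2 = polar ?k (t - e * ?al) $ 2"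
    by (simp only: vector_add_component polar_nth k12 c12) algebra
  ultimately show ?thesis
    unfolding vec_eq_iff forall_2 by blast
qed

text \<open>The lengths and the cosines that enter \<open>quad_invariants\<close>, by the law of cosines in the two triangles. The
  cosines are kept separately from the angles because they lie strictly between \<open>- 1\<close> and \<open>1\<close>,
  which is what makes the invariants continuous at these points.\<close>

lemma quad_frame_angle_arguments:
  assumes q: "(a, r2, r3, r4, b) \<in> invariant_range" and \<sigma>: "e \<in> {1, - 1}" "e' \<in> {1, - 1}"
    and w: "quad_frame alpha3 e e' (t, a, r2, r3, r4, b) = (w2, w3, w4)"
  defines "w1 \<equiv> - (w2 + w3 + w4)" and "k \<equiv> diagonal r3 r4 b"
  shows "norm w2 = r2" "norm w3 = r3" "norm w4 = r4" "norm (w1 + w2) = k"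
    "(r2\<^sup>2 + k\<^sup>2 - (norm w1)\<^sup>2) / (2 * r2 * k) = cos a"
    "(r3\<^sup>2 + r4\<^sup>2 - k\<^sup>2) / (2 * r3 * r4) = cos b"
proof -
  have pos: "a \<in> {0<..<pi}" "r2 > 0" "r3 > 0" "r4 > 0" "b \<in> {0<..<pi}"
    using q by (auto simp: invariant_range_def)
  have k: "k > 0" using diagonal_pos pos by (simp add: k_def)
  have w': "w2 = polar r2 (t + pi - e * alpha3 (r3, r4, b) + e' * a)" "w3 = polar r3 (t + pi + e * b)" "w4 = polar r4 t"
    using w by (auto simp: quad_frame_def)
  show "norm w2 = r2" "norm w3 = r3" "norm w4 = r4"
    using pos by (simp_all add: w' norm_polar)
  have w34: "w3 + w4 = polar k (t - e * alpha3 (r3, r4, b))"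
    unfolding w' k_def using pos \<sigma> by (intro polar_diagonal) auto
  have "w1 + w2 = - (w3 + w4)" by (simp add: w1_def)
  then show "norm (w1 + w2) = k"
    using k by (simp only: norm_minus_cancel w34 norm_polar abs_of_pos)
  have "w2 \<bullet> (w3 + w4) = - (r2 * k * cos a)"
  proof -
    have "w2 \<bullet> (w3 + w4) = r2 * k * cos (pi + e' * a)"
      unfolding w34 unfolding w' inner_polar by (simp add: algebra_simps)
    also have "cos (pi + e' * a) = - cos a" using \<sigma>(2) by (auto simp: cos_add)
    finally show ?thesis by simp
  qed
  moreover have "(norm w1)\<^sup>2 = r2\<^sup>2 + k\<^sup>2 + 2 * (w2 \<bullet> (w3 + w4))"
  proof -
    have "w1 = - (w2 + (w3 + w4))" by (simp add: w1_def)
    then have "(norm w1)\<^sup>2 = (norm (w2 + (w3 + w4)))\<^sup>2" by (simp only: norm_minus_cancel)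
    also have "\<dots> = (norm w2)\<^sup>2 + (norm (w3 + w4))\<^sup>2 + 2 * (w2 \<bullet> (w3 + w4))"
      by (simp add: power2_norm_eq_inner inner_add_left inner_add_right inner_commute)
    also have "norm w2 = r2" using pos by (simp add: w' norm_polar)
    also have "norm (w3 + w4) = k" unfolding w34 using k by (simp add: norm_polar)
    finally show ?thesis .
  qed
  ultimately show "(r2\<^sup>2 + k\<^sup>2 - (norm w1)\<^sup>2) / (2 * r2 * k) = cos a"
    using pos k by simp
  have "k\<^sup>2 = r3\<^sup>2 + r4\<^sup>2 - 2 * r3 * r4 * cos b"
    by (simp only: k_def diagonal_sq')
  then show "(r3\<^sup>2 + r4\<^sup>2 - k\<^sup>2) / (2 * r3 * r4) = cos b"
    using pos by simp
qed

lemma quad_invariants_quad_frame: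
  assumes q: "q \<in> invariant_range" and \<sigma>: "\<sigma> \<in> signs"
    and w: "quad_frame alpha3 (fst \<sigma>) (snd \<sigma>) (t, q) = (w2, w3, w4)"
  shows "quad_invariants (- (w2 + w3 + w4)) w2 w3 w4 = q"
proof -
  obtain a r2 r3 r4 b where qq: "q = (a, r2, r3, r4, b)" by (cases q) auto
  have r: "(a, r2, r3, r4, b) \<in> invariant_range" using q unfolding qq .
  have s: "fst \<sigma> \<in> {1, - 1}" "snd \<sigma> \<in> {1, - 1}" using \<sigma> by (auto simp: signs_def)
  note n = quad_frame_angle_arguments[OF r s w[unfolded qq]]
  have "a \<in> {0<..<pi}" "b \<in> {0<..<pi}"
    using r by (auto simp: invariant_range_def)
  then have "arccos (cos a) = a" "arccos (cos b) = b"
    by (auto intro!: arccos_cos)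
  then show ?thesis
    unfolding quad_invariants_def Let_def opposite_angle_def n(4) n(1) n(2) n(3) n(5) n(6) qq
    by (simp only:)
qed

section \<open>The kernel as a mean of plane waves\<close>

lemma has_sum_finite_sum:
  fixes f :: "'i \<Rightarrow> 'a \<Rightarrow> 'b::topological_comm_monoid_add"
  assumes "finite I" "\<And>i. i \<in> I \<Longrightarrow> (f i has_sum S i) A"
  shows "((\<lambda>x. \<Sum>i\<in>I. f i x) has_sum (\<Sum>i\<in>I. S i)) A"
  using assms by induction (auto intro: has_sum_add)

text \<open>Averaging over the signs turns exponentials into the two cosines of the kernel.\<close>

lemma sum_cis_signs:
  "(\<Sum>\<sigma>\<in>signs. cis (P + fst \<sigma> * U - snd \<sigma> * V)) = 4 * (cis P * complex_of_real (cos V * cos U))"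
proof -
  have c: "cis U + cis (- U) = 2 * complex_of_real (cos U)" for U
    by (simp add: complex_eq_iff)
  have "cis P * complex_of_real (cos V * cos U) * 4
      = cis P * ((2 * complex_of_real (cos U)) * (2 * complex_of_real (cos V)))"
    by simp
  also have "\<dots> = cis P * ((cis U + cis (- U)) * (cis V + cis (- V)))"
    by (simp only: c)
  also have "\<dots> = (\<Sum>\<sigma>\<in>signs. cis P * (cis (fst \<sigma> * U) * cis (- (snd \<sigma> * V))))"
    unfolding sum_signs[of "\<lambda>e e'. cis P * (cis (e * U) * cis (- (e' * V)))"]
    by (simp add: algebra_simps)
  also have "\<dots> = (\<Sum>\<sigma>\<in>signs. cis (P + fst \<sigma> * U - snd \<sigma> * V))"
    by (simp only: cis_mult add.assoc diff_conv_add_uminus)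
  finally show ?thesis by (simp only: mult.commute)
qed

text \<open>The phase of the plane wave as a function of the angle \<open>u\<close> between the frames of the space variables \<open>x\<close>
  and of the frequencies with invariants \<open>q\<close>; the sides \<open>\<omega>\<^sub>2\<close> and \<open>\<omega>\<^sub>3\<close> enter with a minus sign because
  \<open>quad_frame\<close> measures their angles from the opposite direction.\<close>

definition kernel_phase :: "real \<times> real \<Rightarrow> real \<times> real \<times> real \<times> real \<times> real \<Rightarrow> real \<times> real \<times> real \<times> real \<times> real \<Rightarrow> real \<Rightarrow> real" where
  "kernel_phase = (\<lambda>(e, e') (a, \<rho>2, \<rho>3, \<rho>4, b) (r2, \<phi>2, r3, \<phi>3, r4) u.
     \<rho>4 * r4 * cos u - \<rho>2 * r2 * cos (u + (\<phi>2 + e * alpha3 (\<rho>3, \<rho>4, b) - e' * a)) - \<rho>3 * r3 * cos (u + (\<phi>3 - e * b)))"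

lemma inner_frames:
  assumes "\<sigma> \<in> signs"
  shows "relative_frame (t, x) \<bullet> quad_frame alpha3 (fst \<sigma>) (snd \<sigma>) (\<theta>, q) = kernel_phase \<sigma> q x (t - \<theta>)"
proof -
  obtain a \<rho>2 \<rho>3 \<rho>4 b where q: "q = (a, \<rho>2, \<rho>3, \<rho>4, b)" by (cases q) auto
  obtain r2 \<phi>2 r3 \<phi>3 r4 where x: "x = (r2, \<phi>2, r3, \<phi>3, r4)" by (cases x) auto
  obtain e e' where \<sigma>: "\<sigma> = (e, e')" by (cases \<sigma>)
  have 1: "t + \<phi>2 - (\<theta> + pi - e * A + e' * a) = t - \<theta> + (\<phi>2 + e * A - e' * a) - pi"
    "t + \<phi>3 - (\<theta> + pi + e * b) = t - \<theta> + (\<phi>3 - e * b) - pi" for A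
    by simp_all
  have c: "cos (y - pi) = - cos y" for y :: real by (simp add: cos_diff)
  show ?thesis
    unfolding q x \<sigma> relative_frame_def quad_frame_def kernel_phase_def prod.case inner_Pair inner_polar fst_conv snd_conv 1 c
    by simp
qed

text \<open>The kernel is the mean of the plane waves over the common rotation and the four sign pairs, the total
  mass being \<open>4 * 2 \<pi>\<close>.\<close>

lemma T4_integral:
  assumes q: "q \<in> invariant_range" and x: "x \<in> space_range" and s: "s = 1 \<or> s = - 1"
  shows "(\<Sum>\<sigma>\<in>signs. integral {0..2 * pi} (\<lambda>t. cis (kernel_phase \<sigma> q x (s * t + c))))
    = complex_of_real (8 * pi) * (case x of (r2, \<phi>2, r3, \<phi>3, r4) \<Rightarrow> T4 q (r2, \<phi>2) (r3, \<phi>3) r4)"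
proof -
  obtain a \<rho>2 \<rho>3 \<rho>4 b where qq: "q = (a, \<rho>2, \<rho>3, \<rho>4, b)" by (cases q) auto
  obtain r2 \<phi>2 r3 \<phi>3 r4 where xx: "x = (r2, \<phi>2, r3, \<phi>3, r4)" by (cases x) auto
  have z: "\<rho>2 * r2 \<noteq> 0" "\<rho>3 * r3 \<noteq> 0" "\<rho>4 * r4 \<noteq> 0"
    using q x by (auto simp: qq xx invariant_range_def space_range_def)
  define A where "A = alpha3 (\<rho>3, \<rho>4, b)"
  define I where "I = (\<lambda>\<sigma>. integral {0..2 * pi} (\<lambda>t. cis (kernel_phase \<sigma> q x (s * t + c))))"
  define J where "J = (\<lambda>(l2, l3). complex_of_real (bessel_J l2 (\<rho>2 * r2) * bessel_J l3 (\<rho>3 * r3) * bessel_J (l2 + l3) (\<rho>4 * r4)))"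
  define f where "f = (\<lambda>\<sigma> (l2, l3). J (l2, l3) * cis (of_int l2 * \<phi>2 + of_int l3 * \<phi>3
      + fst \<sigma> * (of_int l2 * A - of_int l3 * b) - snd \<sigma> * (of_int l2 * a)))"
  have hs: "(f \<sigma> has_sum I \<sigma> / complex_of_real (2 * pi)) UNIV" for \<sigma>
  proof -
    obtain e e' where \<sigma>: "\<sigma> = (e, e')" by (cases \<sigma>)
    have "f \<sigma> = (\<lambda>(l2, l3). complex_of_real (bessel_J l2 (\<rho>2 * r2) * bessel_J l3 (\<rho>3 * r3) * bessel_J (l2 + l3) (\<rho>4 * r4))
        * cis (of_int l2 * (\<phi>2 + e * A - e' * a) + of_int l3 * (\<phi>3 - e * b)))"
      by (auto simp: f_def J_def \<sigma> fun_eq_iff algebra_simps)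
    then show ?thesis
      using bessel_triple_integral[OF z s, of "\<phi>2 + e * A - e' * a" "\<phi>3 - e * b" c]
      by (simp add: I_def kernel_phase_def qq xx \<sigma> A_def)
  qed
  have "((\<lambda>l. \<Sum>\<sigma>\<in>signs. f \<sigma> l) has_sum (\<Sum>\<sigma>\<in>signs. I \<sigma> / complex_of_real (2 * pi))) UNIV"
    by (intro has_sum_finite_sum hs) (simp add: signs_def)
  moreover have "(\<Sum>\<sigma>\<in>signs. f \<sigma> l) = (case l of (l2, l3) \<Rightarrow> 4 * (cis (of_int l2 * \<phi>2 + of_int l3 * \<phi>3)
      * (J (l2, l3) * complex_of_real (cos (of_int l2 * a) * cos (of_int l2 * A - of_int l3 * b)))))" for l
  proof -
    obtain l2 l3 where l: "l = (l2, l3)" by (cases l)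
    have "(\<Sum>\<sigma>\<in>signs. f \<sigma> (l2, l3)) = J (l2, l3) * (\<Sum>\<sigma>\<in>signs. cis (of_int l2 * \<phi>2 + of_int l3 * \<phi>3
      + fst \<sigma> * (of_int l2 * A - of_int l3 * b) - snd \<sigma> * (of_int l2 * a)))"
      unfolding f_def by (simp only: prod.case sum_distrib_left)
    then show ?thesis
      by (simp only: sum_cis_signs l prod.case) (simp only: mult_ac)
  qed
  ultimately have "((\<lambda>l. case l of (l2, l3) \<Rightarrow> 4 * (cis (of_int l2 * \<phi>2 + of_int l3 * \<phi>3)
      * (J (l2, l3) * complex_of_real (cos (of_int l2 * a) * cos (of_int l2 * A - of_int l3 * b)))))
      has_sum (\<Sum>\<sigma>\<in>signs. I \<sigma> / complex_of_real (2 * pi))) UNIV"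
    by (simp only:)
  then have "((\<lambda>l. (1 / 4) * (case l of (l2, l3) \<Rightarrow> 4 * (cis (of_int l2 * \<phi>2 + of_int l3 * \<phi>3)
      * (J (l2, l3) * complex_of_real (cos (of_int l2 * a) * cos (of_int l2 * A - of_int l3 * b))))))
      has_sum (1 / 4) * (\<Sum>\<sigma>\<in>signs. I \<sigma> / complex_of_real (2 * pi))) UNIV"
    by (rule has_sum_cmult_right)
  moreover have "(\<lambda>l. (1 / 4) * (case l of (l2, l3) \<Rightarrow> 4 * (cis (of_int l2 * \<phi>2 + of_int l3 * \<phi>3)
      * (J (l2, l3) * complex_of_real (cos (of_int l2 * a) * cos (of_int l2 * A - of_int l3 * b))))))
    = (\<lambda>(l2, l3). cis (of_int l2 * \<phi>2 + of_int l3 * \<phi>3)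
        * complex_of_real (bessel_J l2 (\<rho>2 * r2) * bessel_J l3 (\<rho>3 * r3) * bessel_J (l2 + l3) (\<rho>4 * r4)
          * cos (of_int l2 * a) * cos (of_int l2 * A - of_int l3 * b)))"
    by (auto simp: fun_eq_iff J_def)
  ultimately have "T4 q (r2, \<phi>2) (r3, \<phi>3) r4 = (1 / 4) * (\<Sum>\<sigma>\<in>signs. I \<sigma> / complex_of_real (2 * pi))"
    unfolding T4_def qq prod.case Let_def A_def alpha3_def diagonal_def by (intro infsumI) (simp only:)
  also have "\<dots> = (\<Sum>\<sigma>\<in>signs. I \<sigma>) / complex_of_real (8 * pi)"
    by (simp add: sum_divide_distrib[symmetric])
  finally show ?thesis
    by (simp add: I_def xx)
qed

lemma integral_turn:
  fixes f :: "real \<Rightarrow> complex"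
  assumes "continuous_on UNIV f"
  shows "(LINT t|lborel. indicat_real {0..<2 * pi} t *\<^sub>R f t) = integral {0..2 * pi} f"
proof -
  have c: "continuous_on {0..2 * pi} f" using assms continuous_on_subset by blast
  have [measurable]: "f \<in> borel_measurable borel"
    using assms by (rule borel_measurable_continuous_onI)
  have "(LINT t|lborel. indicat_real {0..<2 * pi} t *\<^sub>R f t) = (LINT t|lborel. indicat_real {0..2 * pi} t *\<^sub>R f t)"
  proof (rule integral_cong_AE)
    show "AE t in lborel. indicat_real {0..<2 * pi} t *\<^sub>R f t = indicat_real {0..2 * pi} t *\<^sub>R f t"
      using AE_lborel_singleton[of "2 * pi"] by eventually_elim (auto simp: indicator_def)
  qed measurable
  also have "\<dots> = (LINT t:{0..2 * pi}|lborel. f t)"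
    by (simp add: set_lebesgue_integral_def)
  also have "\<dots> = integral {0..2 * pi} f"
    by (rule set_borel_integral_eq_integral(2)[OF borel_integrable_atLeastAtMost'[OF c]])
  finally show ?thesis .
qed

lemma kernel_phase_continuous: "continuous_on UNIV (\<lambda>t. cis (kernel_phase \<sigma> q x (s * t + c)))"
  unfolding kernel_phase_def split_beta by (intro continuous_intros)

lemma T4_turn_integral:
  assumes "q \<in> invariant_range" "x \<in> space_range" "s = 1 \<or> s = - 1"
  shows "(\<Sum>\<sigma>\<in>signs. LINT t|lborel. indicat_real {0..<2 * pi} t *\<^sub>R cis (kernel_phase \<sigma> q x (s * t + c)))
    = complex_of_real (8 * pi) * (case x of (r2, \<phi>2, r3, \<phi>3, r4) \<Rightarrow> T4 q (r2, \<phi>2) (r3, \<phi>3) r4)"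
  unfolding integral_turn[OF kernel_phase_continuous] by (rule T4_integral[OF assms])

lemma integrable_cis_mult:
  fixes F :: "'a::euclidean_space \<Rightarrow> complex"
  assumes F: "integrable lborel F"
  shows "integrable lborel (\<lambda>w. cis (x \<bullet> w) * F w)"
proof (rule Bochner_Integration.integrable_bound[OF integrable_norm[OF F]])
  have [measurable]: "F \<in> borel_measurable borel"
    using F by (simp add: borel_measurable_integrable flip: measurable_lborel1)
  show "(\<lambda>w. cis (x \<bullet> w) * F w) \<in> borel_measurable lborel" by measurable
qed (simp add: norm_mult)

text \<open>Fubini with the common rotation integrated first, where \<open>h\<close> collects all that does not depend on it.\<close>

lemma sum_integral_turn_first:
  fixes h :: "'b::euclidean_space \<Rightarrow> complex" and k :: "'i \<Rightarrow> real \<Rightarrow> 'b \<Rightarrow> complex"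
  assumes int: "\<And>\<sigma>. \<sigma> \<in> I \<Longrightarrow> integrable lborel (\<lambda>(t, q). h q * (indicat_real {0..<2 * pi} t *\<^sub>R k \<sigma> t q))"
    and K: "\<And>q. h q \<noteq> 0 \<Longrightarrow> (\<Sum>\<sigma>\<in>I. LINT t|lborel. indicat_real {0..<2 * pi} t *\<^sub>R k \<sigma> t q) = C * K q"
  shows "(\<Sum>\<sigma>\<in>I. LINT y|lborel. (case y of (t, q) \<Rightarrow> h q * (indicat_real {0..<2 * pi} t *\<^sub>R k \<sigma> t q)))
    = C * (LINT q|lborel. h q * K q)"
proof -
  let ?g = "\<lambda>\<sigma> t q. h q * (indicat_real {0..<2 * pi} t *\<^sub>R k \<sigma> t q)"
  have ig: "integrable (lborel \<Otimes>\<^sub>M lborel) (\<lambda>(t, q). ?g \<sigma> t q)" if "\<sigma> \<in> I" for \<sigma>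
    using int[OF that] by (simp only: lborel_prod)
  have "(\<Sum>\<sigma>\<in>I. LINT y|lborel. (case y of (t, q) \<Rightarrow> ?g \<sigma> t q)) = (\<Sum>\<sigma>\<in>I. LINT q|lborel. (LINT t|lborel. ?g \<sigma> t q))"
    by (intro sum.cong refl) (simp only: lborel_pair.integral_snd[OF ig] lborel_prod)
  also have "\<dots> = (LINT q|lborel. (\<Sum>\<sigma>\<in>I. (LINT t|lborel. ?g \<sigma> t q)))"
    by (intro Bochner_Integration.integral_sum[symmetric] lborel_pair.integrable_snd ig)
  also have "\<dots> = (LINT q|lborel. C * (h q * K q))"
  proof (intro Bochner_Integration.integral_cong refl)
    fix q
    have "(\<Sum>\<sigma>\<in>I. (LINT t|lborel. ?g \<sigma> t q)) = h q * (\<Sum>\<sigma>\<in>I. (LINT t|lborel. indicat_real {0..<2 * pi} t *\<^sub>R k \<sigma> t q))"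
      by (simp only: integral_mult_right_zero sum_distrib_left)
    then show "(\<Sum>\<sigma>\<in>I. (LINT t|lborel. ?g \<sigma> t q)) = C * (h q * K q)"
      using K[of q] by (cases "h q = 0") simp_all
  qed
  also have "\<dots> = C * (LINT q|lborel. h q * K q)"
    by (rule integral_mult_right_zero)
  finally show ?thesis .
qed

text \<open>The direct transform: in frame coordinates the density depends on \<open>q\<close> alone, so the common rotation of the
  frequencies acts only on the plane waves and produces the kernel.\<close>

lemma fourier_of_function_of_invariants:
  assumes F: "integrable lborel F"
    and Fs: "\<And>q t \<sigma>. q \<in> invariant_range \<Longrightarrow> \<sigma> \<in> signs \<Longrightarrow> F (quad_frame alpha3 (fst \<sigma>) (snd \<sigma>) (t, q)) = s q"
    and x: "(r2, \<phi>2, r3, \<phi>3, r4) \<in> space_range"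
  shows "(LINT w|lborel. cis (relative_frame (0, r2, \<phi>2, r3, \<phi>3, r4) \<bullet> w) * F w)
    = complex_of_real (8 * pi) * (LINT q:invariant_range|lborel. cumulant_integrand s (r2, \<phi>2) (r3, \<phi>3) r4 q)"
proof -
  let ?x = "(r2, \<phi>2, r3, \<phi>3, r4)"
  define H where "H w = cis (relative_frame (0, ?x) \<bullet> w) * F w" for w
  have H: "integrable lborel H"
    unfolding H_def by (rule integrable_cis_mult[OF F])
  define h where "h = (\<lambda>q. complex_of_real (indicator invariant_range q *
     (case q of (a, r2, r3, r4, b) \<Rightarrow> r2 * r3 * r4)) * s q)"
  let ?k = "\<lambda>\<sigma> t q. cis (kernel_phase \<sigma> q ?x (- 1 * t + 0))"
  have eq: "(\<lambda>y. invariant_weight y *\<^sub>R H (quad_frame alpha3 (fst \<sigma>) (snd \<sigma>) y))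
      = (\<lambda>(t, q). h q * (indicat_real {0..<2 * pi} t *\<^sub>R ?k \<sigma> t q))" if "\<sigma> \<in> signs" for \<sigma>
  proof
    fix y :: "real \<times> real \<times> real \<times> real \<times> real \<times> real"
    obtain t q where y: "y = (t, q)" by (cases y)
    show "invariant_weight y *\<^sub>R H (quad_frame alpha3 (fst \<sigma>) (snd \<sigma>) y)
        = (case y of (t, q) \<Rightarrow> h q * (indicat_real {0..<2 * pi} t *\<^sub>R ?k \<sigma> t q))"
    proof (cases "q \<in> invariant_range")
      case True
      have "H (quad_frame alpha3 (fst \<sigma>) (snd \<sigma>) (t, q)) = ?k \<sigma> t q * s q"
        unfolding H_def inner_frames[OF that] Fs[OF True that] by simp
      then show ?thesis
        using True by (simp add: y invariant_weight_def h_def scaleR_conv_of_real mult_ac)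
    qed (simp add: y invariant_weight_def h_def)
  qed
  have "(LINT w|lborel. H w) = (\<Sum>\<sigma>\<in>signs. LINT y|lborel. (case y of (t, q) \<Rightarrow> h q * (indicat_real {0..<2 * pi} t *\<^sub>R ?k \<sigma> t q)))"
    unfolding integral_quad_frame(2)[OF H alpha3_measurable] by (intro sum.cong refl) (simp only: eq)
  also have "\<dots> = complex_of_real (8 * pi) * (LINT q|lborel. h q * T4 q (r2, \<phi>2) (r3, \<phi>3) r4)"
  proof (rule sum_integral_turn_first)
    show "integrable lborel (\<lambda>(t, q). h q * (indicat_real {0..<2 * pi} t *\<^sub>R ?k \<sigma> t q))" if "\<sigma> \<in> signs" for \<sigma>
      using integral_quad_frame(1)[OF H alpha3_measurable that] by (simp only: eq[OF that])
    fix q assume "h q \<noteq> 0"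
    then have "q \<in> invariant_range" by (cases "q \<in> invariant_range") (simp_all add: h_def)
    then show "(\<Sum>\<sigma>\<in>signs. LINT t|lborel. indicat_real {0..<2 * pi} t *\<^sub>R ?k \<sigma> t q)
        = complex_of_real (8 * pi) * T4 q (r2, \<phi>2) (r3, \<phi>3) r4"
      using T4_turn_integral[OF _ x, of q "- 1" 0] by (simp only: prod.case) simp
  qed
  also have "(\<lambda>q. h q * T4 q (r2, \<phi>2) (r3, \<phi>3) r4)
      = (\<lambda>q. indicat_real invariant_range q *\<^sub>R cumulant_integrand s (r2, \<phi>2) (r3, \<phi>3) r4 q)"
    by (auto simp: fun_eq_iff h_def cumulant_integrand_def scaleR_conv_of_real mult_ac)
  finally show ?thesis
    by (simp only: H_def set_lebesgue_integral_def)
qed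

text \<open>The dual computation in the space variables: a rotation invariant function is integrated
  against the plane waves of the four quadrilaterals with invariants \<open>q\<close>, and now the common rotation of the space
  variables produces the kernel. The result does not depend on the position \<open>\<theta>\<close> of the quadrilaterals.\<close>

lemma fourier_of_rotation_invariant:
  assumes D: "integrable lborel D"
    and inv: "\<And>t x. D (relative_frame (t, x)) = D (relative_frame (0, x))"
    and q: "q \<in> invariant_range"
  shows "(\<Sum>\<sigma>\<in>signs. LINT X|lborel. cis (X \<bullet> quad_frame alpha3 (fst \<sigma>) (snd \<sigma>) (\<theta>, q)) * D X)
    = complex_of_real (8 * pi) * (LINT x:space_range|lborel. (case x of (r2, \<phi>2, r3, \<phi>3, r4) \<Rightarrow>
        T4 q (r2, \<phi>2) (r3, \<phi>3) r4 * D (relative_frame (0, x)) * complex_of_real (r2 * r3 * r4)))"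
proof -
  define w where "w \<sigma> = quad_frame alpha3 (fst \<sigma>) (snd \<sigma>) (\<theta>, q)" for \<sigma>
  define H where "H \<sigma> X = cis (w \<sigma> \<bullet> X) * D X" for \<sigma> X
  have H: "integrable lborel (H \<sigma>)" for \<sigma>
    unfolding H_def by (rule integrable_cis_mult[OF D])
  define h where "h = (\<lambda>x. complex_of_real (indicator space_range x *
     (case x of (r2, t2, r3, t3, r4) \<Rightarrow> r2 * r3 * r4)) * D (relative_frame (0, x)))"
  let ?k = "\<lambda>\<sigma> t x. cis (kernel_phase \<sigma> q x (1 * t + - \<theta>))"
  have eq: "(\<lambda>y. space_weight y *\<^sub>R H \<sigma> (relative_frame y))
      = (\<lambda>(t, x). h x * (indicat_real {0..<2 * pi} t *\<^sub>R ?k \<sigma> t x))" if "\<sigma> \<in> signs" for \<sigma>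
  proof
    fix y :: "real \<times> real \<times> real \<times> real \<times> real \<times> real"
    obtain t x where y: "y = (t, x)" by (cases y)
    have "H \<sigma> (relative_frame (t, x)) = ?k \<sigma> t x * D (relative_frame (0, x))"
      unfolding H_def w_def inner_commute[of _ "relative_frame (t, x)"] inner_frames[OF that] inv[of t] by simp
    then show "space_weight y *\<^sub>R H \<sigma> (relative_frame y)
        = (case y of (t, x) \<Rightarrow> h x * (indicat_real {0..<2 * pi} t *\<^sub>R ?k \<sigma> t x))"
      by (simp add: y space_weight_def h_def scaleR_conv_of_real mult_ac)
  qed
  have "(\<Sum>\<sigma>\<in>signs. LINT X|lborel. H \<sigma> X) = (\<Sum>\<sigma>\<in>signs. LINT y|lborel. (case y of (t, x) \<Rightarrow> h x * (indicat_real {0..<2 * pi} t *\<^sub>R ?k \<sigma> t x)))"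
    by (intro sum.cong refl) (simp only: integral_relative_frame(2)[OF H] eq)
  also have "\<dots> = complex_of_real (8 * pi) * (LINT x|lborel. h x * (case x of (r2, \<phi>2, r3, \<phi>3, r4) \<Rightarrow> T4 q (r2, \<phi>2) (r3, \<phi>3) r4))"
  proof (rule sum_integral_turn_first)
    show "integrable lborel (\<lambda>(t, x). h x * (indicat_real {0..<2 * pi} t *\<^sub>R ?k \<sigma> t x))" if "\<sigma> \<in> signs" for \<sigma>
      using integral_relative_frame(1)[OF H] by (simp only: eq[OF that, symmetric])
    fix x assume "h x \<noteq> 0"
    then have "x \<in> space_range" by (cases "x \<in> space_range") (simp_all add: h_def)
    then show "(\<Sum>\<sigma>\<in>signs. LINT t|lborel. indicat_real {0..<2 * pi} t *\<^sub>R ?k \<sigma> t x)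
        = complex_of_real (8 * pi) * (case x of (r2, \<phi>2, r3, \<phi>3, r4) \<Rightarrow> T4 q (r2, \<phi>2) (r3, \<phi>3) r4)"
      by (intro T4_turn_integral q) auto
  qed
  also have "(\<lambda>x. h x * (case x of (r2, \<phi>2, r3, \<phi>3, r4) \<Rightarrow> T4 q (r2, \<phi>2) (r3, \<phi>3) r4))
      = (\<lambda>x. indicat_real space_range x *\<^sub>R (case x of (r2, \<phi>2, r3, \<phi>3, r4) \<Rightarrow>
        T4 q (r2, \<phi>2) (r3, \<phi>3) r4 * D (relative_frame (0, x)) * complex_of_real (r2 * r3 * r4)))"
    by (auto simp: fun_eq_iff h_def scaleR_conv_of_real mult_ac)
  finally show ?thesis
    by (simp only: H_def w_def set_lebesgue_integral_def inner_commute)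
qed

section \<open>Cumulants, trispectrum and inversion\<close>

definition rotation :: "real \<Rightarrow> real^2^2" where
  "rotation t = vector [vector [cos t, - sin t], vector [sin t, cos t]]"

lemma rotation_matrix_rotation: "rotation_matrix (rotation t)"
proof -
  have n: "rotation t $ 1 $ 1 = cos t" "rotation t $ 1 $ 2 = - sin t"
    "rotation t $ 2 $ 1 = sin t" "rotation t $ 2 $ 2 = cos t"
    by (simp_all add: rotation_def)
  have sc: "cos t * cos t + sin t * sin t = 1" "sin t * sin t + cos t * cos t = 1"
    using sin_cos_squared_add[of t] by (simp_all add: power2_eq_square)
  have "det (rotation t) = 1"
    by (simp add: det_2 n sc)
  moreover have "orthogonal_matrix (rotation t)"
    unfolding orthogonal_matrix_def
    by (simp add: vec_eq_iff forall_2 matrix_matrix_mult_def sum_2 transpose_def mat_def n sc)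
  ultimately show ?thesis by (simp add: rotation_matrix_def)
qed

lemma rotation_polar: "rotation t *v polar r u = polar r (t + u)"
  by (simp add: vec_eq_iff forall_2 matrix_vector_mult_def sum_2 rotation_def cos_add sin_add algebra_simps)

text \<open>A joint moment is an integral with respect to a finite dimensional distribution.\<close>

lemma joint_moment_isotropic:
  fixes n :: nat and B :: "nat set"
  assumes "planar_field M X" "isotropic M X" "rotation_matrix g" and B: "B \<subseteq> {..<n}"
  shows "(LINT w|M. (\<Prod>i\<in>B. X (g *v x i) w)) = (LINT w|M. (\<Prod>i\<in>B. X (x i) w))"
proof -
  interpret planar_field M X by fact
  have [measurable]: "X y \<in> borel_measurable M" for y by (rule measurable_field)
  have "(LINT w|M. (\<Prod>i\<in>B. X (y i) w)) = (LINT v|fin_dim_distr M X n y. (\<Prod>i\<in>B. v i))" for y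
  proof -
    have "(LINT v|fin_dim_distr M X n y. (\<Prod>i\<in>B. v i)) = (LINT w|M. (\<Prod>i\<in>B. (\<lambda>i\<in>{..<n}. X (y i) w) i))"
      unfolding fin_dim_distr_def
    proof (rule integral_distr)
      show "(\<lambda>w. \<lambda>i\<in>{..<n}. X (y i) w) \<in> M \<rightarrow>\<^sub>M Pi\<^sub>M {..<n} (\<lambda>_. borel)"
        by measurable
      show "(\<lambda>v. \<Prod>i\<in>B. v i) \<in> borel_measurable (Pi\<^sub>M {..<n} (\<lambda>_. borel :: real measure))"
        using B by (intro borel_measurable_prod measurable_component_singleton) auto
    qed
    also have "\<dots> = (LINT w|M. (\<Prod>i\<in>B. X (y i) w))"
      using B by (intro Bochner_Integration.integral_cong prod.cong refl) auto
    finally show ?thesis by simp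
  qed
  then show ?thesis
    using assms(2,3) by (simp add: isotropic_def)
qed

lemma cum4_isotropic:
  assumes "planar_field M X" "isotropic M X" "rotation_matrix g"
  shows "cum4 M X (g *v x1) (g *v x2) (g *v x3) (g *v x4) = cum4 M X x1 x2 x3 x4"
proof -
  have eq: "(LINT w|M. (\<Prod>i\<in>B. X ([g *v x1, g *v x2, g *v x3, g *v x4] ! i) w))
      = (LINT w|M. (\<Prod>i\<in>B. X ([x1, x2, x3, x4] ! i) w))" if B: "B \<subseteq> {..<4}" for B :: "nat set"
  proof -
    have "(LINT w|M. (\<Prod>i\<in>B. X ([g *v x1, g *v x2, g *v x3, g *v x4] ! i) w))
        = (LINT w|M. (\<Prod>i\<in>B. X (g *v ([x1, x2, x3, x4] ! i)) w))"
    proof (intro Bochner_Integration.integral_cong prod.cong refl)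
      fix w i assume "i \<in> B"
      then have "i < length [x1, x2, x3, x4]" using B by auto
      then have "map ((*v) g) [x1, x2, x3, x4] ! i = g *v ([x1, x2, x3, x4] ! i)"
        by (rule nth_map)
      then show "X ([g *v x1, g *v x2, g *v x3, g *v x4] ! i) w = X (g *v ([x1, x2, x3, x4] ! i)) w"
        by simp
    qed
    then show ?thesis
      using joint_moment_isotropic[OF assms B, of "\<lambda>i. [x1, x2, x3, x4] ! i"] by simp
  qed
  show ?thesis
    unfolding cum4_def joint_cumulant_def
  proof (intro sum.cong refl arg_cong2[where f="(*)"] prod.cong)
    fix P :: "nat set set" and B :: "nat set" assume "P \<in> {P. partition_on {..<4} P}" "B \<in> P"
    then have "B \<subseteq> {..<4}" by (auto simp: partition_on_def)
    then show "(LINT w|M. (\<Prod>i\<in>B. X ([g *v x1, g *v x2, g *v x3, g *v x4] ! i) w))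
      = (LINT w|M. (\<Prod>i\<in>B. X ([x1, x2, x3, x4] ! i) w))" by (rule eq)
  qed
qed

text \<open>The trispectrum on the hyperplane \<open>\<omega>\<^sub>1 + \<omega>\<^sub>2 + \<omega>\<^sub>3 + \<omega>\<^sub>4 = 0\<close> that carries the Dirac distribution.\<close>

definition spectral_density ::
    "(real^2 \<Rightarrow> real^2 \<Rightarrow> real^2 \<Rightarrow> real^2 \<Rightarrow> complex) \<Rightarrow> (real^2) \<times> (real^2) \<times> (real^2) \<Rightarrow> complex" where
  "spectral_density S4 = (\<lambda>(w2, w3, w4). S4 (- (w2 + w3 + w4)) w2 w3 w4)"

lemma spectral_density_integrable:
  assumes "has_trispectrum c M X S4"
  shows "integrable lborel (spectral_density S4)"
proof -
  have "integrable lborel (\<lambda>(w2, w3, w4). let w1 = - (w2 + w3 + w4)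
      in cis (0 \<bullet> w1 + 0 \<bullet> w2 + 0 \<bullet> w3 + 0 \<bullet> w4) * S4 w1 w2 w3 w4)"
    using assms unfolding has_trispectrum_def Let_def by blast
  then show ?thesis
    by (simp add: spectral_density_def Let_def)
qed

lemma cum4_eq_fourier:
  assumes "has_trispectrum c M X S4"
  shows "complex_of_real (cum4 M X 0 x2 x3 x4)
    = complex_of_real c * (LINT w|lborel. cis ((x2, x3, x4) \<bullet> w) * spectral_density S4 w)"
proof -
  have "complex_of_real (cum4 M X 0 x2 x3 x4) = complex_of_real c * (LINT w|lborel. (\<lambda>(w2, w3, w4). let w1 = - (w2 + w3 + w4)
      in cis (0 \<bullet> w1 + x2 \<bullet> w2 + x3 \<bullet> w3 + x4 \<bullet> w4) * S4 w1 w2 w3 w4) w)"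
    using assms unfolding has_trispectrum_def Let_def by blast
  also have "(\<lambda>(w2, w3, w4). let w1 = - (w2 + w3 + w4)
      in cis (0 \<bullet> w1 + x2 \<bullet> w2 + x3 \<bullet> w3 + x4 \<bullet> w4) * S4 w1 w2 w3 w4)
    = (\<lambda>w. cis ((x2, x3, x4) \<bullet> w) * spectral_density S4 w)"
    by (auto simp: fun_eq_iff spectral_density_def Let_def add.assoc)
  finally show ?thesis .
qed

lemma spectral_density_quad_frame:
  assumes S4: "function_of_invariants S4 s" and q: "q \<in> invariant_range" and \<sigma>: "\<sigma> \<in> signs"
  shows "spectral_density S4 (quad_frame alpha3 (fst \<sigma>) (snd \<sigma>) (t, q)) = s q"
proof -
  obtain w2 w3 w4 where w: "quad_frame alpha3 (fst \<sigma>) (snd \<sigma>) (t, q) = (w2, w3, w4)"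
    by (cases "quad_frame alpha3 (fst \<sigma>) (snd \<sigma>) (t, q)") auto
  have "quad_invariants (- (w2 + w3 + w4)) w2 w3 w4 = q"
    by (rule quad_invariants_quad_frame[OF q \<sigma> w])
  moreover have "- (w2 + w3 + w4) + w2 + w3 + w4 = 0" by simp
  ultimately show ?thesis
    using S4 q unfolding w spectral_density_def function_of_invariants_def by (metis prod.case)
qed

lemma isCont_opposite_angle:
  fixes f g h :: "'a::t2_space \<Rightarrow> real"
  assumes "isCont f w" "isCont g w" "isCont h w" "g w \<noteq> 0" "h w \<noteq> 0"
    and "((g w)\<^sup>2 + (h w)\<^sup>2 - (f w)\<^sup>2) / (2 * g w * h w) = cos a" "a \<in> {0<..<pi}"
  shows "isCont (\<lambda>x. opposite_angle (f x) (g x) (h x)) w"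
proof -
  have "sin a > 0" using assms(7) by (intro sin_gt_zero) auto
  then have "(cos a)\<^sup>2 < 1" using sin_cos_squared_add[of a] by (smt (verit) zero_less_power)
  then have "- 1 < cos a" "cos a < 1" by (auto simp: abs_square_less_1)
  then have "isCont arccos (((g w)\<^sup>2 + (h w)\<^sup>2 - (f w)\<^sup>2) / (2 * g w * h w))"
    unfolding assms(6) by (rule isCont_arccos)
  moreover have "isCont (\<lambda>x. ((g x)\<^sup>2 + (h x)\<^sup>2 - (f x)\<^sup>2) / (2 * g x * h x)) w"
    using assms by (intro continuous_intros) auto
  ultimately show ?thesis
    unfolding opposite_angle_def by (rule isCont_o2[rotated])
qed

text \<open>The range of the invariants is open and the invariants are continuous at nondegenerate quadrilaterals,
  so the density coincides with \<open>s\<close> of the invariants in a whole neighbourhood.\<close>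

lemma isCont_spectral_density:
  assumes S4: "function_of_invariants S4 s" and q: "q \<in> invariant_range" and \<sigma>: "\<sigma> \<in> signs"
    and c: "isCont s q"
  shows "isCont (spectral_density S4) (quad_frame alpha3 (fst \<sigma>) (snd \<sigma>) (t, q))"
proof -
  obtain w2 w3 w4 where w: "quad_frame alpha3 (fst \<sigma>) (snd \<sigma>) (t, q) = (w2, w3, w4)"
    by (cases "quad_frame alpha3 (fst \<sigma>) (snd \<sigma>) (t, q)") auto
  obtain a r2 r3 r4 b where qq: "q = (a, r2, r3, r4, b)" by (cases q) auto
  have s: "fst \<sigma> \<in> {1, - 1}" "snd \<sigma> \<in> {1, - 1}" using \<sigma> by (auto simp: signs_def)
  note n = quad_frame_angle_arguments[OF q[unfolded qq] s w[unfolded qq]]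
  have pos: "a \<in> {0<..<pi}" "r2 > 0" "r3 > 0" "r4 > 0" "b \<in> {0<..<pi}"
    using q by (auto simp: qq invariant_range_def)
  define inv where "inv = (\<lambda>w :: (real^2) \<times> (real^2) \<times> (real^2).
     quad_invariants (- (fst w + fst (snd w) + snd (snd w))) (fst w) (fst (snd w)) (snd (snd w)))"
  have inv: "inv (w2, w3, w4) = q"
    using quad_invariants_quad_frame[OF q \<sigma> w] by (simp add: inv_def)
  have "isCont inv (w2, w3, w4)"
    unfolding inv_def quad_invariants_def Let_def
  proof (intro isCont_Pair)
    have k: "diagonal r3 r4 b > 0" using diagonal_pos pos by blast
    show "isCont (\<lambda>w :: (real^2) \<times> (real^2) \<times> (real^2). opposite_angle
        (norm (- (fst w + fst (snd w) + snd (snd w)))) (norm (fst w))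
        (norm (- (fst w + fst (snd w) + snd (snd w)) + fst w))) (w2, w3, w4)"
    proof (rule isCont_opposite_angle)
      show "((norm (fst (w2, w3, w4)))\<^sup>2 + (norm (- (fst (w2, w3, w4) + fst (snd (w2, w3, w4)) + snd (snd (w2, w3, w4))) + fst (w2, w3, w4)))\<^sup>2
          - (norm (- (fst (w2, w3, w4) + fst (snd (w2, w3, w4)) + snd (snd (w2, w3, w4)))))\<^sup>2)
          / (2 * norm (fst (w2, w3, w4)) * norm (- (fst (w2, w3, w4) + fst (snd (w2, w3, w4)) + snd (snd (w2, w3, w4))) + fst (w2, w3, w4))) = cos a"
        unfolding fst_conv snd_conv n(4) n(1) by (rule n(5))
      show "norm (fst (w2, w3, w4)) \<noteq> 0"
        unfolding fst_conv n(1) using pos by simp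
      show "norm (- (fst (w2, w3, w4) + fst (snd (w2, w3, w4)) + snd (snd (w2, w3, w4))) + fst (w2, w3, w4)) \<noteq> 0"
        unfolding fst_conv snd_conv n(4) using k by simp
    qed (use pos in \<open>auto intro!: continuous_intros\<close>)
    show "isCont (\<lambda>w :: (real^2) \<times> (real^2) \<times> (real^2). opposite_angle
        (norm (- (fst w + fst (snd w) + snd (snd w)) + fst w)) (norm (fst (snd w))) (norm (snd (snd w)))) (w2, w3, w4)"
    proof (rule isCont_opposite_angle)
      show "((norm (fst (snd (w2, w3, w4))))\<^sup>2 + (norm (snd (snd (w2, w3, w4))))\<^sup>2
          - (norm (- (fst (w2, w3, w4) + fst (snd (w2, w3, w4)) + snd (snd (w2, w3, w4))) + fst (w2, w3, w4)))\<^sup>2)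
          / (2 * norm (fst (snd (w2, w3, w4))) * norm (snd (snd (w2, w3, w4)))) = cos b"
        unfolding fst_conv snd_conv n(4) n(2) n(3) by (rule n(6))
      show "norm (fst (snd (w2, w3, w4))) \<noteq> 0" "norm (snd (snd (w2, w3, w4))) \<noteq> 0"
        unfolding fst_conv snd_conv n(2) n(3) using pos by simp_all
    qed (use pos in \<open>auto intro!: continuous_intros\<close>)
  qed (auto intro!: continuous_intros)
  then have ci: "isCont (\<lambda>w. s (inv w)) (w2, w3, w4)"
    by (rule isCont_o2) (simp add: inv c)
  have "open invariant_range"
    unfolding invariant_range_def by (intro open_Times) auto
  then have "\<forall>\<^sub>F w in nhds (w2, w3, w4). inv w \<in> invariant_range"
    using \<open>isCont inv (w2, w3, w4)\<close> q inv
    by (metis isCont_def tendsto_at_iff_tendsto_nhds topological_tendstoD)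
  then have "\<forall>\<^sub>F w in nhds (w2, w3, w4). spectral_density S4 w = s (inv w)"
  proof eventually_elim
    fix w assume "inv w \<in> invariant_range"
    moreover have "- (fst w + fst (snd w) + snd (snd w)) + fst w + fst (snd w) + snd (snd w) = 0"
      by simp
    ultimately show "spectral_density S4 w = s (inv w)"
      using S4 unfolding function_of_invariants_def inv_def spectral_density_def by (simp add: split_beta)
  qed
  then show ?thesis
    unfolding w using ci isCont_cong[of "spectral_density S4" "\<lambda>w. s (inv w)" "(w2, w3, w4)"] by blast
qed

lemma C4_eq_cum4:
  "C4 M X (r2, \<phi>2) (r3, \<phi>3) r4 = cum4 M X 0 (polar r2 \<phi>2) (polar r3 \<phi>3) (polar r4 0)"
proof -
  have "r4 *\<^sub>R vector [1, 0] = polar r4 0"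
    by (simp add: polar_def vec_eq_iff forall_2)
  then show ?thesis
    by (simp add: C4_def polar_def)
qed

text \<open>Isotropy of the field passes to the transform of the density through the cumulants; this uses \<open>c \<noteq> 0\<close>.\<close>

lemma fourier_rotation_invariant:
  assumes X: "planar_field M X" "isotropic M X" and c: "c > 0" and S4: "has_trispectrum c M X S4"
  shows "(LINT w|lborel. cis (relative_frame (t, x) \<bullet> w) * spectral_density S4 w)
    = (LINT w|lborel. cis (relative_frame (0, x) \<bullet> w) * spectral_density S4 w)"
proof -
  obtain r2 \<phi>2 r3 \<phi>3 r4 where x: "x = (r2, \<phi>2, r3, \<phi>3, r4)" by (cases x) auto
  have "cum4 M X 0 (polar r2 (t + \<phi>2)) (polar r3 (t + \<phi>3)) (polar r4 t)
      = cum4 M X 0 (polar r2 \<phi>2) (polar r3 \<phi>3) (polar r4 0)"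
    using cum4_isotropic[OF X rotation_matrix_rotation, of t 0 "polar r2 \<phi>2" "polar r3 \<phi>3" "polar r4 0"]
    by (simp add: rotation_polar)
  then have "complex_of_real c * (LINT w|lborel. cis (relative_frame (t, x) \<bullet> w) * spectral_density S4 w)
    = complex_of_real c * (LINT w|lborel. cis (relative_frame (0, x) \<bullet> w) * spectral_density S4 w)"
    unfolding x relative_frame_def prod.case cum4_eq_fourier[OF S4, symmetric] by simp
  then show ?thesis using c by simp
qed

lemma norm_relative_frame: "norm (relative_frame (t, x)) = norm (relative_frame (0, x))"
  by (cases x) (simp add: relative_frame_def norm_Pair norm_polar)

text \<open>The common part of both inverse formulas. Each needs only that the smoothed density converges to
  \<open>v\<close> at the four quadrilaterals with invariants \<open>q\<close> in some position \<open>\<theta>\<close>; the assumed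
  integrability at \<open>q\<close> then allows to remove the Gaussian from the space integral.\<close>

lemma trispectrum_inversion:
  assumes X: "planar_field M X" "isotropic M X" and c: "c > 0" and S4: "has_trispectrum c M X S4"
    and q: "q \<in> invariant_range"
    and e: "e \<longlonglongrightarrow> 0" "\<And>n. e n > 0"
    and lim: "\<And>\<sigma>. \<sigma> \<in> signs \<Longrightarrow>
       (\<lambda>n. gauss_smooth (e n) (spectral_density S4) (quad_frame alpha3 (fst \<sigma>) (snd \<sigma>) (\<theta>, q))) \<longlonglongrightarrow> v"
    and int: "set_integrable lborel space_range (trispectrum_integrand M X q)"
  shows "v = complex_of_real (1 / (2 * pi * c)) * (complex_of_real (1 / (2 * pi) ^ 4)
       * (LINT x:space_range|lborel. trispectrum_integrand M X q x))"
proof -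
  define F where "F = spectral_density S4"
  have F: "integrable lborel F" unfolding F_def by (rule spectral_density_integrable[OF S4])
  define Ch where "Ch x = (LINT w|lborel. cis (x \<bullet> w) * F w)" for x
  define E where "E n x = complex_of_real (exp (- ((e n)\<^sup>2 * (norm x)\<^sup>2) / 2))" for n and x :: "(real^2) \<times> (real^2) \<times> (real^2)"
  define D where "D n x = E n x * Ch x" for n x
  let ?w = "\<lambda>\<sigma>. quad_frame alpha3 (fst \<sigma>) (snd \<sigma>) (\<theta>, q)"
  let ?L = "LINT x:space_range|lborel. trispectrum_integrand M X q x"
  \<comment> \<open>\<open>D n\<close> is the cumulant, up to the factor \<open>c\<close>, damped by the Gaussian of parameter \<open>e n\<close>.\<close>
  have D: "integrable lborel (D n)" for n
    using fourier_gauss_smooth(1)[OF e(2)[of n] F, of 0] by (simp add: D_def[abs_def] E_def Ch_def)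
  have inv: "D n (relative_frame (t, x)) = D n (relative_frame (0, x))" for n t x
    unfolding D_def E_def Ch_def F_def fourier_rotation_invariant[OF X c S4, of t] norm_relative_frame[of t] ..
  define g where "g n = (\<lambda>x. case x of (r2, \<phi>2, r3, \<phi>3, r4) \<Rightarrow>
      T4 q (r2, \<phi>2) (r3, \<phi>3) r4 * D n (relative_frame (0, x)) * complex_of_real (r2 * r3 * r4))" for n
  have dim: "DIM((real^2) \<times> (real^2) \<times> (real^2)) = 6" by simp
  \<comment> \<open>The inverse transform has the opposite phase; the opposite quadrilateral is the one turned by \<open>\<pi>\<close>.\<close>
  have id: "complex_of_real ((2 * pi) ^ 6) * (\<Sum>\<sigma>\<in>signs. gauss_smooth (e n) F (?w \<sigma>))
      = complex_of_real (8 * pi) * (LINT x:space_range|lborel. g n x)" for n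
  proof -
    have "complex_of_real ((2 * pi) ^ 6) * gauss_smooth (e n) F (?w \<sigma>)
        = (LINT X|lborel. cis (X \<bullet> quad_frame alpha3 (fst \<sigma>) (snd \<sigma>) (\<theta> + pi, q)) * D n X)" for \<sigma>
      using fourier_gauss_smooth(2)[OF e(2)[of n] F, of "?w \<sigma>"] unfolding dim
      by (simp only: D_def E_def Ch_def quad_frame_add_pi inner_minus_right mult.assoc)
    then have "complex_of_real ((2 * pi) ^ 6) * (\<Sum>\<sigma>\<in>signs. gauss_smooth (e n) F (?w \<sigma>))
        = (\<Sum>\<sigma>\<in>signs. LINT X|lborel. cis (X \<bullet> quad_frame alpha3 (fst \<sigma>) (snd \<sigma>) (\<theta> + pi, q)) * D n X)"
      by (simp only: sum_distrib_left)
    also have "\<dots> = complex_of_real (8 * pi) * (LINT x:space_range|lborel. g n x)"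
      unfolding g_def by (rule fourier_of_rotation_invariant[OF D inv q])
    finally show ?thesis .
  qed
  have cg: "complex_of_real c * g n x = E n (relative_frame (0, x)) * trispectrum_integrand M X q x" for n x
  proof -
    obtain r2 \<phi>2 r3 \<phi>3 r4 where x: "x = (r2, \<phi>2, r3, \<phi>3, r4)" by (cases x) auto
    have "complex_of_real (C4 M X (r2, \<phi>2) (r3, \<phi>3) r4) = complex_of_real c * Ch (relative_frame (0, x))"
      unfolding C4_eq_cum4 cum4_eq_fourier[OF S4] Ch_def F_def x relative_frame_def by simp
    then show ?thesis
      by (simp add: g_def trispectrum_integrand_def x D_def)
  qed
  have En: "norm (E n x) \<le> 1" for n x
    by (simp add: E_def)
  have EM [measurable]: "E n \<in> borel_measurable borel" for n
    unfolding E_def by measurable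
  have intL: "integrable lborel (\<lambda>x. indicat_real space_range x *\<^sub>R trispectrum_integrand M X q x)"
    using int by (simp add: set_integrable_def)
  have rf: "(\<lambda>x. relative_frame (0, x)) \<in> borel_measurable borel"
    by measurable
  \<comment> \<open>The damping factor is at most one, so the integrand that is assumed integrable dominates.\<close>
  have L: "(\<lambda>n. complex_of_real c * (LINT x:space_range|lborel. g n x)) \<longlonglongrightarrow> ?L"
  proof -
    have eq: "complex_of_real c * (LINT x:space_range|lborel. g n x)
        = (LINT x|lborel. E n (relative_frame (0, x)) * (indicat_real space_range x *\<^sub>R trispectrum_integrand M X q x))" for n
    proof -
      have "complex_of_real c * (LINT x:space_range|lborel. g n x)
          = (LINT x|lborel. complex_of_real c * (indicat_real space_range x *\<^sub>R g n x))"
        unfolding set_lebesgue_integral_def by (rule integral_mult_right_zero[symmetric])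
      also have "(\<lambda>x. complex_of_real c * (indicat_real space_range x *\<^sub>R g n x))
          = (\<lambda>x. E n (relative_frame (0, x)) * (indicat_real space_range x *\<^sub>R trispectrum_integrand M X q x))"
        by (simp only: mult_scaleR_right cg)
      finally show ?thesis .
    qed
    show ?thesis
      unfolding eq unfolding set_lebesgue_integral_def
    proof (rule integral_dominated_convergence[where w="\<lambda>x. norm (indicat_real space_range x *\<^sub>R trispectrum_integrand M X q x)"])
      show "integrable lborel (\<lambda>x. norm (indicat_real space_range x *\<^sub>R trispectrum_integrand M X q x))"
        using intL by (rule integrable_norm)
      show "(\<lambda>x. indicat_real space_range x *\<^sub>R trispectrum_integrand M X q x) \<in> borel_measurable lborel"
        using intL by (rule borel_measurable_integrable)
      then show "(\<lambda>x. E n (relative_frame (0, x)) * (indicat_real space_range x *\<^sub>R trispectrum_integrand M X q x)) \<in> borel_measurable lborel" for n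
        using rf by (intro borel_measurable_times) auto
      show "AE x in lborel. (\<lambda>n. E n (relative_frame (0, x)) * (indicat_real space_range x *\<^sub>R trispectrum_integrand M X q x))
          \<longlonglongrightarrow> indicat_real space_range x *\<^sub>R trispectrum_integrand M X q x"
      proof (rule AE_I2)
        fix x
        have "(\<lambda>n. E n (relative_frame (0, x)) * (indicat_real space_range x *\<^sub>R trispectrum_integrand M X q x))
          \<longlonglongrightarrow> complex_of_real (exp (- (0\<^sup>2 * (norm (relative_frame (0, x)))\<^sup>2) / 2)) * (indicat_real space_range x *\<^sub>R trispectrum_integrand M X q x)"
          unfolding E_def by (intro tendsto_intros e) simp
        then show "(\<lambda>n. E n (relative_frame (0, x)) * (indicat_real space_range x *\<^sub>R trispectrum_integrand M X q x))
          \<longlonglongrightarrow> indicat_real space_range x *\<^sub>R trispectrum_integrand M X q x" by simp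
      qed
      show "AE x in lborel. norm (E n (relative_frame (0, x)) * (indicat_real space_range x *\<^sub>R trispectrum_integrand M X q x))
          \<le> norm (indicat_real space_range x *\<^sub>R trispectrum_integrand M X q x)" for n
        by (intro AE_I2) (simp only: norm_mult mult_left_le_one_le[OF norm_ge_zero norm_ge_zero En])
    qed
  qed
  have "(\<lambda>n. complex_of_real c * (complex_of_real ((2 * pi) ^ 6) * (\<Sum>\<sigma>\<in>signs. gauss_smooth (e n) F (?w \<sigma>))))
      \<longlonglongrightarrow> complex_of_real c * (complex_of_real ((2 * pi) ^ 6) * (\<Sum>\<sigma>\<in>signs. v))"
    unfolding F_def by (intro tendsto_intros lim)
  moreover have "(\<lambda>n. complex_of_real c * (complex_of_real ((2 * pi) ^ 6) * (\<Sum>\<sigma>\<in>signs. gauss_smooth (e n) F (?w \<sigma>))))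
      \<longlonglongrightarrow> complex_of_real (8 * pi) * ?L"
    unfolding id using tendsto_mult[OF tendsto_const L, of "complex_of_real (8 * pi)"]
    by (simp only: mult.left_commute)
  ultimately have "complex_of_real c * (complex_of_real ((2 * pi) ^ 6) * (\<Sum>\<sigma>\<in>signs. v)) = complex_of_real (8 * pi) * ?L"
    by (rule LIMSEQ_unique)
  also have "(\<Sum>\<sigma>\<in>signs. v) = complex_of_real 4 * v"
    by (simp add: signs_def)
  finally have eq: "complex_of_real (4 * c * (2 * pi) ^ 6) * v = complex_of_real (8 * pi) * ?L"
    by (simp only: of_real_mult mult_ac)
  define K where "K = 4 * c * (2 * pi) ^ 6"
  have K: "K \<noteq> 0" using c by (simp add: K_def)
  have "v = complex_of_real (inverse K) * (complex_of_real K * v)"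
    using K by simp
  also have "\<dots> = complex_of_real (inverse K * (8 * pi)) * ?L"
    using eq by (simp only: K_def of_real_mult mult.assoc)
  also have "inverse K * (8 * pi) = 1 / (2 * pi * c) * (1 / (2 * pi) ^ 4)"
    using c by (simp add: K_def field_simps eval_nat_numeral)
  finally show ?thesis by (simp only: of_real_mult mult.assoc)
qed

text \<open>Almost every frame coordinate is good for all four sign pairs. By Fubini a single position \<open>\<theta>\<close> can be
  chosen that is good for almost every \<open>q\<close>.\<close>

lemma AE_smooth_quad_frame:
  assumes F: "integrable lborel F" and e: "e \<longlonglongrightarrow> 0" "\<And>n. e n > 0"
  obtains r \<theta> where "strict_mono r"
    "AE q in lborel. q \<in> invariant_range \<longrightarrow> (\<forall>\<sigma>\<in>signs.
       (\<lambda>n. gauss_smooth (e (r n)) F (quad_frame alpha3 (fst \<sigma>) (snd \<sigma>) (\<theta>, q))) \<longlonglongrightarrow> F (quad_frame alpha3 (fst \<sigma>) (snd \<sigma>) (\<theta>, q)))"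
proof -
  obtain r where r: "strict_mono r" "AE w in lborel. (\<lambda>n. gauss_smooth (e (r n)) F w) \<longlonglongrightarrow> F w"
    using gauss_smooth_AE_subseq[OF F e] by blast
  define P where "P w \<longleftrightarrow> (\<lambda>n. gauss_smooth (e (r n)) F w) \<longlonglongrightarrow> F w" for w
  have "AE y in lborel. \<forall>\<sigma>\<in>signs. invariant_weight y > 0 \<longrightarrow> P (quad_frame alpha3 (fst \<sigma>) (snd \<sigma>) y)"
  proof (rule AE_finite_allI)
    show "finite signs" by (simp add: signs_def)
    show "AE y in lborel. invariant_weight y > 0 \<longrightarrow> P (quad_frame alpha3 (fst \<sigma>) (snd \<sigma>) y)" if "\<sigma> \<in> signs" for \<sigma>
      using r(2) by (intro AE_quad_frame alpha3_measurable that) (simp add: P_def)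
  qed
  then have "AE y in lborel \<Otimes>\<^sub>M lborel. \<forall>\<sigma>\<in>signs. invariant_weight y > 0 \<longrightarrow> P (quad_frame alpha3 (fst \<sigma>) (snd \<sigma>) y)"
    by (simp only: lborel_prod)
  then have "AE t in lborel. AE q in lborel. \<forall>\<sigma>\<in>signs. invariant_weight (t, q) > 0 \<longrightarrow> P (quad_frame alpha3 (fst \<sigma>) (snd \<sigma>) (t, q))"
    by (rule lborel_pair.AE_pair)
  then have "\<exists>t\<in>{0..<2 * pi}. AE q in lborel. \<forall>\<sigma>\<in>signs. invariant_weight (t, q) > 0 \<longrightarrow> P (quad_frame alpha3 (fst \<sigma>) (snd \<sigma>) (t, q))"
    (is "\<exists>t\<in>_. ?Q t")
  proof (rule contrapos_pp)
    assume "\<not> (\<exists>t\<in>{0..<2 * pi}. ?Q t)"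
    show "\<not> (AE t in lborel. ?Q t)"
    proof
      assume "AE t in lborel. ?Q t"
      then have "AE t in lborel. t \<notin> {0..<2 * pi}"
        by eventually_elim (use \<open>\<not> (\<exists>t\<in>{0..<2 * pi}. ?Q t)\<close> in blast)
      then have "emeasure lborel {0..<2 * pi} = 0"
        by (subst (asm) AE_iff_measurable[where N="{0..<2 * pi}"]) auto
      then show False by simp
    qed
  qed
  then obtain t where t: "t \<in> {0..<2 * pi}" "?Q t" by blast
  show thesis
  proof (rule that[OF r(1)])
    show "AE q in lborel. q \<in> invariant_range \<longrightarrow> (\<forall>\<sigma>\<in>signs.
       (\<lambda>n. gauss_smooth (e (r n)) F (quad_frame alpha3 (fst \<sigma>) (snd \<sigma>) (t, q))) \<longlonglongrightarrow> F (quad_frame alpha3 (fst \<sigma>) (snd \<sigma>) (t, q)))"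
      using t(2)
    proof eventually_elim
      fix q assume Q: "\<forall>\<sigma>\<in>signs. invariant_weight (t, q) > 0 \<longrightarrow> P (quad_frame alpha3 (fst \<sigma>) (snd \<sigma>) (t, q))"
      have "invariant_weight (t, q) > 0" if "q \<in> invariant_range"
        using that t(1) by (auto simp: invariant_weight_def invariant_range_def)
      then show "q \<in> invariant_range \<longrightarrow> (\<forall>\<sigma>\<in>signs.
       (\<lambda>n. gauss_smooth (e (r n)) F (quad_frame alpha3 (fst \<sigma>) (snd \<sigma>) (t, q))) \<longlonglongrightarrow> F (quad_frame alpha3 (fst \<sigma>) (snd \<sigma>) (t, q)))"
        using Q by (simp add: P_def)
    qed
  qed
qed

theorem theorem1:
  fixes M :: "'a measure"
    and X :: "real^2 \<Rightarrow> 'a \<Rightarrow> real"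
    and S4 :: "real^2 \<Rightarrow> real^2 \<Rightarrow> real^2 \<Rightarrow> real^2 \<Rightarrow> complex"
    and s :: "real \<times> real \<times> real \<times> real \<times> real \<Rightarrow> complex"
    and c :: real
  assumes "planar_field M X"
    and "homogeneous M X"
    and "isotropic M X"
    and "c > 0"
    and "has_trispectrum c M X S4"
    and "function_of_invariants S4 s"
  shows "(\<forall>r2>0. \<forall>r3>0. \<forall>r4>0. \<forall>\<phi>2\<in>{0..<2 * pi}. \<forall>\<phi>3\<in>{0..<2 * pi}.
            set_integrable lborel invariant_range (cumulant_integrand s (r2, \<phi>2) (r3, \<phi>3) r4) \<longrightarrow>
            complex_of_real (C4 M X (r2, \<phi>2) (r3, \<phi>3) r4) =
              complex_of_real (2 * pi * c)
              * (4 * (LINT q:invariant_range|lborel. cumulant_integrand s (r2, \<phi>2) (r3, \<phi>3) r4 q)))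
       \<and> (AE q in lborel. q \<in> invariant_range \<longrightarrow>
            set_integrable lborel space_range (trispectrum_integrand M X q) \<longrightarrow>
            s q = complex_of_real (1 / (2 * pi * c))
              * (complex_of_real (1 / (2 * pi) ^ 4)
                 * (LINT x:space_range|lborel. trispectrum_integrand M X q x)))
       \<and> (\<forall>q\<in>invariant_range. isCont s q \<longrightarrow>
            set_integrable lborel space_range (trispectrum_integrand M X q) \<longrightarrow>
            s q = complex_of_real (1 / (2 * pi * c))
              * (complex_of_real (1 / (2 * pi) ^ 4)
                 * (LINT x:space_range|lborel. trispectrum_integrand M X q x)))"
proof (intro conjI allI impI ballI)
  define F where "F = spectral_density S4"
  have F: "integrable lborel F"
    unfolding F_def using assms(5) by (rule spectral_density_integrable)
  have Fs: "F (quad_frame alpha3 (fst \<sigma>) (snd \<sigma>) (t, q)) = s q" if "q \<in> invariant_range" "\<sigma> \<in> signs" for q t \<sigma>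
    unfolding F_def using assms(6) that by (rule spectral_density_quad_frame)
  define e where "e n = inverse (real (Suc n))" for n
  have e: "e \<longlonglongrightarrow> 0" "e n > 0" for n
    unfolding e_def by (rule LIMSEQ_inverse_real_of_nat) simp
  {
    fix r2 r3 r4 \<phi>2 \<phi>3 :: real
    assume "r2 > 0" "r3 > 0" "r4 > 0" "\<phi>2 \<in> {0..<2 * pi}" "\<phi>3 \<in> {0..<2 * pi}"
    then have "(r2, \<phi>2, r3, \<phi>3, r4) \<in> space_range"
      by (simp add: space_range_def)
    from fourier_of_function_of_invariants[OF F Fs this]
    have "(LINT w|lborel. cis (relative_frame (0, r2, \<phi>2, r3, \<phi>3, r4) \<bullet> w) * F w)
      = complex_of_real (8 * pi) * (LINT q:invariant_range|lborel. cumulant_integrand s (r2, \<phi>2) (r3, \<phi>3) r4 q)" .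
    then show "complex_of_real (C4 M X (r2, \<phi>2) (r3, \<phi>3) r4) =
              complex_of_real (2 * pi * c)
              * (4 * (LINT q:invariant_range|lborel. cumulant_integrand s (r2, \<phi>2) (r3, \<phi>3) r4 q))"
      unfolding C4_eq_cum4 cum4_eq_fourier[OF assms(5)] F_def relative_frame_def by simp
  }
  {
    obtain r \<theta> where r: "strict_mono r" and ae: "AE q in lborel. q \<in> invariant_range \<longrightarrow> (\<forall>\<sigma>\<in>signs.
       (\<lambda>n. gauss_smooth (e (r n)) F (quad_frame alpha3 (fst \<sigma>) (snd \<sigma>) (\<theta>, q))) \<longlonglongrightarrow> F (quad_frame alpha3 (fst \<sigma>) (snd \<sigma>) (\<theta>, q)))"
      using AE_smooth_quad_frame[OF F e] by blast
    have er: "(\<lambda>n. e (r n)) \<longlonglongrightarrow> 0"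
      using LIMSEQ_subseq_LIMSEQ[OF e(1) r] by (simp add: o_def)
    show "AE q in lborel. q \<in> invariant_range \<longrightarrow>
            set_integrable lborel space_range (trispectrum_integrand M X q) \<longrightarrow>
            s q = complex_of_real (1 / (2 * pi * c))
              * (complex_of_real (1 / (2 * pi) ^ 4)
                 * (LINT x:space_range|lborel. trispectrum_integrand M X q x))"
      using ae
    proof (eventually_elim, intro impI)
      fix q
      assume lim: "q \<in> invariant_range \<longrightarrow> (\<forall>\<sigma>\<in>signs.
         (\<lambda>n. gauss_smooth (e (r n)) F (quad_frame alpha3 (fst \<sigma>) (snd \<sigma>) (\<theta>, q))) \<longlonglongrightarrow> F (quad_frame alpha3 (fst \<sigma>) (snd \<sigma>) (\<theta>, q)))"
        and q: "q \<in> invariant_range" and int: "set_integrable lborel space_range (trispectrum_integrand M X q)"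
      have "(\<lambda>n. gauss_smooth (e (r n)) (spectral_density S4) (quad_frame alpha3 (fst \<sigma>) (snd \<sigma>) (\<theta>, q))) \<longlonglongrightarrow> s q"
        if "\<sigma> \<in> signs" for \<sigma>
        using lim[rule_format, OF q that] by (simp only: Fs[OF q that] F_def[symmetric])
      then show "s q = complex_of_real (1 / (2 * pi * c))
              * (complex_of_real (1 / (2 * pi) ^ 4)
                 * (LINT x:space_range|lborel. trispectrum_integrand M X q x))"
        by (rule trispectrum_inversion[OF assms(1,3,4,5) q er e(2) _ int])
    qed
  }
  {
    fix q
    assume q: "q \<in> invariant_range" and c: "isCont s q"
      and int: "set_integrable lborel space_range (trispectrum_integrand M X q)"
    have "(\<lambda>n. gauss_smooth (e n) (spectral_density S4) (quad_frame alpha3 (fst \<sigma>) (snd \<sigma>) (0, q))) \<longlonglongrightarrow> s q"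
      if "\<sigma> \<in> signs" for \<sigma>
    proof -
      have "(\<lambda>n. gauss_smooth (e n) F (quad_frame alpha3 (fst \<sigma>) (snd \<sigma>) (0, q))) \<longlonglongrightarrow> F (quad_frame alpha3 (fst \<sigma>) (snd \<sigma>) (0, q))"
        using gauss_smooth_tendsto_isCont[OF F isCont_spectral_density[OF assms(6) q that c, folded F_def] e] .
      then show ?thesis by (simp only: Fs[OF q that] F_def[symmetric])
    qed
    then show "s q = complex_of_real (1 / (2 * pi * c))
              * (complex_of_real (1 / (2 * pi) ^ 4)
                 * (LINT x:space_range|lborel. trispectrum_integrand M X q x))"
      by (rule trispectrum_inversion[OF assms(1,3,4,5) q e _ int])
  }
qed

end
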